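(* Let $\Gamma_\delta=C_4$ be the metric cycle with four vertices $V_1,V_2,V_3,V_4$ enumerated consecutively around the cycle and four edges of rationally independent lengths $l_1,l_2,l_3,l_4$ (each edge joining two cyclically consecutive vertices), all four vertices being of $\delta$ type. Let $A_{\vec\alpha}$ and $A_{\vec{\widetilde\alpha}}$ be two graph Laplacians on $\Gamma_\delta$ with coupling constants $\vec\alpha,\vec{\widetilde\alpha}\in\mathbb R^4$, and assume that the coupling constants at all vertices are non-zero for both Laplacians. If the spectra of $A_{\vec\alpha}$ and $A_{\vec{\widetilde\alpha}}$ coincide counting multiplicities, then $\vec\alpha=\vec{\widetilde\alpha}$, unless $\vec\alpha=(\alpha,-\alpha,\alpha,-\alpha)$ and $\vec{\widetilde\alpha}=(-\alpha,\alpha,-\alpha,\alpha)$ for some real $\alpha$. Conversely, in the latter case, i.e. whenever $\vec\alpha=(\alpha,-\alpha,\alpha,-\alpha)$ and $\vec{\widetilde\alpha}=(-\alpha,\alpha,-\alpha,\alpha)$ for some real $\alpha$, the operators $A_{\vec\alpha}$ and $A_{\vec{\widetilde\alpha}}$ are isospectral (have the same spectrum counting multiplicities).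
   Context: A finite compact metric graph $\Gamma$ consists of finitely many compact intervals (edges) $\Delta_j=[x_{2j-1},x_{2j}]$ together with a partition of the set of endpoints into classes $V_1,V_2,\dots$ (vertices). The valence $\gamma_k=\deg V_k$ is the number of endpoints belonging to $V_k$. Put $L_2(\Gamma)=\bigoplus_j L_2(\Delta_j)$, $W_2^2(\Gamma)=\bigoplus_j W_2^2(\Delta_j)$. The normal derivative of $f\in W_2^2(\Gamma)$ at an endpoint is $\partial_n f(x_j)=f'(x_j)$ if $x_j$ is the left endpoint of its edge and $-f'(x_j)$ if it is the right endpoint. When all vertices are of $\delta$ type and $\vec\alpha$ is a vector of real coupling constants (one constant $\alpha_k$ for each vertex $V_k$), the graph Laplacian $A_{\vec\alpha}$ is the self-adjoint operator in $L_2(\Gamma)$ acting on each edge as $-\frac{d^2}{dx^2}$, on the domain of all $f\in W_2^2(\Gamma)$ that are continuous at every vertex (i.e. $f(x_i)=f(x_j)=:f(V_k)$ for all $x_i,x_j\in V_k$) and satisfy $\sum_{x_j\in V_k}\partial_n f(x_j)=\alpha_k f(V_k)$ for every $k$. Its spectrum is purely discrete. Edge lengths are called rationally independent if they are linearly independent over $\mathbb Q$. *)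

theory Defs
  imports "HOL-Analysis.Analysis" "HOL-Library.Function_Algebras"
begin

datatype 'e endpoint = Lft 'e | Rgt 'e

instance endpoint :: (finite) finite
proof
  have "(UNIV :: 'a endpoint set) = range Lft \<union> range Rgt"
    by (metis UNIV_eq_I UnI1 UnI2 endpoint.exhaust rangeI)
  then show "finite (UNIV :: 'a endpoint set)"
    by (metis finite_UnI finite_imageI finite)
qed

text \<open>
  The edges are the intervals \<open>[lo G e, hi G e]\<close>, indexed by the finite type \<open>'e\<close>; they are
  treated as disjoint copies, so overlapping coordinates are harmless. The vertices are the
  classes \<open>vertex G k\<close> of endpoints, indexed by the finite type \<open>'v\<close>.
\<close>

record ('e, 'v) metric_graph =
  lo :: "'e \<Rightarrow> real"
  hi :: "'e \<Rightarrow> real"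
  vertex :: "'v \<Rightarrow> 'e endpoint set"

definition metric_graph :: "('e::finite, 'v::finite) metric_graph \<Rightarrow> bool" where
  "metric_graph G \<longleftrightarrow>
     (\<forall>e. lo G e < hi G e) \<and>
     (\<forall>k. vertex G k \<noteq> {}) \<and> disjoint_family (vertex G) \<and> (\<Union>k. vertex G k) = UNIV"

definition edge :: "('e, 'v) metric_graph \<Rightarrow> 'e \<Rightarrow> real set" where
  "edge G e = {lo G e..hi G e}"

definition edge_length :: "('e, 'v) metric_graph \<Rightarrow> 'e \<Rightarrow> real" where
  "edge_length G e = hi G e - lo G e"

definition rationally_independent :: "('i::finite \<Rightarrow> real) \<Rightarrow> bool" where
  "rationally_independent l \<longleftrightarrow>
     (\<forall>q :: 'i \<Rightarrow> rat. (\<Sum>i\<in>UNIV. of_rat (q i) * l i) = 0 \<longrightarrow> (\<forall>i. q i = 0))"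

text \<open>
  A function on the graph is a family of complex functions, one for each edge. Elements of
  \<open>L2 G\<close> are representatives: two of them are the same vector iff they agree almost everywhere
  on every edge, and their values off the edges are irrelevant.
\<close>

type_synonym 'e graph_fun = "'e \<Rightarrow> real \<Rightarrow> complex"

definition cscale :: "complex \<Rightarrow> 'e graph_fun \<Rightarrow> 'e graph_fun" where
  "cscale c f = (\<lambda>e x. c * f e x)"

lemma vector_space_cscale: "vector_space (cscale :: complex \<Rightarrow> 'e graph_fun \<Rightarrow> 'e graph_fun)"
  by unfold_locales (auto simp: cscale_def fun_eq_iff algebra_simps)

definition L2 :: "('e::finite, 'v) metric_graph \<Rightarrow> 'e graph_fun set" where
  "L2 G = {f. \<forall>e. f e \<in> borel_measurable (lebesgue_on (edge G e)) \<and>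
                  integrable (lebesgue_on (edge G e)) (\<lambda>x. (cmod (f e x))\<^sup>2)}"

definition L2_norm :: "('e::finite, 'v) metric_graph \<Rightarrow> 'e graph_fun \<Rightarrow> real" where
  "L2_norm G f = sqrt (\<Sum>e\<in>UNIV. LINT x|lebesgue_on (edge G e). (cmod (f e x))\<^sup>2)"

definition edge_deriv :: "('e, 'v) metric_graph \<Rightarrow> 'e graph_fun \<Rightarrow> 'e \<Rightarrow> real \<Rightarrow> complex" where
  "edge_deriv G f e x = vector_derivative (f e) (at x within edge G e)"

text \<open>
  For \<open>g \<in> L2 G\<close>: every \<open>f e\<close> is continuously differentiable on its closed edge, with an
  absolutely continuous derivative whose almost everywhere derivative is \<open>g e\<close>.
\<close>

definition has_second_deriv ::
    "('e, 'v) metric_graph \<Rightarrow> 'e graph_fun \<Rightarrow> 'e graph_fun \<Rightarrow> bool" where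
  "has_second_deriv G f g \<longleftrightarrow>
     (\<forall>e. \<forall>x\<in>edge G e. f e differentiable (at x within edge G e) \<and>
        edge_deriv G f e x =
          edge_deriv G f e (lo G e) + (LINT t|lebesgue_on {lo G e..x}. g e t))"

text \<open>
  The Sobolev space \<open>W\<^sub>2\<^sup>2\<close>. In contrast to \<open>L2\<close>, each of its elements is given by its unique
  continuously differentiable representative, normalised to \<open>0\<close> off the edges; distinct
  elements of the set are therefore distinct vectors.
\<close>

definition W22 :: "('e::finite, 'v) metric_graph \<Rightarrow> 'e graph_fun set" where
  "W22 G = {f. (\<forall>e x. x \<notin> edge G e \<longrightarrow> f e x = 0) \<and> (\<exists>g\<in>L2 G. has_second_deriv G f g)}"

fun endpoint_value :: "('e, 'v) metric_graph \<Rightarrow> 'e graph_fun \<Rightarrow> 'e endpoint \<Rightarrow> complex" where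
  "endpoint_value G f (Lft e) = f e (lo G e)"
| "endpoint_value G f (Rgt e) = f e (hi G e)"

fun normal_deriv :: "('e, 'v) metric_graph \<Rightarrow> 'e graph_fun \<Rightarrow> 'e endpoint \<Rightarrow> complex" where
  "normal_deriv G f (Lft e) = edge_deriv G f e (lo G e)"
| "normal_deriv G f (Rgt e) = - edge_deriv G f e (hi G e)"

text \<open>The matching condition of \<open>\<delta>\<close> type; \<open>c\<close> is the common value of \<open>f\<close> at the vertex.\<close>

definition delta_condition ::
    "('e::finite, 'v) metric_graph \<Rightarrow> real \<Rightarrow> 'v \<Rightarrow> 'e graph_fun \<Rightarrow> bool" where
  "delta_condition G a k f \<longleftrightarrow>
     (\<exists>c. (\<forall>p\<in>vertex G k. endpoint_value G f p = c) \<and>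
          (\<Sum>p\<in>vertex G k. normal_deriv G f p) = of_real a * c)"

definition laplacian_domain ::
    "('e::finite, 'v::finite) metric_graph \<Rightarrow> real^'v \<Rightarrow> 'e graph_fun set" where
  "laplacian_domain G \<alpha> = {f \<in> W22 G. \<forall>k. delta_condition G (\<alpha> $ k) k f}"

text \<open>
  An operator in \<open>L2 G\<close> is given by its graph, the set of pairs \<open>(f, h)\<close> for which \<open>h\<close>
  represents the image of \<open>f\<close>. Here \<open>f\<close> is the representative fixed in \<open>W22 G\<close>, while \<open>h\<close> is any
  representative of \<open>- f''\<close>.
\<close>

type_synonym 'e graph_op = "('e graph_fun \<times> 'e graph_fun) set"

definition graph_laplacian ::
    "('e::finite, 'v::finite) metric_graph \<Rightarrow> real^'v \<Rightarrow> 'e graph_op" where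
  "graph_laplacian G \<alpha> =
     {(f, h). f \<in> laplacian_domain G \<alpha> \<and> h \<in> L2 G \<and> has_second_deriv G f (- h)}"

text \<open>
  \<open>z\<close> is in the resolvent set iff \<open>A - z\<close> is a bijection from the domain of \<open>A\<close> onto \<open>L2 G\<close> with
  bounded inverse; \<open>(f, g + z f) \<in> A\<close> says that \<open>(A - z) f = g\<close>.
\<close>

definition resolvent_set ::
    "('e::finite, 'v) metric_graph \<Rightarrow> 'e graph_op \<Rightarrow> complex set" where
  "resolvent_set G A =
     {z. (\<forall>g\<in>L2 G. \<exists>!f. (f, g + cscale z f) \<in> A) \<and>
         (\<exists>C. \<forall>g\<in>L2 G. \<forall>f. (f, g + cscale z f) \<in> A \<longrightarrow> L2_norm G f \<le> C * L2_norm G g)}"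

definition op_spectrum :: "('e::finite, 'v) metric_graph \<Rightarrow> 'e graph_op \<Rightarrow> complex set" where
  "op_spectrum G A = - resolvent_set G A"

definition eigenspace :: "'e graph_op \<Rightarrow> complex \<Rightarrow> 'e graph_fun set" where
  "eigenspace A z = {f. (f, cscale z f) \<in> A}"

text \<open>
  Meaningful for operators with purely discrete spectrum: every eigenspace is then finite
  dimensional, and for self-adjoint operators its dimension is the multiplicity of the point
  of the spectrum. Since the first components of \<open>graph_laplacian G \<alpha>\<close> are fixed representatives,
  the dimension is that of the space of eigenvectors in \<open>L2 G\<close>.
\<close>

definition multiplicity_of :: "'e graph_op \<Rightarrow> complex \<Rightarrow> nat" where
  "multiplicity_of A z = vector_space.dim cscale (eigenspace A z)"

definition isospectral ::
    "('e::finite, 'v) metric_graph \<Rightarrow> 'e graph_op \<Rightarrow> 'e graph_op \<Rightarrow> bool" where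
  "isospectral G A B \<longleftrightarrow>
     op_spectrum G A = op_spectrum G B \<and>
     (\<forall>z \<in> op_spectrum G A. multiplicity_of A z = multiplicity_of B z)"

text \<open>
  The metric cycle on four vertices. In the index type \<open>4\<close> arithmetic is modulo 4, so the
  vertices, in cyclic order, are \<open>1, 2, 3, 4 = 0\<close>, and edge \<open>j\<close> joins the vertices \<open>j\<close> and \<open>j + 1\<close>;
  the orientation of each edge is arbitrary.
\<close>

definition metric_C4 :: "(4, 4) metric_graph \<Rightarrow> bool" where
  "metric_C4 G \<longleftrightarrow> metric_graph G \<and>
     (\<forall>j. (Lft j \<in> vertex G j \<and> Rgt j \<in> vertex G (j + 1)) \<or>
          (Rgt j \<in> vertex G j \<and> Lft j \<in> vertex G (j + 1)))"

end

theory Submission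
  imports Defs
begin

text \<open>
  Cut the cycle at a vertex and follow a solution of \<open>- f'' = z f\<close> once around. Its value and its
  derivative along the cycle are multiplied by one \<open>2 \<times> 2\<close> matrix, the monodromy \<open>M(z)\<close>, a product
  of matrices of determinant \<open>1\<close>, one for each edge and one for each vertex. An eigenfunction is a
  fixed vector of \<open>M(z)\<close>, so eigenvalues are given by \<open>trace (M(z)) = 2\<close>. Off these points
  \<open>M(z) - 1\<close> is invertible and the resolvent equation can be solved edge by edge with bounds, hence
  the equation describes the whole spectrum (\<open>spectrum_iff\<close>). The multiplicity is \<open>2\<close> if
  \<open>M(z) = 1\<close> and \<open>1\<close> otherwise (\<open>multiplicity_of_eq\<close>). The trace is a sum over sets of vertices:
  each set contributes the product of its couplings times the product of the values
  \<open>sin (k d) / k\<close>, \<open>z = k\<^sup>2\<close>, over the lengths \<open>d\<close> of the arcs into which it cuts the cycle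
  (\<open>trace_monodromy\<close>).

  The sign of an alternating vector \<open>(a, -a, a, -a)\<close> cannot be heard because the sets of odd size
  cancel in the trace. This cancellation is a polynomial identity in the cosines and sines of the
  single edges, valid for arbitrary values of these variables. Hence one may replace the
  cosine and sine of one edge by their derivatives, and the equality of traces gives more
  equations. If \<open>M(z) = 1\<close> for \<open>\<alpha>\<close>, they leave for \<open>-\<alpha>\<close>, when its monodromy is not \<open>1\<close>, only
  solutions that are pure exponentials \<open>exp (\<mu> x)\<close> on every edge with \<open>\<mu> = \<plusminus> a / 2\<close> of alternating
  sign; closing up after one turn forces \<open>l\<^sub>1 + l\<^sub>3 = l\<^sub>2 + l\<^sub>4\<close>
  (\<open>monodromy_alternating_identity\<close>). So the multiplicities agree as well.

  Conversely, let the spectra coincide. With the perimeter \<open>L\<close>, eigenvalues \<open>k\<^sup>2\<close> lie near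
  \<open>k\<^sub>0 = 2 \<pi> n / L\<close>. Put \<open>k = k\<^sub>0 + \<kappa> / (L k\<^sub>0)\<close>. Then \<open>k\<^sup>2 (trace - 2)\<close> tends to a quadratic
  polynomial in \<open>\<kappa>\<close> as \<open>k\<^sub>0\<close> tends to infinity while the phases \<open>k\<^sub>0 l\<^sub>j\<close> converge modulo \<open>2 \<pi>\<close>.
  If the limits of the phases are the differences of four angles \<open>\<phi>\<^sub>j\<close>, its roots are half of
  \<open>\<Sum> a\<^sub>j \<plusminus> \<bar>\<Sum> a\<^sub>j exp (2 \<i> \<phi>\<^sub>j)\<bar>\<close>. By Kronecker's theorem such angles can be prescribed, because the
  lengths are rationally independent. A simple root is a limit of eigenvalues, so whatever vanishes
  at the eigenvalues vanishes in the limit (\<open>limit_vanishes_at_simple_root\<close>). Therefore \<open>\<Sum> a\<^sub>j\<close>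
  and all the numbers \<open>\<bar>\<Sum> \<plusminus> a\<^sub>j\<bar>\<close> are determined, so all products \<open>a\<^sub>i a\<^sub>j\<close> are, and the vector of
  nonzero couplings is known up to sign (\<open>equal_or_opposite\<close>). If both signs give the same spectrum, then
  \<open>\<Sum> a\<^sub>j = 0\<close>, and the cubic part of the trace vanishes at the eigenvalues, hence in the
  limit for all choices of angles with a simple root. Two choices give \<open>a\<^sub>3 + a\<^sub>4 = 0\<close> and
  \<open>a\<^sub>2 + a\<^sub>3 = 0\<close> (\<open>opposite_imp_alternating\<close>).
\<close>

section \<open>Solutions on one edge\<close>

text \<open>
  The solutions of \<open>f'' = - z f\<close> with data \<open>(1, 0)\<close> and \<open>(0, 1)\<close> at \<open>0\<close>. The choice of the square
  root does not matter, since both functions are even in it.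
\<close>

definition fcos :: "complex \<Rightarrow> real \<Rightarrow> complex" where
  "fcos z x = cos (csqrt z * of_real x)"

definition fsin :: "complex \<Rightarrow> real \<Rightarrow> complex" where
  "fsin z x = (if z = 0 then of_real x else sin (csqrt z * of_real x) / csqrt z)"

lemma fcos_0 [simp]: "fcos z 0 = 1" and fsin_0 [simp]: "fsin z 0 = 0"
  by (simp_all add: fcos_def fsin_def)

lemma fcos_minus [simp]: "fcos z (- x) = fcos z x" and fsin_minus [simp]: "fsin z (- x) = - fsin z x"
  by (simp_all add: fcos_def fsin_def)

lemma csqrt_square [simp]: "csqrt z * csqrt z = z"
  by (metis power2_csqrt power2_eq_square)

lemma fcos_fsin_add:
  "fcos z (x + y) = fcos z x * fcos z y - z * fsin z x * fsin z y"
  "fsin z (x + y) = fsin z x * fcos z y + fcos z x * fsin z y"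
  by (simp_all add: fcos_def fsin_def distrib_left cos_add sin_add field_simps)

lemma fcos_fsin_square: "(fcos z x)\<^sup>2 + z * (fsin z x)\<^sup>2 = 1"
  using fcos_fsin_add(1)[of z x "- x"] by (simp add: power2_eq_square mult.assoc)

lemma fcos_derivative [derivative_intros]:
  assumes "(g has_real_derivative g') (at x within S)"
  shows "((\<lambda>x. fcos z (g x)) has_vector_derivative (- z * fsin z (g x) * of_real g')) (at x within S)"
proof -
  have *: "((\<lambda>x. complex_of_real (g x)) has_vector_derivative of_real g') (at x within S)"
    using assms has_vector_derivative_of_real by blast
  have "((\<lambda>w. cos (csqrt z * w)) has_field_derivative (- z * fsin z (g x))) (at (of_real (g x)))"
    by (auto intro!: derivative_eq_intros simp: fsin_def field_simps)
  from field_vector_diff_chain_within[OF * has_field_derivative_at_within[OF this]]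
  show ?thesis by (simp add: fcos_def o_def mult.commute)
qed

lemma fsin_derivative [derivative_intros]:
  assumes "(g has_real_derivative g') (at x within S)"
  shows "((\<lambda>x. fsin z (g x)) has_vector_derivative (fcos z (g x) * of_real g')) (at x within S)"
proof -
  have *: "((\<lambda>x. complex_of_real (g x)) has_vector_derivative of_real g') (at x within S)"
    using assms has_vector_derivative_of_real by blast
  have "((\<lambda>w. if z = 0 then w else sin (csqrt z * w) / csqrt z) has_field_derivative (fcos z (g x))) (at (of_real (g x)))"
    by (cases "z = 0") (auto intro!: derivative_eq_intros simp: fcos_def field_simps)
  from field_vector_diff_chain_within[OF * has_field_derivative_at_within[OF this]]
  show ?thesis by (simp add: fsin_def o_def mult.commute)
qed

lemma fcos_continuous [continuous_intros]:
  "continuous_on S g \<Longrightarrow> continuous_on S (\<lambda>x. fcos z (g x))"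
  unfolding fcos_def by (intro continuous_intros continuous_on_compose2[OF continuous_on_cos]) auto

lemma fsin_continuous [continuous_intros]:
  "continuous_on S g \<Longrightarrow> continuous_on S (\<lambda>x. fsin z (g x))"
  unfolding fsin_def
  by (cases "z = 0") (auto intro!: continuous_intros continuous_on_compose2[OF continuous_on_sin])

text \<open>
  The equation \<open>- f'' = g + z f\<close> for square integrable \<open>g\<close>: the derivative \<open>f'\<close> exists everywhere, and
  only its increments are integrals of the right-hand side.
\<close>

definition edge_solution ::
    "real \<Rightarrow> real \<Rightarrow> complex \<Rightarrow> (real \<Rightarrow> complex) \<Rightarrow> (real \<Rightarrow> complex) \<Rightarrow> (real \<Rightarrow> complex) \<Rightarrow> bool" where
  "edge_solution a b z g f f' \<longleftrightarrow>
     (\<forall>x\<in>{a..b}. (f has_vector_derivative f' x) (at x within {a..b}) \<and>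
        f' x = f' a - (LINT t|lebesgue_on {a..x}. g t + z * f t))"

lemma edge_solution_continuous:
  assumes "edge_solution a b z g f f'"
  shows "continuous_on {a..b} f"
  using assms unfolding edge_solution_def
  by (meson continuous_on_vector_derivative)

lemma LINT_eq_integral_continuous:
  fixes f :: "real \<Rightarrow> complex"
  assumes "continuous_on {a..b} f" "x \<in> {a..b}"
  shows "(LINT t|lebesgue_on {a..x}. f t) = integral {a..x} f"
  using assms
  by (intro lebesgue_integral_eq_integral continuous_imp_integrable_real) (auto elim: continuous_on_subset)

lemma edge_solution_zeroI:
  assumes "\<And>x. x \<in> {a..b} \<Longrightarrow> (f has_vector_derivative f' x) (at x within {a..b})"
    and "\<And>x. x \<in> {a..b} \<Longrightarrow> (f' has_vector_derivative - z * f x) (at x within {a..b})"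
  shows "edge_solution a b z (\<lambda>_. 0) f f'"
proof -
  have cont: "continuous_on {a..b} f"
    using assms(1) by (meson continuous_on_vector_derivative)
  have "f' x = f' a - integral {a..x} (\<lambda>t. z * f t)" if "x \<in> {a..b}" for x
  proof -
    have "((\<lambda>t. - z * f t) has_integral f' x - f' a) {a..x}"
    proof (rule fundamental_theorem_of_calculus)
      show "(f' has_vector_derivative - z * f t) (at t within {a..x})" if "t \<in> {a..x}" for t
        by (rule has_vector_derivative_within_subset[OF assms(2)]) (use \<open>x \<in> {a..b}\<close> that in auto)
    qed (use that in auto)
    then have "integral {a..x} (\<lambda>t. - z * f t) = f' x - f' a" by (rule integral_unique)
    then show ?thesis by simp algebra
  qed
  moreover have "continuous_on {a..b} (\<lambda>t. z * f t)"
    using cont by (intro continuous_intros)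
  ultimately have "f' x = f' a - (LINT t|lebesgue_on {a..x}. 0 + z * f t)" if "x \<in> {a..b}" for x
    using that by (simp only: add_0 LINT_eq_integral_continuous)
  then show ?thesis
    unfolding edge_solution_def using assms(1) by blast
qed

lemma edge_solution_zeroD:
  assumes "edge_solution a b z (\<lambda>_. 0) f f'" "x \<in> {a..b}"
  shows "(f has_vector_derivative f' x) (at x within {a..b})"
    and "(f' has_vector_derivative - z * f x) (at x within {a..b})"
proof -
  show "(f has_vector_derivative f' x) (at x within {a..b})"
    using assms unfolding edge_solution_def by blast
  have cont: "continuous_on {a..b} (\<lambda>t. z * f t)"
    using edge_solution_continuous[OF assms(1)] by (intro continuous_intros)
  have eq: "f' x = f' a - integral {a..x} (\<lambda>t. z * f t)" if "x \<in> {a..b}" for x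
  proof -
    have "f' x = f' a - (LINT t|lebesgue_on {a..x}. 0 + z * f t)"
      using assms(1) that unfolding edge_solution_def by blast
    then show ?thesis by (simp only: add_0 LINT_eq_integral_continuous[OF cont that])
  qed
  have "((\<lambda>x. f' a - integral {a..x} (\<lambda>t. z * f t)) has_vector_derivative 0 - z * f x) (at x within {a..b})"
    by (rule has_vector_derivative_diff[OF has_vector_derivative_const
          integral_has_vector_derivative[OF cont assms(2)]])
  then have "((\<lambda>x. f' a - integral {a..x} (\<lambda>t. z * f t)) has_vector_derivative - z * f x) (at x within {a..b})"
    by simp
  from has_vector_derivative_transform[OF assms(2) eq this]
  show "(f' has_vector_derivative - z * f x) (at x within {a..b})"
    by simp
qed

lemma edge_solution_fundamental:
  shows "edge_solution a b z (\<lambda>_. 0) (\<lambda>x. u * fcos z (x - s) + p * fsin z (x - s))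
           (\<lambda>x. p * fcos z (x - s) - z * u * fsin z (x - s))"
  by (rule edge_solution_zeroI) (auto intro!: derivative_eq_intros simp: algebra_simps)

text \<open>
  Two Wronskians, of \<open>f\<close> with each of the fundamental solutions based at \<open>s\<close>, have derivative zero; their constant
  values are the data of \<open>f\<close> at \<open>s\<close>.
\<close>

lemma edge_solution_zero_unique:
  assumes sol: "edge_solution a b z (\<lambda>_. 0) f f'" and s: "s \<in> {a..b}" and x: "x \<in> {a..b}"
  shows "f x = f s * fcos z (x - s) + f' s * fsin z (x - s)"
    and "f' x = f' s * fcos z (x - s) - z * f s * fsin z (x - s)"
proof -
  define A where "A = (\<lambda>x. f x * fcos z (x - s) - f' x * fsin z (x - s))"
  define B where "B = (\<lambda>x. z * f x * fsin z (x - s) + f' x * fcos z (x - s))"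
  note d = edge_solution_zeroD[OF sol]
  have "(A has_vector_derivative 0) (at y within {a..b})"
       "(B has_vector_derivative 0) (at y within {a..b})" if "y \<in> {a..b}" for y
    unfolding A_def B_def using d[OF that]
    by (auto intro!: derivative_eq_intros simp: algebra_simps)
  then have "A x = A s" "B x = B s"
    using has_vector_derivative_zero_constant[of "{a..b}"] s x
    by (metis convex_real_interval(5))+
  then have A: "f x * fcos z (x - s) - f' x * fsin z (x - s) = f s"
    and B: "z * f x * fsin z (x - s) + f' x * fcos z (x - s) = f' s"
    by (simp_all add: A_def B_def)
  note sq = fcos_fsin_square[of z "x - s"]
  show "f x = f s * fcos z (x - s) + f' s * fsin z (x - s)"
    unfolding A[symmetric] B[symmetric] using sq by algebra
  show "f' x = f' s * fcos z (x - s) - z * f s * fsin z (x - s)"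
    unfolding A[symmetric] B[symmetric] using sq by algebra
qed

lemma edge_solution_diff:
  assumes f: "edge_solution a b z g f f'" and h: "edge_solution a b z g h h'"
    and g: "integrable (lebesgue_on {a..b}) g"
  shows "edge_solution a b z (\<lambda>_. 0) (\<lambda>x. f x - h x) (\<lambda>x. f' x - h' x)"
proof -
  have "f' x - h' x = f' a - h' a - (LINT t|lebesgue_on {a..x}. 0 + z * (f t - h t))" if x: "x \<in> {a..b}" for x
  proof -
    have sub: "{a..x} \<subseteq> {a..b}" using x by auto
    have int: "integrable (lebesgue_on {a..x}) (\<lambda>t. g t + z * F t)" if "edge_solution a b z g F F'" for F F'
    proof -
      have "continuous_on {a..x} (\<lambda>t. z * F t)"
        using continuous_on_subset[OF edge_solution_continuous[OF that] sub] by (intro continuous_intros)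
      then show ?thesis
        by (rule Bochner_Integration.integrable_add[OF integrable_subinterval[OF g sub] continuous_imp_integrable_real])
    qed
    have "(LINT t|lebesgue_on {a..x}. 0 + z * (f t - h t)) =
          (LINT t|lebesgue_on {a..x}. (g t + z * f t) - (g t + z * h t))"
      by (intro Bochner_Integration.integral_cong) (auto simp: algebra_simps)
    also have "\<dots> = (LINT t|lebesgue_on {a..x}. g t + z * f t) - (LINT t|lebesgue_on {a..x}. g t + z * h t)"
      by (rule Bochner_Integration.integral_diff[OF int[OF f] int[OF h]])
    also have "\<dots> = (f' a - f' x) - (h' a - h' x)"
    proof -
      have "f' x = f' a - (LINT t|lebesgue_on {a..x}. g t + z * f t)"
        and "h' x = h' a - (LINT t|lebesgue_on {a..x}. g t + z * h t)"
        using f h x unfolding edge_solution_def by blast+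
      then show ?thesis by algebra
    qed
    finally show ?thesis by algebra
  qed
  moreover have "((\<lambda>x. f x - h x) has_vector_derivative f' x - h' x) (at x within {a..b})" if "x \<in> {a..b}" for x
    using f h that unfolding edge_solution_def by (blast intro: has_vector_derivative_diff)
  ultimately show ?thesis
    unfolding edge_solution_def by blast
qed

lemma edge_solution_add_zero:
  assumes f: "edge_solution a b z g f f'" and h: "edge_solution a b z (\<lambda>_. 0) h h'"
    and g: "integrable (lebesgue_on {a..b}) g"
  shows "edge_solution a b z g (\<lambda>x. f x + h x) (\<lambda>x. f' x + h' x)"
proof -
  have "f' x + h' x = f' a + h' a - (LINT t|lebesgue_on {a..x}. g t + z * (f t + h t))" if x: "x \<in> {a..b}" for x
  proof -
    have sub: "{a..x} \<subseteq> {a..b}" using x by auto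
    have cont: "continuous_on {a..x} (\<lambda>t. z * F t)" if "edge_solution a b z k F F'" for F F' k
      using continuous_on_subset[OF edge_solution_continuous[OF that] sub] by (intro continuous_intros)
    have int: "integrable (lebesgue_on {a..x}) (\<lambda>t. g t + z * f t)"
        "integrable (lebesgue_on {a..x}) (\<lambda>t. 0 + z * h t)"
      using Bochner_Integration.integrable_add[OF integrable_subinterval[OF g sub]
          continuous_imp_integrable_real[OF cont[OF f]]]
        continuous_imp_integrable_real[OF cont[OF h]]
      by simp_all
    have "(LINT t|lebesgue_on {a..x}. g t + z * (f t + h t)) =
          (LINT t|lebesgue_on {a..x}. (g t + z * f t) + (0 + z * h t))"
      by (intro Bochner_Integration.integral_cong) (auto simp: algebra_simps)
    also have "\<dots> = (LINT t|lebesgue_on {a..x}. g t + z * f t) + (LINT t|lebesgue_on {a..x}. 0 + z * h t)"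
      by (rule Bochner_Integration.integral_add[OF int])
    also have "\<dots> = (f' a - f' x) + (h' a - h' x)"
    proof -
      have "f' x = f' a - (LINT t|lebesgue_on {a..x}. g t + z * f t)"
        and "h' x = h' a - (LINT t|lebesgue_on {a..x}. 0 + z * h t)"
        using f h x unfolding edge_solution_def by blast+
      then show ?thesis by algebra
    qed
    finally show ?thesis by algebra
  qed
  moreover have "((\<lambda>x. f x + h x) has_vector_derivative f' x + h' x) (at x within {a..b})" if "x \<in> {a..b}" for x
    using f h that unfolding edge_solution_def by (blast intro: has_vector_derivative_add)
  ultimately show ?thesis
    unfolding edge_solution_def by blast
qed

lemma integral_continuous_bound:
  fixes f :: "real \<Rightarrow> complex"
  assumes "continuous_on {a..b} f" "\<And>t. t \<in> {a..b} \<Longrightarrow> cmod (f t) \<le> B" "x \<in> {a..b}" "0 \<le> B"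
  shows "cmod (integral {a..x} f) \<le> B * (b - a)"
proof -
  have "cmod (integral {a..x} f) \<le> B * (x - a)"
    using assms by (intro integral_bound) (auto elim: continuous_on_subset)
  also have "\<dots> \<le> B * (b - a)"
    using assms by (intro mult_left_mono) auto
  finally show ?thesis .
qed

lemma fundamental_bounded:
  obtains B where "B \<ge> 0" "\<And>x. x \<in> {a..b} \<Longrightarrow> cmod (fcos z x) \<le> B"
    "\<And>x. x \<in> {a..b} \<Longrightarrow> cmod (fsin z x) \<le> B"
proof -
  have "bounded (fcos z ` {a..b})" "bounded (fsin z ` {a..b})"
    by (intro compact_imp_bounded compact_continuous_image continuous_intros compact_Icc)+
  then obtain B1 B2 where "\<And>x. x \<in> {a..b} \<Longrightarrow> cmod (fcos z x) \<le> B1"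
      "\<And>x. x \<in> {a..b} \<Longrightarrow> cmod (fsin z x) \<le> B2"
    unfolding bounded_iff by (metis imageI)
  then show ?thesis
    by (intro that[of "max 0 (max B1 B2)"]) (force simp: le_max_iff_disj)+
qed

text \<open>
  For a merely integrable \<open>g\<close> the usual variation of constants formula cannot be differentiated at every
  point. Subtracting the double integral \<open>H\<close> of \<open>g\<close> moves the roughness away: \<open>f = h - H\<close> works once
  \<open>h'' + z h = z H\<close>, and here the forcing term is continuous.
\<close>

lemma edge_particular_solution:
  assumes ab: "a < b"
  obtains K where "K \<ge> 0"
    "\<And>g. integrable (lebesgue_on {a..b}) g \<Longrightarrow>
       \<exists>f f'. edge_solution a b z g f f' \<and>
         (\<forall>x\<in>{a..b}. cmod (f x) \<le> K * (LINT t|lebesgue_on {a..b}. cmod (g t)) \<and>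
                      cmod (f' x) \<le> K * (LINT t|lebesgue_on {a..b}. cmod (g t)))"
proof -
  obtain B where B: "B \<ge> 0" "\<And>x. x \<in> {0..b-a} \<Longrightarrow> cmod (fcos z x) \<le> B"
      "\<And>x. x \<in> {0..b-a} \<Longrightarrow> cmod (fsin z x) \<le> B"
    using fundamental_bounded by blast
  define l where "l = b - a"
  have l: "l \<ge> 0" using ab by (simp add: l_def)
  define Z where "Z = cmod z"
  have Z: "Z \<ge> 0" by (simp add: Z_def)
  \<comment> \<open>The first two summands bound \<open>f\<close>, the others \<open>f'\<close>, in units of the integral of \<open>\<bar>g\<bar>\<close>.\<close>
  define K where "K = Z * (B * (B * l * l) + B * (B * l * l)) + l + (Z * (B * (B * l * l) + Z * B * (B * l * l)) + 1)"
  have K: "K \<ge> 0" using B l Z by (simp add: K_def)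
  moreover have "\<exists>f f'. edge_solution a b z g f f' \<and>
         (\<forall>x\<in>{a..b}. cmod (f x) \<le> K * (LINT t|lebesgue_on {a..b}. cmod (g t)) \<and>
                      cmod (f' x) \<le> K * (LINT t|lebesgue_on {a..b}. cmod (g t)))"
    if g: "integrable (lebesgue_on {a..b}) g" for g
  proof -
    define I where "I = (LINT t|lebesgue_on {a..b}. cmod (g t))"
    have I: "I \<ge> 0" by (simp add: I_def)
    have gI: "g integrable_on {a..b}" using integrable_on_lebesgue_on[OF g] by simp
    define G where "G = (\<lambda>x. integral {a..x} g)"
    define H where "H = (\<lambda>x. integral {a..x} G)"
    have contG: "continuous_on {a..b} G"
      unfolding G_def by (rule indefinite_integral_continuous_1[OF gI])
    have gL: "(LINT t|lebesgue_on {a..x}. g t) = G x" if "x \<in> {a..b}" for x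
      unfolding G_def using that by (intro lebesgue_integral_eq_integral integrable_subinterval[OF g]) auto
    have boundG: "cmod (G x) \<le> I" if x: "x \<in> {a..b}" for x
    proof -
      have sub: "{a..x} \<subseteq> {a..b}" using x by auto
      note gn = integrable_norm[OF g]
      have "cmod (G x) \<le> (LINT t|lebesgue_on {a..x}. cmod (g t))"
        unfolding gL[OF x, symmetric] by (rule integral_norm_bound)
      also have "\<dots> = integral {a..x} (\<lambda>t. cmod (g t))"
        by (intro lebesgue_integral_eq_integral integrable_subinterval[OF gn sub]) auto
      also have "\<dots> \<le> integral {a..b} (\<lambda>t. cmod (g t))"
        using sub by (intro integral_subset_le integrable_on_lebesgue_on integrable_subinterval[OF gn] gn) auto
      also have "\<dots> = I"
        unfolding I_def by (intro lebesgue_integral_eq_integral[symmetric] gn) auto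
      finally show ?thesis .
    qed
    have H': "(H has_vector_derivative G x) (at x within {a..b})" if "x \<in> {a..b}" for x
      unfolding H_def by (rule integral_has_vector_derivative[OF contG that])
    then have contH: "continuous_on {a..b} H"
      by (meson continuous_on_vector_derivative)
    have boundH: "cmod (H x) \<le> I * l" if "x \<in> {a..b}" for x
      unfolding H_def l_def using that boundG I by (intro integral_continuous_bound contG) auto
    define c where "c = (\<lambda>x. integral {a..x} (\<lambda>t. fcos z (t - a) * H t))"
    define s where "s = (\<lambda>x. integral {a..x} (\<lambda>t. fsin z (t - a) * H t))"
    have bc: "cmod (fcos z (x - a)) \<le> B" "cmod (fsin z (x - a)) \<le> B" if "x \<in> {a..b}" for x
      using B that by auto
    have boundc: "cmod (c x) \<le> B * (I * l) * l" and bounds: "cmod (s x) \<le> B * (I * l) * l" if "x \<in> {a..b}" for x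
      unfolding c_def s_def l_def using that boundH bc B I l ab
      by (auto intro!: integral_continuous_bound continuous_intros contH mult_mono simp: norm_mult l_def)
    have c': "(c has_vector_derivative fcos z (x - a) * H x) (at x within {a..b})"
      and s': "(s has_vector_derivative fsin z (x - a) * H x) (at x within {a..b})" if "x \<in> {a..b}" for x
      unfolding c_def s_def using that
      by (auto intro!: integral_has_vector_derivative[where f = "\<lambda>t. fcos z (t - a) * H t"]
          integral_has_vector_derivative[where f = "\<lambda>t. fsin z (t - a) * H t"] continuous_intros contH)
    \<comment> \<open>Variation of constants for the forcing term \<open>z H\<close>.\<close>
    define h where "h = (\<lambda>x. z * (fsin z (x - a) * c x - fcos z (x - a) * s x))"
    define h' where "h' = (\<lambda>x. z * (fcos z (x - a) * c x + z * fsin z (x - a) * s x))"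
    have hd: "(h has_vector_derivative h' x) (at x within {a..b})" if "x \<in> {a..b}" for x
      unfolding h_def h'_def using c'[OF that] s'[OF that]
      by (auto intro!: derivative_eq_intros simp: algebra_simps)
    have hd': "(h' has_vector_derivative z * H x - z * h x) (at x within {a..b})" if "x \<in> {a..b}" for x
    proof -
      have "(h' has_vector_derivative z * (fcos z (x - a) * (fcos z (x - a) * H x) + - z * fsin z (x - a) * c x
             + (z * fsin z (x - a) * (fsin z (x - a) * H x) + z * fcos z (x - a) * s x))) (at x within {a..b})"
        unfolding h'_def using c'[OF that] s'[OF that]
        by (auto intro!: derivative_eq_intros simp: algebra_simps)
      also have "z * (fcos z (x - a) * (fcos z (x - a) * H x) + - z * fsin z (x - a) * c x
             + (z * fsin z (x - a) * (fsin z (x - a) * H x) + z * fcos z (x - a) * s x)) = z * H x - z * h x"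
        unfolding h_def using fcos_fsin_square[of z "x - a"] by algebra
      finally show ?thesis .
    qed
    have conth: "continuous_on {a..b} h"
      using hd by (meson continuous_on_vector_derivative)
    define f where "f = (\<lambda>x. h x - H x)"
    define f' where "f' = (\<lambda>x. h' x - G x)"
    have contf: "continuous_on {a..b} (\<lambda>t. z * f t)"
      unfolding f_def by (intro continuous_intros conth contH)
    have "edge_solution a b z g f f'"
      unfolding edge_solution_def
    proof (intro ballI conjI)
      fix x assume x: "x \<in> {a..b}"
      show "(f has_vector_derivative f' x) (at x within {a..b})"
        unfolding f_def f'_def by (intro has_vector_derivative_diff hd H' x)
      have sub: "{a..x} \<subseteq> {a..b}" using x by auto
      have "((\<lambda>t. z * H t - z * h t) has_integral h' x - h' a) {a..x}"
        by (rule fundamental_theorem_of_calculus)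
          (use x in \<open>auto intro!: has_vector_derivative_within_subset[OF hd' sub]\<close>)
      also have "(\<lambda>t. z * H t - z * h t) = (\<lambda>t. - (z * f t))"
        by (simp add: f_def algebra_simps)
      finally have "integral {a..x} (\<lambda>t. - (z * f t)) = h' x - h' a"
        by (rule integral_unique)
      then have zf: "integral {a..x} (\<lambda>t. z * f t) = h' a - h' x"
        unfolding integral_neg by algebra
      have "(LINT t|lebesgue_on {a..x}. g t + z * f t) =
            (LINT t|lebesgue_on {a..x}. g t) + (LINT t|lebesgue_on {a..x}. z * f t)"
        by (intro Bochner_Integration.integral_add integrable_subinterval[OF g sub]
            continuous_imp_integrable_real continuous_on_subset[OF contf sub])
      also have "\<dots> = G x + (h' a - h' x)"
        by (simp only: gL[OF x] LINT_eq_integral_continuous[OF contf x] zf)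
      finally show "f' x = f' a - (LINT t|lebesgue_on {a..x}. g t + z * f t)"
        by (simp add: f'_def G_def)
    qed
    moreover have "cmod (f x) \<le> K * I \<and> cmod (f' x) \<le> K * I" if x: "x \<in> {a..b}" for x
    proof -
      let ?J = "B * (I * l) * l"
      have sc: "cmod (fsin z (x - a) * c x) \<le> B * ?J" "cmod (fcos z (x - a) * s x) \<le> B * ?J"
        "cmod (fcos z (x - a) * c x) \<le> B * ?J" "cmod (fsin z (x - a) * s x) \<le> B * ?J"
        unfolding norm_mult using bc[OF x] boundc[OF x] bounds[OF x] B by (auto intro!: mult_mono)
      have "cmod (h x) \<le> Z * (B * ?J + B * ?J)"
        unfolding h_def norm_mult[of z] Z_def
        by (intro mult_left_mono order_trans[OF norm_triangle_ineq4] add_mono sc) auto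
      then have 1: "cmod (f x) \<le> Z * (B * ?J + B * ?J) + I * l"
        unfolding f_def using boundH[OF x] norm_triangle_ineq4[of "h x" "H x"] by linarith
      have "cmod (h' x) \<le> Z * (B * ?J + Z * (B * ?J))"
        unfolding h'_def norm_mult[of z] Z_def mult.assoc[of z]
        by (intro mult_left_mono order_trans[OF norm_triangle_ineq] add_mono sc) (auto simp: norm_mult[of z] intro!: mult_left_mono sc)
      then have 2: "cmod (f' x) \<le> Z * (B * ?J + Z * (B * ?J)) + I"
        unfolding f'_def using boundG[OF x] norm_triangle_ineq4[of "h' x" "G x"] by linarith
      have nn: "0 \<le> Z * (B * ?J + B * ?J) + I * l" "0 \<le> Z * (B * ?J + Z * (B * ?J)) + I"
        using Z B I l by auto
      have "K * I = (Z * (B * ?J + B * ?J) + I * l) + (Z * (B * ?J + Z * (B * ?J)) + I)"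
        unfolding K_def by algebra
      then show ?thesis using 1 2 nn by linarith
    qed
    ultimately show ?thesis unfolding I_def by blast
  qed
  ultimately show ?thesis using that by blast
qed

text \<open>
  Later the data of a solution at the start of an edge serve as unknowns, so the particular solution
  should vanish there to first order. Subtracting the free solution with the same data achieves this.
\<close>

lemma edge_particular_solution_at:
  assumes ab: "a < b" and s: "s \<in> {a..b}"
  obtains K where "K \<ge> 0"
    "\<And>g. integrable (lebesgue_on {a..b}) g \<Longrightarrow>
       \<exists>f f'. edge_solution a b z g f f' \<and> f s = 0 \<and> f' s = 0 \<and>
         (\<forall>x\<in>{a..b}. cmod (f x) \<le> K * (LINT t|lebesgue_on {a..b}. cmod (g t)) \<and>
                      cmod (f' x) \<le> K * (LINT t|lebesgue_on {a..b}. cmod (g t)))"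
proof -
  obtain K where K: "K \<ge> 0" and part: "\<And>g. integrable (lebesgue_on {a..b}) g \<Longrightarrow>
       \<exists>f f'. edge_solution a b z g f f' \<and>
         (\<forall>x\<in>{a..b}. cmod (f x) \<le> K * (LINT t|lebesgue_on {a..b}. cmod (g t)) \<and>
                      cmod (f' x) \<le> K * (LINT t|lebesgue_on {a..b}. cmod (g t)))"
    using edge_particular_solution[OF ab] by blast
  obtain B where B: "B \<ge> 0" "\<And>x. x \<in> {a-s..b-s} \<Longrightarrow> cmod (fcos z x) \<le> B"
      "\<And>x. x \<in> {a-s..b-s} \<Longrightarrow> cmod (fsin z x) \<le> B"
    using fundamental_bounded by blast
  define K' where "K' = K + K * B + K * B + cmod z * (K * B)"
  have K': "K' \<ge> 0" using K B by (simp add: K'_def)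
  moreover have "\<exists>f f'. edge_solution a b z g f f' \<and> f s = 0 \<and> f' s = 0 \<and>
         (\<forall>x\<in>{a..b}. cmod (f x) \<le> K' * (LINT t|lebesgue_on {a..b}. cmod (g t)) \<and>
                      cmod (f' x) \<le> K' * (LINT t|lebesgue_on {a..b}. cmod (g t)))"
    if g: "integrable (lebesgue_on {a..b}) g" for g
  proof -
    define I where "I = (LINT t|lebesgue_on {a..b}. cmod (g t))"
    have I: "I \<ge> 0" by (simp add: I_def)
    obtain f f' where f: "edge_solution a b z g f f'"
      and bf: "\<And>x. x \<in> {a..b} \<Longrightarrow> cmod (f x) \<le> K * I" "\<And>x. x \<in> {a..b} \<Longrightarrow> cmod (f' x) \<le> K * I"
      using part[OF g] unfolding I_def by blast
    define F where "F = (\<lambda>x. f x + (- f s * fcos z (x - s) + - f' s * fsin z (x - s)))"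
    define F' where "F' = (\<lambda>x. f' x + (- f' s * fcos z (x - s) - z * - f s * fsin z (x - s)))"
    have "edge_solution a b z g F F'"
      unfolding F_def F'_def by (rule edge_solution_add_zero[OF f edge_solution_fundamental g])
    moreover have "F s = 0" "F' s = 0" by (simp_all add: F_def F'_def)
    moreover have "cmod (F x) \<le> K' * I \<and> cmod (F' x) \<le> K' * I" if x: "x \<in> {a..b}" for x
    proof -
      have b: "cmod (fcos z (x - s)) \<le> B" "cmod (fsin z (x - s)) \<le> B" using B x by auto
      have p: "cmod (f s * fcos z (x - s)) \<le> K * I * B" "cmod (f' s * fsin z (x - s)) \<le> K * I * B"
        "cmod (f' s * fcos z (x - s)) \<le> K * I * B" "cmod (f s * fsin z (x - s)) \<le> K * I * B"
        unfolding norm_mult using b bf[OF s] K I B by (auto intro!: mult_mono)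
      have q: "cmod (z * (f s * fsin z (x - s))) \<le> cmod z * (K * I * B)"
        unfolding norm_mult[of z] by (intro mult_left_mono p) auto
      have nn: "0 \<le> K * I * B" "0 \<le> cmod z * (K * I * B)" using K I B by auto
      have KI: "K' * I = K * I + K * I * B + K * I * B + cmod z * (K * I * B)"
        unfolding K'_def by algebra
      have "F x = f x - (f s * fcos z (x - s) + f' s * fsin z (x - s))"
        unfolding F_def by algebra
      then have "cmod (F x) \<le> cmod (f x) + (cmod (f s * fcos z (x - s)) + cmod (f' s * fsin z (x - s)))"
        by (metis norm_triangle_ineq norm_triangle_ineq4 add_left_mono order_trans)
      then have 1: "cmod (F x) \<le> K' * I"
        unfolding KI using p(1,2) bf(1)[OF x] nn by linarith
      have "F' x = f' x + (z * (f s * fsin z (x - s)) - f' s * fcos z (x - s))"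
        unfolding F'_def by algebra
      then have "cmod (F' x) \<le> cmod (f' x) + (cmod (z * (f s * fsin z (x - s))) + cmod (f' s * fcos z (x - s)))"
        by (metis norm_triangle_ineq norm_triangle_ineq4 add_left_mono order_trans)
      then have 2: "cmod (F' x) \<le> K' * I"
        unfolding KI using p(3) q bf(2)[OF x] nn by linarith
      show ?thesis using 1 2 by simp
    qed
    ultimately show ?thesis unfolding I_def by blast
  qed
  ultimately show ?thesis using that by blast
qed

text \<open>
  The Cauchy--Schwarz inequality up to a constant, from \<open>2 \<bar>g\<bar> \<le> r + \<bar>g\<bar>\<^sup>2 / r\<close> with \<open>r\<close> slightly above
  \<open>N\<close>; the slack \<open>d\<close> keeps \<open>r\<close> positive when \<open>N = 0\<close>.
\<close>

lemma square_integrable_imp_integrable: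
  fixes g :: "real \<Rightarrow> complex"
  assumes m: "g \<in> borel_measurable (lebesgue_on {a..b})"
    and sq: "integrable (lebesgue_on {a..b}) (\<lambda>x. (cmod (g x))\<^sup>2)"
    and N: "(LINT x|lebesgue_on {a..b}. (cmod (g x))\<^sup>2) \<le> N\<^sup>2" "N \<ge> 0" and ab: "a \<le> b"
  shows "integrable (lebesgue_on {a..b}) g"
    and "(LINT x|lebesgue_on {a..b}. cmod (g x)) \<le> (b - a + 1) * N"
proof -
  have c: "integrable (lebesgue_on {a..b}) (\<lambda>_. k :: real)" for k
    by (intro continuous_imp_integrable_real continuous_intros)
  have am: "cmod (g x) \<le> (r + (cmod (g x))\<^sup>2 / r) / 2" if "r > 0" for r x
  proof -
    have "0 \<le> (r - cmod (g x))\<^sup>2" by simp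
    then show ?thesis using that by (simp add: field_simps power2_eq_square)
  qed
  have i: "integrable (lebesgue_on {a..b}) (\<lambda>x. (r + (cmod (g x))\<^sup>2 / r) / 2)" for r
    using sq c by (intro Bochner_Integration.integrable_divide Bochner_Integration.integrable_add) auto
  show gi: "integrable (lebesgue_on {a..b}) g"
    by (rule Bochner_Integration.integrable_bound[OF i[of 1] m]) (use am[of 1] in \<open>auto intro!: AE_I2\<close>)
  have "(LINT x|lebesgue_on {a..b}. cmod (g x)) \<le> (b - a + 1) * N + e" if e: "e > 0" for e
  proof -
    define d where "d = e / (b - a + 1)"
    have d: "d > 0" using e ab by (simp add: d_def)
    let ?L = "N + d"
    have L: "?L > 0" using N d by simp
    have "(LINT x|lebesgue_on {a..b}. cmod (g x)) \<le> (LINT x|lebesgue_on {a..b}. (?L + (cmod (g x))\<^sup>2 / ?L) / 2)"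
      by (intro integral_mono integrable_norm gi i am L)
    also have "\<dots> = ((LINT x|lebesgue_on {a..b}. ?L) + (LINT x|lebesgue_on {a..b}. (cmod (g x))\<^sup>2) / ?L) / 2"
      using sq c by (simp add: Bochner_Integration.integral_add)
    also have "(LINT x|lebesgue_on {a..b}. ?L) = ?L * (b - a)"
      using ab lebesgue_integral_eq_integral[OF c[of ?L]] by simp
    also have "(?L * (b - a) + (LINT x|lebesgue_on {a..b}. (cmod (g x))\<^sup>2) / ?L) / 2 \<le> (?L * (b - a) + ?L) / 2"
    proof -
      have "N\<^sup>2 \<le> ?L\<^sup>2" using N d by (intro power_mono) auto
      then have "(LINT x|lebesgue_on {a..b}. (cmod (g x))\<^sup>2) \<le> ?L * ?L"
        using N by (simp add: power2_eq_square)
      then have "(LINT x|lebesgue_on {a..b}. (cmod (g x))\<^sup>2) / ?L \<le> ?L"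
        using L by (simp add: divide_le_eq)
      then show ?thesis by (intro divide_right_mono add_left_mono) auto
    qed
    also have "\<dots> \<le> (?L * (b - a) + ?L)"
    proof -
      have "0 \<le> ?L * (b - a)" using L ab by (intro mult_nonneg_nonneg) auto
      then have "0 \<le> ?L * (b - a) + ?L" using L by linarith
      moreover have "X / 2 \<le> X" if "0 \<le> X" for X :: real using that by simp
      ultimately show ?thesis by blast
    qed
    also have "\<dots> = (b - a + 1) * N + (b - a + 1) * d" by (simp add: algebra_simps)
    also have "(b - a + 1) * d = e" using ab by (simp add: d_def)
    finally show ?thesis .
  qed
  then show "(LINT x|lebesgue_on {a..b}. cmod (g x)) \<le> (b - a + 1) * N"
    by (rule field_le_epsilon)
qed

section \<open>Travelling around the cycle\<close>

text \<open>
  Edge \<open>j\<close> is always travelled from vertex \<open>j\<close> to vertex \<open>j + 1\<close>; it is \<open>forward\<close> if its coordinate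
  increases on the way.
\<close>

definition forward :: "(4, 4) metric_graph \<Rightarrow> 4 \<Rightarrow> bool" where
  "forward G j \<longleftrightarrow> Lft j \<in> vertex G j"

definition start_pt :: "(4, 4) metric_graph \<Rightarrow> 4 \<Rightarrow> real" where
  "start_pt G j = (if forward G j then lo G j else hi G j)"

definition end_pt :: "(4, 4) metric_graph \<Rightarrow> 4 \<Rightarrow> real" where
  "end_pt G j = (if forward G j then hi G j else lo G j)"

text \<open>
  The factor that turns a derivative in the coordinate into a derivative along the direction of travel.
\<close>

definition dir :: "(4, 4) metric_graph \<Rightarrow> 4 \<Rightarrow> complex" where
  "dir G j = (if forward G j then 1 else - 1)"

text \<open>
  The matrices act on pairs (value, derivative along the direction of travel): the first crosses an edge
  with cosine \<open>c\<close> and sine \<open>s\<close>, the second crosses a vertex of coupling \<open>a\<close>, where the derivative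
  jumps.
\<close>

definition edge_matrix :: "complex \<Rightarrow> complex \<Rightarrow> complex \<Rightarrow> complex^2^2" where
  "edge_matrix z c s = vector [vector [c, s], vector [- z * s, c]]"

definition vertex_matrix :: "complex \<Rightarrow> complex^2^2" where
  "vertex_matrix a = vector [vector [1, 0], vector [a, 1]]"

lemma vertex_matrix_apply: "vertex_matrix a *v x = vector [x $ 1, x $ 2 + a * x $ 1]"
  by (simp add: vertex_matrix_def matrix_vector_mult_def vec_eq_iff forall_2 sum_2)

lemma edge_matrix_apply: "edge_matrix z c s *v x = vector [c * x $ 1 + s * x $ 2, c * x $ 2 - z * s * x $ 1]"
  by (simp add: edge_matrix_def matrix_vector_mult_def vec_eq_iff forall_2 sum_2)


definition around :: "(4 \<Rightarrow> complex^2^2) \<Rightarrow> complex^2^2" where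
  "around X = X 4 ** X 3 ** X 2 ** X 1"

lemma four_cycle: "(1::4) + 1 = 2" "(2::4) + 1 = 3" "(3::4) + 1 = 4" "(4::4) + 1 = 1"
  by simp_all

lemma cyclic_recurrence_iff:
  "(\<forall>k::4. w (k + 1) = X k *v w k + r k) \<longleftrightarrow>
     w 2 = X 1 *v w 1 + r 1 \<and> w 3 = X 2 *v w 2 + r 2 \<and> w 4 = X 3 *v w 3 + r 3 \<and>
     w 1 - around X *v w 1 = X 4 *v (X 3 *v (X 2 *v r 1 + r 2) + r 3) + r 4"
  (is "_ \<longleftrightarrow> ?R")
proof -
  have "(\<forall>k::4. w (k + 1) = X k *v w k + r k) \<longleftrightarrow>
     w 2 = X 1 *v w 1 + r 1 \<and> w 3 = X 2 *v w 2 + r 2 \<and> w 4 = X 3 *v w 3 + r 3 \<and> w 1 = X 4 *v w 4 + r 4"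
    unfolding forall_4 four_cycle by blast
  also have "\<dots> \<longleftrightarrow> ?R"
  proof -
    have "X 4 *v (X 3 *v (X 2 *v (X 1 *v w 1 + r 1) + r 2) + r 3) + r 4
        = around X *v w 1 + (X 4 *v (X 3 *v (X 2 *v r 1 + r 2) + r 3) + r 4)"
      by (simp only: around_def matrix_vector_mul_assoc matrix_mul_assoc matrix_vector_right_distrib add.assoc)
    then have "w 1 = X 4 *v w 4 + r 4 \<longleftrightarrow>
        w 1 - around X *v w 1 = X 4 *v (X 3 *v (X 2 *v r 1 + r 2) + r 3) + r 4"
      if "w 2 = X 1 *v w 1 + r 1" "w 3 = X 2 *v w 2 + r 2" "w 4 = X 3 *v w 3 + r 3"
      unfolding that(3) that(2) that(1) diff_eq_eq by (simp only: add.commute)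
    then show ?thesis by blast
  qed
  finally show ?thesis .
qed

lemma matrix_apply_bound:
  fixes A :: "complex^2^2"
  obtains B where "B \<ge> 0" "\<And>x. norm (A *v x) \<le> B * norm x"
proof -
  have "linear (\<lambda>x. A *v x)"
    by (intro linearI) (simp_all add: matrix_vector_mult_def vec_eq_iff sum_2 algebra_simps)
  then have "bounded_linear (\<lambda>x. A *v x)" by (simp add: linear_conv_bounded_linear)
  from bounded_linear.nonneg_bounded[OF this] show ?thesis
    using that by (metis mult.commute)
qed

text \<open>
  Going around once, the recurrence becomes a linear equation with matrix \<open>1 - around X\<close> for the value at
  vertex \<open>1\<close>; the other values follow by substitution, and each substitution keeps a bound that is linear
  in the size of the inhomogeneity.
\<close>

lemma cyclic_recurrence_solvable:
  assumes "det (around X - mat 1) \<noteq> 0"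
  shows "\<exists>!w. \<forall>k. w (k + 1) = X k *v w k + r k"
    and "\<exists>B\<ge>0. \<forall>r w. (\<forall>k. w (k + 1) = X k *v w k + r k) \<longrightarrow> (\<forall>k. norm (w k) \<le> B * (\<Sum>k\<in>UNIV. norm (r k)))"
proof -
  have "det (around X - mat 1) = det (mat 1 - around X)"
    by (simp add: det_2 mat_def algebra_simps)
  then have "invertible (mat 1 - around X)"
    using assms by (simp add: invertible_det_nz)
  then obtain N where N: "N ** (mat 1 - around X) = mat 1" "(mat 1 - around X) ** N = mat 1"
    unfolding invertible_def by blast
  have N1: "v - around X *v v = y \<longleftrightarrow> v = N *v y" for v y
  proof -
    have "v - around X *v v = (mat 1 - around X) *v v"
      by (simp add: matrix_vector_mult_diff_rdistrib)
    then show ?thesis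
      using N by (metis matrix_vector_mul_assoc matrix_vector_mul_lid)
  qed
  define S where "S = (\<lambda>r :: 4 \<Rightarrow> complex^2. X 4 *v (X 3 *v (X 2 *v r 1 + r 2) + r 3) + r 4)"
  have iff: "(\<forall>k::4. w (k + 1) = X k *v w k + r k) \<longleftrightarrow>
     w 2 = X 1 *v w 1 + r 1 \<and> w 3 = X 2 *v w 2 + r 2 \<and> w 4 = X 3 *v w 3 + r 3 \<and> w 1 = N *v S r" for w r
    unfolding cyclic_recurrence_iff N1 S_def by blast
  show "\<exists>!w. \<forall>k. w (k + 1) = X k *v w k + r k"
  proof (rule ex1I)
    define w1 where "w1 = N *v S r"
    define w2 where "w2 = X 1 *v w1 + r 1"
    define w3 where "w3 = X 2 *v w2 + r 2"
    define w4 where "w4 = X 3 *v w3 + r 3"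
    define W where "W = (\<lambda>k::4. if k = 1 then w1 else if k = 2 then w2 else if k = 3 then w3 else w4)"
    have W: "W 1 = w1" "W 2 = w2" "W 3 = w3" "W 4 = w4"
      by (simp_all add: W_def)
    show "\<forall>k. W (k + 1) = X k *v W k + r k"
      unfolding iff W w4_def w3_def w2_def w1_def by blast
    fix w assume "\<forall>k. w (k + 1) = X k *v w k + r k"
    then have "w 1 = w1" "w 2 = w2" "w 3 = w3" "w 4 = w4"
      unfolding iff w1_def w2_def w3_def w4_def by auto
    then show "w = W"
      unfolding fun_eq_iff forall_4 W by blast
  qed
  have "\<forall>k. \<exists>B\<ge>0. \<forall>x. norm (X k *v x) \<le> B * norm x"
    by (meson matrix_apply_bound)
  then obtain B where B: "\<And>k. B k \<ge> 0" "\<And>k x. norm (X k *v x) \<le> B k * norm x"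
    by metis
  obtain b where b: "b \<ge> 0" "\<And>x. norm (N *v x) \<le> b * norm x"
    using matrix_apply_bound[of N] by blast
  have step: "norm (X k *v x + y) \<le> (B k * c + 1) * R" if "norm x \<le> c * R" "norm y \<le> R" for k x y c R
  proof -
    have "norm (X k *v x + y) \<le> B k * norm x + norm y"
      using norm_triangle_ineq[of "X k *v x" y] B(2)[of k x] by linarith
    also have "\<dots> \<le> B k * (c * R) + R"
      using that B by (intro add_mono mult_left_mono) auto
    finally show ?thesis by (simp add: algebra_simps)
  qed
  define c2 where "c2 = B 2 * 1 + 1"
  define c3 where "c3 = B 3 * c2 + 1"
  define c4 where "c4 = B 4 * c3 + 1"
  define d1 where "d1 = b * c4"
  define d2 where "d2 = B 1 * d1 + 1"
  define d3 where "d3 = B 2 * d2 + 1"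
  define d4 where "d4 = B 3 * d3 + 1"
  have nn: "0 \<le> d1" "0 \<le> d2" "0 \<le> d3" "0 \<le> d4"
    unfolding d4_def d3_def d2_def d1_def c4_def c3_def c2_def using B(1) b(1) by auto
  show "\<exists>B\<ge>0. \<forall>r w. (\<forall>k. w (k + 1) = X k *v w k + r k) \<longrightarrow> (\<forall>k. norm (w k) \<le> B * (\<Sum>k\<in>UNIV. norm (r k)))"
  proof (intro exI[of _ "d1 + d2 + d3 + d4"] conjI allI impI)
    fix r w and k :: 4
    assume "\<forall>k. w (k + 1) = X k *v w k + r k"
    then have w: "w 2 = X 1 *v w 1 + r 1" "w 3 = X 2 *v w 2 + r 2" "w 4 = X 3 *v w 3 + r 3" "w 1 = N *v S r"
      unfolding iff by auto
    define R where "R = (\<Sum>k\<in>UNIV. norm (r k))"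
    have R: "norm (r k) \<le> R" for k
      unfolding R_def by (intro member_le_sum) auto
    have R0: "0 \<le> R" unfolding R_def by (intro sum_nonneg) auto
    have "norm (S r) \<le> c4 * R"
      unfolding S_def c4_def c3_def c2_def by (intro step R) (use R in simp)
    then have "b * norm (S r) \<le> b * (c4 * R)" using b(1) by (rule mult_left_mono)
    then have 1: "norm (w 1) \<le> d1 * R"
      unfolding w(4) d1_def using b(2)[of "S r"] by (simp add: mult.assoc)
    then have 2: "norm (w 2) \<le> d2 * R" unfolding w(1) d2_def by (intro step R)
    then have 3: "norm (w 3) \<le> d3 * R" unfolding w(2) d3_def by (intro step R)
    then have 4: "norm (w 4) \<le> d4 * R" unfolding w(3) d4_def by (intro step R)
    have "0 \<le> d1 * R" "0 \<le> d2 * R" "0 \<le> d3 * R" "0 \<le> d4 * R" using nn R0 by auto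
    moreover have "norm (w k) \<le> d1 * R \<or> norm (w k) \<le> d2 * R \<or> norm (w k) \<le> d3 * R \<or> norm (w k) \<le> d4 * R"
      using 1 2 3 4 exhaust_4[of k] by auto
    ultimately have "norm (w k) \<le> d1 * R + d2 * R + d3 * R + d4 * R" by linarith
    then show "norm (w k) \<le> (d1 + d2 + d3 + d4) * (\<Sum>k\<in>UNIV. norm (r k))"
      unfolding R_def by (simp add: algebra_simps)
  qed (use nn in auto)
qed

section \<open>The operator on the cycle\<close>

locale cycle =
  fixes G :: "(4, 4) metric_graph"
  assumes C4: "metric_C4 G"
begin

lemma lo_less_hi: "lo G e < hi G e"
  using C4 unfolding metric_C4_def metric_graph_def by blast

lemma edge_eq: "edge G e = {lo G e..hi G e}"
  by (simp add: edge_def)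

lemma pts_in_edge: "start_pt G e \<in> {lo G e..hi G e}" "end_pt G e \<in> {lo G e..hi G e}"
  using lo_less_hi[of e] by (auto simp: start_pt_def end_pt_def)

lemma dir_square [simp]: "dir G e * dir G e = 1"
  by (simp add: dir_def)

lemma fcos_end: "fcos z (end_pt G e - start_pt G e) = fcos z (edge_length G e)"
  using fcos_minus[of z "hi G e - lo G e"] by (simp add: end_pt_def start_pt_def edge_length_def)

lemma fsin_end: "fsin z (end_pt G e - start_pt G e) = dir G e * fsin z (edge_length G e)"
  using fsin_minus[of z "hi G e - lo G e"] by (simp add: end_pt_def start_pt_def edge_length_def dir_def)

definition start_end :: "4 \<Rightarrow> 4 endpoint" where
  "start_end j = (if forward G j then Lft j else Rgt j)"

definition finish_end :: "4 \<Rightarrow> 4 endpoint" where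
  "finish_end j = (if forward G j then Rgt j else Lft j)"

lemma vertex_disjoint: "p \<in> vertex G i \<Longrightarrow> p \<in> vertex G j \<Longrightarrow> i = j"
  using C4 unfolding metric_C4_def metric_graph_def disjoint_family_on_def by blast

lemma ends_in_vertex: "start_end j \<in> vertex G j" "finish_end j \<in> vertex G (j + 1)"
proof -
  have "\<not> (Lft j \<in> vertex G j \<and> Lft j \<in> vertex G (j + 1))"
    using vertex_disjoint[of _ j "j + 1"] by auto
  then show "start_end j \<in> vertex G j" "finish_end j \<in> vertex G (j + 1)"
    using C4 unfolding start_end_def finish_end_def forward_def metric_C4_def by auto
qed

text \<open>
  The vertices partition the eight endpoints, and the four edges already place two endpoints in each vertex;
  nothing else fits.
\<close>

lemma vertex_eq: "vertex G (k + 1) = {start_end (k + 1), finish_end k}"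
proof
  show "{start_end (k + 1), finish_end k} \<subseteq> vertex G (k + 1)"
    using ends_in_vertex by auto
  show "vertex G (k + 1) \<subseteq> {start_end (k + 1), finish_end k}"
  proof
    fix p assume p: "p \<in> vertex G (k + 1)"
    obtain e where "p = start_end e \<or> p = finish_end e"
      unfolding start_end_def finish_end_def by (cases p) (metis (full_types))+
    then show "p \<in> {start_end (k + 1), finish_end k}"
      using p ends_in_vertex[of e] vertex_disjoint by (metis add_right_cancel insertCI)
  qed
qed

lemma start_neq_finish: "start_end (k + 1) \<noteq> finish_end k"
  using ends_in_vertex[of k] by (auto simp: start_end_def finish_end_def)

lemma delta_condition_iff:
  "delta_condition G a (k + 1) f \<longleftrightarrow>
     f (k + 1) (start_pt G (k + 1)) = f k (end_pt G k) \<and>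
     dir G (k + 1) * edge_deriv G f (k + 1) (start_pt G (k + 1)) =
       dir G k * edge_deriv G f k (end_pt G k) + of_real a * f (k + 1) (start_pt G (k + 1))"
proof -
  have "endpoint_value G f (start_end e) = f e (start_pt G e)" 
    "endpoint_value G f (finish_end e) = f e (end_pt G e)"
    "normal_deriv G f (start_end e) = dir G e * edge_deriv G f e (start_pt G e)"
    "normal_deriv G f (finish_end e) = - dir G e * edge_deriv G f e (end_pt G e)" for e
    by (simp_all add: start_end_def finish_end_def start_pt_def end_pt_def dir_def)
  then show ?thesis
    unfolding delta_condition_def vertex_eq using start_neq_finish[of k]
    by (auto simp: algebra_simps)
qed

lemma edge_deriv_eq:
  assumes "edge_solution (lo G e) (hi G e) z g (f e) f'" "x \<in> {lo G e..hi G e}"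
  shows "edge_deriv G f e x = f' x"
proof -
  have "(f e has_vector_derivative f' x) (at x within cbox (lo G e) (hi G e))"
    using assms unfolding edge_solution_def cbox_interval by blast
  then show ?thesis
    using vector_derivative_within_cbox[OF lo_less_hi] assms(2)
    unfolding edge_deriv_def edge_eq cbox_interval by blast
qed

lemma L2_add:
  assumes g: "g \<in> L2 G" and f: "\<And>e. continuous_on (edge G e) (f e)"
  shows "g + cscale z f \<in> L2 G"
  unfolding L2_def
proof (intro CollectI allI conjI)
  fix e
  have c: "continuous_on {lo G e..hi G e} (\<lambda>x. z * f e x)"
    using f[of e] unfolding edge_eq by (intro continuous_intros)
  have gm: "g e \<in> borel_measurable (lebesgue_on (edge G e))"
    and gs: "integrable (lebesgue_on (edge G e)) (\<lambda>x. (cmod (g e x))\<^sup>2)"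
    using g unfolding L2_def by auto
  have fm: "(\<lambda>x. z * f e x) \<in> borel_measurable (lebesgue_on (edge G e))"
    unfolding edge_eq by (rule continuous_imp_measurable_on_sets_lebesgue[OF c]) simp
  show m: "(g + cscale z f) e \<in> borel_measurable (lebesgue_on (edge G e))"
    using borel_measurable_add[OF gm fm] by (simp add: cscale_def plus_fun_def)
  have "integrable (lebesgue_on (edge G e)) (\<lambda>x. (cmod (z * f e x))\<^sup>2)"
    unfolding edge_eq by (intro continuous_imp_integrable_real continuous_on_power continuous_on_norm c)
  then have i: "integrable (lebesgue_on (edge G e)) (\<lambda>x. 2 * (cmod (g e x))\<^sup>2 + 2 * (cmod (z * f e x))\<^sup>2)"
    using gs by (intro Bochner_Integration.integrable_add Bochner_Integration.integrable_mult_right)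
  have le: "(cmod ((g + cscale z f) e x))\<^sup>2 \<le> 2 * (cmod (g e x))\<^sup>2 + 2 * (cmod (z * f e x))\<^sup>2" for x
  proof -
    have "(cmod ((g + cscale z f) e x))\<^sup>2 \<le> (cmod (g e x) + cmod (z * f e x))\<^sup>2"
      by (intro power_mono) (simp_all add: cscale_def norm_triangle_ineq)
    also have "\<dots> \<le> 2 * (cmod (g e x))\<^sup>2 + 2 * (cmod (z * f e x))\<^sup>2"
      using zero_le_power2[of "cmod (g e x) - cmod (z * f e x)"] by (simp add: power2_eq_square algebra_simps)
    finally show ?thesis .
  qed
  have m2: "(\<lambda>x. (cmod ((g + cscale z f) e x))\<^sup>2) \<in> borel_measurable (lebesgue_on (edge G e))"
    by (intro borel_measurable_power measurable_compose[OF m borel_measurable_norm])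
  show "integrable (lebesgue_on (edge G e)) (\<lambda>x. (cmod ((g + cscale z f) e x))\<^sup>2)"
  proof (rule Bochner_Integration.integrable_bound[OF i m2], rule AE_I2)
    fix x
    show "norm ((cmod ((g + cscale z f) e x))\<^sup>2) \<le> norm (2 * (cmod (g e x))\<^sup>2 + 2 * (cmod (z * f e x))\<^sup>2)"
      unfolding real_norm_def
      by (rule order_trans[OF eq_refl[OF abs_of_nonneg] order_trans[OF le abs_ge_self]]) simp
  qed
qed

lemma L2_uminus: "g \<in> L2 G \<Longrightarrow> - g \<in> L2 G"
  unfolding L2_def by (auto simp: fun_Compl_def)

lemma L2_zero: "0 \<in> L2 G"
  unfolding L2_def by (auto simp: zero_fun_def)

text \<open>
  The resolvent equation, with the derivative made explicit and the matching conditions written along the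
  direction of travel.
\<close>

lemma graph_laplacian_iff:
  assumes g: "g \<in> L2 G"
  shows "(f, g + cscale z f) \<in> graph_laplacian G \<alpha> \<longleftrightarrow>
     (\<forall>e x. x \<notin> edge G e \<longrightarrow> f e x = 0) \<and>
     (\<exists>f'. (\<forall>e. edge_solution (lo G e) (hi G e) z (g e) (f e) (f' e)) \<and>
        (\<forall>k. f (k + 1) (start_pt G (k + 1)) = f k (end_pt G k) \<and>
           dir G (k + 1) * f' (k + 1) (start_pt G (k + 1)) =
             dir G k * f' k (end_pt G k) + of_real (\<alpha> $ (k + 1)) * f (k + 1) (start_pt G (k + 1))))"
    (is "?lhs \<longleftrightarrow> ?supp \<and> (\<exists>f'. ?rhs f')")
proof
  have delta: "(\<forall>k. delta_condition G (\<alpha> $ k) k f) \<longleftrightarrow> (\<forall>k. delta_condition G (\<alpha> $ (k + 1)) (k + 1) f)"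
    by (metis diff_add_cancel)
  have minus: "(- (g + cscale z f)) e t = - (g e t + z * f e t)" for e t
    by (simp add: cscale_def)
  {
    assume ?lhs
    then have f: "f \<in> W22 G" "\<forall>k. delta_condition G (\<alpha> $ (k + 1)) (k + 1) f"
      and sd: "has_second_deriv G f (- (g + cscale z f))"
      unfolding graph_laplacian_def laplacian_domain_def delta[symmetric] by auto
    have "edge_solution (lo G e) (hi G e) z (g e) (f e) (edge_deriv G f e)" for e
      unfolding edge_solution_def
    proof (intro ballI conjI)
      fix x assume x: "x \<in> {lo G e..hi G e}"
      show "(f e has_vector_derivative edge_deriv G f e x) (at x within {lo G e..hi G e})"
        using sd x unfolding has_second_deriv_def edge_deriv_def edge_eq vector_derivative_works by blast
      have "edge_deriv G f e x = edge_deriv G f e (lo G e) + (LINT t|lebesgue_on {lo G e..x}. - (g e t + z * f e t))"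
        using sd x unfolding has_second_deriv_def edge_eq minus by blast
      then show "edge_deriv G f e x = edge_deriv G f e (lo G e) - (LINT t|lebesgue_on {lo G e..x}. g e t + z * f e t)"
        unfolding Bochner_Integration.integral_minus by simp
    qed
    then have "?rhs (edge_deriv G f)"
      using f(2) unfolding delta_condition_iff by blast
    moreover have ?supp using f(1) unfolding W22_def by blast
    ultimately show "?supp \<and> (\<exists>f'. ?rhs f')" by blast
  }
  assume "?supp \<and> (\<exists>f'. ?rhs f')"
  then obtain f' where supp: ?supp and sol: "\<And>e. edge_solution (lo G e) (hi G e) z (g e) (f e) (f' e)"
    and match: "\<And>k. f (k + 1) (start_pt G (k + 1)) = f k (end_pt G k) \<and>
           dir G (k + 1) * f' (k + 1) (start_pt G (k + 1)) =
             dir G k * f' k (end_pt G k) + of_real (\<alpha> $ (k + 1)) * f (k + 1) (start_pt G (k + 1))"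
    by blast
  have ed: "edge_deriv G f e x = f' e x" if "x \<in> {lo G e..hi G e}" for e x
    using edge_deriv_eq[of e z "g e" f "f' e"] sol that by blast
  have "delta_condition G (\<alpha> $ (k + 1)) (k + 1) f" for k
    using match[of k] unfolding delta_condition_iff ed[OF pts_in_edge(1)] ed[OF pts_in_edge(2)] .
  then have d: "\<forall>k. delta_condition G (\<alpha> $ k) k f" unfolding delta by blast
  have "has_second_deriv G f (- (g + cscale z f))"
    unfolding has_second_deriv_def edge_eq minus
  proof (intro allI ballI conjI)
    fix e x assume x: "x \<in> {lo G e..hi G e}"
    show "f e differentiable (at x within {lo G e..hi G e})"
      using sol[of e] x unfolding edge_solution_def by (blast intro: differentiableI_vector)
    have lo: "lo G e \<in> {lo G e..hi G e}" using lo_less_hi[of e] by auto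
    have "f' e x = f' e (lo G e) - (LINT t|lebesgue_on {lo G e..x}. g e t + z * f e t)"
      using sol[of e] x unfolding edge_solution_def by blast
    then show "edge_deriv G f e x = edge_deriv G f e (lo G e) + (LINT t|lebesgue_on {lo G e..x}. - (g e t + z * f e t))"
      unfolding ed[OF x] ed[OF lo] Bochner_Integration.integral_minus by simp
  qed
  moreover have "g + cscale z f \<in> L2 G"
    using edge_solution_continuous[OF sol] by (intro L2_add[OF g]) (simp add: edge_eq)
  ultimately show ?lhs
    using supp d unfolding graph_laplacian_def laplacian_domain_def W22_def
    by (auto intro: bexI[of _ "- (g + cscale z f)"] L2_uminus)
qed

end

lemma edge_solution_cong:
  assumes sol: "edge_solution a b z g f f'" and eq: "\<And>x. x \<in> {a..b} \<Longrightarrow> h x = f x"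
  shows "edge_solution a b z g h f'"
  unfolding edge_solution_def
proof (intro ballI conjI)
  fix x assume x: "x \<in> {a..b}"
  have "(f has_vector_derivative f' x) (at x within {a..b})"
    using sol x unfolding edge_solution_def by blast
  from has_vector_derivative_transform[OF x eq this]
  show "(h has_vector_derivative f' x) (at x within {a..b})"
    by simp
  have "f' x = f' a - (LINT t|lebesgue_on {a..x}. g t + z * f t)"
    using sol x unfolding edge_solution_def by blast
  also have "(LINT t|lebesgue_on {a..x}. g t + z * f t) = (LINT t|lebesgue_on {a..x}. g t + z * h t)"
    using x eq by (intro Bochner_Integration.integral_cong) auto
  finally show "f' x = f' a - (LINT t|lebesgue_on {a..x}. g t + z * h t)" .
qed

context cycle
begin

definition transfer :: "real^4 \<Rightarrow> complex \<Rightarrow> 4 \<Rightarrow> complex^2^2" where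
  "transfer \<alpha> z k = vertex_matrix (of_real (\<alpha> $ (k + 1))) **
     edge_matrix z (fcos z (edge_length G k)) (fsin z (edge_length G k))"

definition monodromy :: "real^4 \<Rightarrow> complex \<Rightarrow> complex^2^2" where
  "monodromy \<alpha> z = around (transfer \<alpha> z)"

text \<open>
  The function on the cycle that solves the free equation on each edge \<open>e\<close> and has the data \<open>w e\<close> at the
  start of that edge.
\<close>

definition wave :: "complex \<Rightarrow> (4 \<Rightarrow> complex^2) \<Rightarrow> 4 graph_fun" where
  "wave z w = (\<lambda>e x. if x \<in> edge G e
     then w e $ 1 * fcos z (x - start_pt G e) + dir G e * w e $ 2 * fsin z (x - start_pt G e) else 0)"

lemma square_integrable_edge:
  assumes "g \<in> L2 G"
  shows "integrable (lebesgue_on {lo G e..hi G e}) (g e)"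
    and "(LINT x|lebesgue_on {lo G e..hi G e}. cmod (g e x)) \<le> (edge_length G e + 1) * L2_norm G g"
proof -
  have g: "g e \<in> borel_measurable (lebesgue_on {lo G e..hi G e})"
      "integrable (lebesgue_on {lo G e..hi G e}) (\<lambda>x. (cmod (g e x))\<^sup>2)"
    using assms unfolding L2_def edge_eq by auto
  have nn: "0 \<le> (\<Sum>e\<in>UNIV. LINT x|lebesgue_on (edge G e). (cmod (g e x))\<^sup>2)"
    by (intro sum_nonneg Bochner_Integration.integral_nonneg) auto
  have le: "(LINT x|lebesgue_on {lo G e..hi G e}. (cmod (g e x))\<^sup>2) \<le> (L2_norm G g)\<^sup>2"
    unfolding L2_norm_def real_sqrt_pow2[OF nn] unfolding edge_eq
    by (intro member_le_sum[of e UNIV "\<lambda>e. LINT x|lebesgue_on {lo G e..hi G e}. (cmod (g e x))\<^sup>2"]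
        Bochner_Integration.integral_nonneg) auto
  have "0 \<le> L2_norm G g" unfolding L2_norm_def using nn by simp
  from square_integrable_imp_integrable[OF g le this less_imp_le[OF lo_less_hi]]
  show "integrable (lebesgue_on {lo G e..hi G e}) (g e)"
    and "(LINT x|lebesgue_on {lo G e..hi G e}. cmod (g e x)) \<le> (edge_length G e + 1) * L2_norm G g"
    by (simp_all add: edge_length_def)
qed

lemma transfer_apply:
  "transfer \<alpha> z k *v v = vertex_matrix (of_real (\<alpha> $ (k + 1))) *v
     vector [fcos z (edge_length G k) * v $ 1 + fsin z (edge_length G k) * v $ 2,
             fcos z (edge_length G k) * v $ 2 - z * fsin z (edge_length G k) * v $ 1]"
  by (simp add: transfer_def matrix_vector_mul_assoc[symmetric] edge_matrix_apply)

text \<open>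
  Subtracting particular solutions with zero data at the starting points reduces the resolvent equation to
  the free one. What remains of it is the propagation of the data \<open>w\<close> around the cycle, with an
  inhomogeneity from the values of the particular solutions at the far ends.
\<close>

lemma graph_laplacian_wave:
  assumes g: "g \<in> L2 G"
    and P: "\<And>e. edge_solution (lo G e) (hi G e) z (g e) (P e) (P' e)"
    and P0: "\<And>e. P e (start_pt G e) = 0" "\<And>e. P' e (start_pt G e) = 0"
  shows "(f, g + cscale z f) \<in> graph_laplacian G \<alpha> \<longleftrightarrow>
     (\<exists>w. f = (\<lambda>e x. (if x \<in> edge G e then P e x else 0) + wave z w e x) \<and>
       (\<forall>k. w (k + 1) = transfer \<alpha> z k *v w k +
          vertex_matrix (of_real (\<alpha> $ (k + 1))) *v vector [P k (end_pt G k), dir G k * P' k (end_pt G k)]))"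
    (is "_ \<longleftrightarrow> (\<exists>w. f = ?F w \<and> ?rec w)")
proof
  note gi = square_integrable_edge(1)[OF g]
  note s = pts_in_edge(1) note en = pts_in_edge(2)
  {
    assume "(f, g + cscale z f) \<in> graph_laplacian G \<alpha>"
    then obtain f' where supp: "\<And>e x. x \<notin> edge G e \<Longrightarrow> f e x = 0"
      and sol: "\<And>e. edge_solution (lo G e) (hi G e) z (g e) (f e) (f' e)"
      and match: "\<And>k. f (k + 1) (start_pt G (k + 1)) = f k (end_pt G k)"
        "\<And>k. dir G (k + 1) * f' (k + 1) (start_pt G (k + 1)) =
             dir G k * f' k (end_pt G k) + of_real (\<alpha> $ (k + 1)) * f (k + 1) (start_pt G (k + 1))"
      unfolding graph_laplacian_iff[OF g] by blast
    define w :: "4 \<Rightarrow> complex^2" where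
      "w = (\<lambda>e. vector [f e (start_pt G e), dir G e * f' e (start_pt G e)])"
    have w: "w e $ 1 = f e (start_pt G e)" "w e $ 2 = dir G e * f' e (start_pt G e)" for e
      by (simp_all add: w_def)
    have rep: "f e x - P e x = w e $ 1 * fcos z (x - start_pt G e) + dir G e * w e $ 2 * fsin z (x - start_pt G e)"
      and rep': "f' e x - P' e x = dir G e * w e $ 2 * fcos z (x - start_pt G e) - z * w e $ 1 * fsin z (x - start_pt G e)"
      if "x \<in> {lo G e..hi G e}" for e x
      using edge_solution_zero_unique[OF edge_solution_diff[OF sol P gi] s that]
      by (simp_all add: P0 w)
    have "f = ?F w"
    proof (intro ext)
      show "f e x = ?F w e x" for e x
        using rep[of x e] supp[of x e] by (simp add: wave_def edge_eq algebra_simps)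
    qed
    moreover have "?rec w"
    proof
      fix k
      have "f k (end_pt G k) = P k (end_pt G k) +
          (fcos z (edge_length G k) * w k $ 1 + fsin z (edge_length G k) * w k $ 2)"
        using rep[OF en[of k]] unfolding fcos_end fsin_end by (simp add: algebra_simps)
      moreover have "dir G k * f' k (end_pt G k) = dir G k * P' k (end_pt G k) +
          (fcos z (edge_length G k) * w k $ 2 - z * fsin z (edge_length G k) * w k $ 1)"
      proof -
        have "f' k (end_pt G k) = P' k (end_pt G k) +
          (dir G k * w k $ 2 * fcos z (edge_length G k) - z * w k $ 1 * (dir G k * fsin z (edge_length G k)))"
          using rep'[OF en[of k]] unfolding fcos_end fsin_end by algebra
        then show ?thesis using dir_square[of k] by algebra
      qed
      moreover have "w (k + 1) $ 1 = f k (end_pt G k)"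
        "w (k + 1) $ 2 = dir G k * f' k (end_pt G k) + of_real (\<alpha> $ (k + 1)) * f k (end_pt G k)"
        using match[of k] by (simp_all add: w)
      ultimately show "w (k + 1) = transfer \<alpha> z k *v w k +
          vertex_matrix (of_real (\<alpha> $ (k + 1))) *v vector [P k (end_pt G k), dir G k * P' k (end_pt G k)]"
        unfolding transfer_apply vertex_matrix_apply vec_eq_iff forall_2 by (simp add: algebra_simps)
    qed
    ultimately show "\<exists>w. f = ?F w \<and> ?rec w" by blast
  }
  assume "\<exists>w. f = ?F w \<and> ?rec w"
  then obtain w where f: "f = ?F w" and rec: "?rec w" by blast
  define f' where "f' = (\<lambda>e x. P' e x + (dir G e * w e $ 2 * fcos z (x - start_pt G e) - z * w e $ 1 * fsin z (x - start_pt G e)))"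
  have on: "f e x = P e x + (w e $ 1 * fcos z (x - start_pt G e) + dir G e * w e $ 2 * fsin z (x - start_pt G e))"
    if "x \<in> {lo G e..hi G e}" for e x
    using that unfolding f by (simp add: wave_def edge_eq)
  have sol: "edge_solution (lo G e) (hi G e) z (g e) (f e) (f' e)" for e
    unfolding f'_def
    by (rule edge_solution_cong[OF edge_solution_add_zero[OF P edge_solution_fundamental gi]]) (rule on)
  have st: "f e (start_pt G e) = w e $ 1" "dir G e * f' e (start_pt G e) = w e $ 2" for e
    unfolding on[OF s] f'_def by (simp_all add: P0)
  have e1: "f k (end_pt G k) = P k (end_pt G k) +
          (fcos z (edge_length G k) * w k $ 1 + fsin z (edge_length G k) * w k $ 2)" for k
    unfolding on[OF en] fcos_end fsin_end by (simp add: algebra_simps)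
  have e2: "dir G k * f' k (end_pt G k) = dir G k * P' k (end_pt G k) +
          (fcos z (edge_length G k) * w k $ 2 - z * fsin z (edge_length G k) * w k $ 1)" for k
    unfolding f'_def fcos_end fsin_end using dir_square[of k] by algebra
  have "f (k + 1) (start_pt G (k + 1)) = f k (end_pt G k) \<and>
           dir G (k + 1) * f' (k + 1) (start_pt G (k + 1)) =
             dir G k * f' k (end_pt G k) + of_real (\<alpha> $ (k + 1)) * f (k + 1) (start_pt G (k + 1))" for k
    using rec[rule_format, of k] unfolding st e1 e2 transfer_apply vertex_matrix_apply vec_eq_iff forall_2
    by (simp add: algebra_simps)
  moreover have "\<forall>e x. x \<notin> edge G e \<longrightarrow> f e x = 0"
    by (simp add: f wave_def)
  ultimately show "(f, g + cscale z f) \<in> graph_laplacian G \<alpha>"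
    unfolding graph_laplacian_iff[OF g] using sol by blast
qed

lemma eigenspace_eq:
  "eigenspace (graph_laplacian G \<alpha>) z = {wave z w | w. \<forall>k. w (k + 1) = transfer \<alpha> z k *v w k}"
proof -
  have "edge_solution a b z ((0 :: 4 graph_fun) e) (\<lambda>_. 0) (\<lambda>_. 0)" for a b e
    unfolding zero_fun_def by (rule edge_solution_zeroI) auto
  from graph_laplacian_wave[OF L2_zero, of z "\<lambda>_ _. 0" "\<lambda>_ _. 0" _ \<alpha>, OF this]
  have "(f, 0 + cscale z f) \<in> graph_laplacian G \<alpha> \<longleftrightarrow>
    (\<exists>w. f = wave z w \<and> (\<forall>k. w (k + 1) = transfer \<alpha> z k *v w k))" for f
    by (simp add: vertex_matrix_apply vec_eq_iff forall_2)
  then show ?thesis unfolding eigenspace_def by auto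
qed

lemma det_transfer: "det (transfer \<alpha> z k) = 1"
  using fcos_fsin_square[of z "edge_length G k"]
  by (simp add: transfer_def det_mul) (simp add: det_2 vertex_matrix_def edge_matrix_def power2_eq_square algebra_simps)

lemma det_monodromy: "det (monodromy \<alpha> z) = 1"
  by (simp add: monodromy_def around_def det_mul det_transfer)

lemma det_minus_one:
  fixes A :: "complex^2^2"
  shows "det (A - mat 1) = det A + 1 - trace A"
  by (simp add: det_2 trace_def sum_2 mat_def algebra_simps)

lemma wave_eq_zero_iff: "wave z w = 0 \<longleftrightarrow> (\<forall>e. w e = 0)"
proof
  assume w: "wave z w = 0"
  have "w e = 0" for e
  proof -
    have zero: "wave z w e x = 0" for x using w by (simp add: zero_fun_def)
    have on: "w e $ 1 * fcos z (x - start_pt G e) + dir G e * w e $ 2 * fsin z (x - start_pt G e) = 0"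
      if "x \<in> {lo G e..hi G e}" for x
      using zero[of x] that by (simp add: wave_def edge_eq)
    define h where "h = (\<lambda>x. w e $ 1 * fcos z (x - start_pt G e) + dir G e * w e $ 2 * fsin z (x - start_pt G e))"
    define h' where "h' = (\<lambda>x. dir G e * w e $ 2 * fcos z (x - start_pt G e) - z * w e $ 1 * fsin z (x - start_pt G e))"
    have "edge_solution (lo G e) (hi G e) z (\<lambda>_. 0) h h'"
      unfolding h_def h'_def by (rule edge_solution_fundamental)
    then have d: "(h has_vector_derivative h' (start_pt G e)) (at (start_pt G e) within {lo G e..hi G e})"
      using pts_in_edge(1)[of e] unfolding edge_solution_def by blast
    have "((\<lambda>_. 0) has_vector_derivative h' (start_pt G e)) (at (start_pt G e) within {lo G e..hi G e})"
      by (rule has_vector_derivative_transform[OF pts_in_edge(1) _ d]) (simp add: h_def on)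
    from vector_derivative_unique_within_closed_interval[OF lo_less_hi[of e], unfolded cbox_interval,
        OF pts_in_edge(1) this has_vector_derivative_const]
    have "dir G e * w e $ 2 = 0" by (simp add: h'_def)
    then have "w e $ 2 = 0" by (simp add: dir_def split: if_splits)
    moreover have "w e $ 1 = 0" using on[OF pts_in_edge(1)] by simp
    ultimately show ?thesis by (simp add: vec_eq_iff forall_2)
  qed
  then show "\<forall>e. w e = 0" by blast
next
  assume "\<forall>e. w e = 0"
  then show "wave z w = 0" by (simp add: wave_def fun_eq_iff)
qed

lemma wave_bound:
  obtains B where "B \<ge> 0" "\<And>w e x. cmod (wave z w e x) \<le> B * norm (w e)"
proof -
  have "\<exists>B\<ge>0. (\<forall>x\<in>{lo G e - start_pt G e..hi G e - start_pt G e}. cmod (fcos z x) \<le> B \<and> cmod (fsin z x) \<le> B)" for e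
    using fundamental_bounded by metis
  then obtain B where B: "\<And>e. B e \<ge> 0"
     "\<And>e x. x\<in>{lo G e - start_pt G e..hi G e - start_pt G e} \<Longrightarrow> cmod (fcos z x) \<le> B e"
     "\<And>e x. x\<in>{lo G e - start_pt G e..hi G e - start_pt G e} \<Longrightarrow> cmod (fsin z x) \<le> B e"
    by metis
  have le: "B e \<le> (\<Sum>e\<in>UNIV. B e)" for e
    using B(1) by (intro member_le_sum) auto
  have nn: "0 \<le> (\<Sum>e\<in>UNIV. B e)" using B(1) by (intro sum_nonneg)
  have "cmod (wave z w e x) \<le> 2 * (\<Sum>e\<in>UNIV. B e) * norm (w e)" for w e x
  proof (cases "x \<in> {lo G e..hi G e}")
    case False
    then have "wave z w e x = 0" unfolding wave_def edge_eq by (rule if_not_P)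
    then show ?thesis using nn by simp
  next
    case True
    have dn: "cmod (dir G e) = 1" by (simp add: dir_def)
    have b: "cmod (fcos z (x - start_pt G e)) \<le> (\<Sum>e\<in>UNIV. B e)" "cmod (fsin z (x - start_pt G e)) \<le> (\<Sum>e\<in>UNIV. B e)"
      using B(2,3)[of "x - start_pt G e" e] True le[of e] by (fastforce intro: order_trans)+
    have "cmod (wave z w e x) \<le> cmod (w e $ 1) * cmod (fcos z (x - start_pt G e)) + cmod (w e $ 2) * cmod (fsin z (x - start_pt G e))"
      using True dn by (simp add: wave_def edge_eq) (metis norm_triangle_ineq norm_mult mult_1)
    also have "\<dots> \<le> norm (w e) * (\<Sum>e\<in>UNIV. B e) + norm (w e) * (\<Sum>e\<in>UNIV. B e)"
      using b by (intro add_mono mult_mono) (auto intro: Finite_Cartesian_Product.norm_nth_le)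
    finally show ?thesis by (simp add: algebra_simps)
  qed
  then show ?thesis using nn that[of "2 * (\<Sum>e\<in>UNIV. B e)"] by simp
qed

lemma L2_norm_le_sup:
  assumes "\<And>e x. x \<in> edge G e \<Longrightarrow> cmod (f e x) \<le> C" "C \<ge> 0"
  shows "L2_norm G f \<le> sqrt (\<Sum>e\<in>UNIV. edge_length G e) * C"
proof -
  have "(LINT x|lebesgue_on (edge G e). (cmod (f e x))\<^sup>2) \<le> edge_length G e * C\<^sup>2" for e
  proof -
    have c: "integrable (lebesgue_on {lo G e..hi G e}) (\<lambda>_. C\<^sup>2)"
      by (intro continuous_imp_integrable_real continuous_intros)
    have "(LINT x|lebesgue_on {lo G e..hi G e}. (cmod (f e x))\<^sup>2) \<le> (LINT x|lebesgue_on {lo G e..hi G e}. C\<^sup>2)"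
      using assms unfolding edge_eq
      by (intro Bochner_Integration.integral_mono_AE' c AE_I2) (auto intro: power_mono)
    also have "\<dots> = edge_length G e * C\<^sup>2"
      using lebesgue_integral_eq_integral[OF c] lo_less_hi[of e] by (simp add: edge_length_def)
    finally show ?thesis by (simp add: edge_eq)
  qed
  then have "(\<Sum>e\<in>UNIV. LINT x|lebesgue_on (edge G e). (cmod (f e x))\<^sup>2) \<le> (\<Sum>e\<in>UNIV. edge_length G e * C\<^sup>2)"
    by (intro sum_mono)
  then have "L2_norm G f \<le> sqrt ((\<Sum>e\<in>UNIV. edge_length G e) * C\<^sup>2)"
    unfolding L2_norm_def by (simp add: sum_distrib_right)
  then show ?thesis using assms(2) by (simp add: real_sqrt_mult)
qed

text \<open>
  If the trace is \<open>2\<close>, a fixed vector of the monodromy gives an eigenfunction. Otherwise \<open>1\<close> is not an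
  eigenvalue of the monodromy, because its determinant is \<open>1\<close>; then the data \<open>w\<close> exist, are unique and are
  bounded by the right-hand side, which is the existence and boundedness of the resolvent.
\<close>

theorem spectrum_iff:
  "z \<in> op_spectrum G (graph_laplacian G \<alpha>) \<longleftrightarrow> trace (monodromy \<alpha> z) = 2"
proof
  assume tr: "trace (monodromy \<alpha> z) = 2"
  then have "det (monodromy \<alpha> z - mat 1) = 0"
    by (simp add: det_minus_one det_monodromy)
  then obtain v where v: "v \<noteq> 0" "(monodromy \<alpha> z - mat 1) *v v = 0"
    by (metis invertible_det_nz invertible_left_inverse matrix_left_invertible_ker)
  then have Mv: "v - around (transfer \<alpha> z) *v v = 0"
    by (simp add: monodromy_def matrix_vector_mult_diff_rdistrib)
  define w where "w = (\<lambda>k::4. if k = 1 then v else if k = 2 then transfer \<alpha> z 1 *v v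
     else if k = 3 then transfer \<alpha> z 2 *v (transfer \<alpha> z 1 *v v)
     else transfer \<alpha> z 3 *v (transfer \<alpha> z 2 *v (transfer \<alpha> z 1 *v v)))"
  have w: "w 1 = v" "w 2 = transfer \<alpha> z 1 *v v" "w 3 = transfer \<alpha> z 2 *v (transfer \<alpha> z 1 *v v)"
    "w 4 = transfer \<alpha> z 3 *v (transfer \<alpha> z 2 *v (transfer \<alpha> z 1 *v v))"
    by (simp_all add: w_def)
  have "\<forall>k. w (k + 1) = transfer \<alpha> z k *v w k + 0"
    using cyclic_recurrence_iff[of w "transfer \<alpha> z" "\<lambda>_. 0"] Mv unfolding w by simp
  then have "wave z w \<in> eigenspace (graph_laplacian G \<alpha>) z" unfolding eigenspace_eq by auto
  moreover have "wave z w \<noteq> 0" using v(1) w(1) wave_eq_zero_iff by metis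
  moreover have "0 \<in> eigenspace (graph_laplacian G \<alpha>) z"
  proof -
    have "wave z (\<lambda>_. 0) = 0" by (simp add: wave_eq_zero_iff)
    then show ?thesis unfolding eigenspace_eq by (auto intro!: exI[of _ "\<lambda>_. 0"])
  qed
  ultimately have "\<not> (\<exists>!f. (f, 0 + cscale z f) \<in> graph_laplacian G \<alpha>)"
    unfolding eigenspace_def by auto
  then show "z \<in> op_spectrum G (graph_laplacian G \<alpha>)"
    unfolding op_spectrum_def resolvent_set_def using L2_zero by blast
next
  assume z: "z \<in> op_spectrum G (graph_laplacian G \<alpha>)"
  show "trace (monodromy \<alpha> z) = 2"
  proof (rule ccontr)
    assume "trace (monodromy \<alpha> z) \<noteq> 2"
    then have det: "det (around (transfer \<alpha> z) - mat 1) \<noteq> 0"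
      unfolding monodromy_def[symmetric] by (simp add: det_minus_one det_monodromy)
    note solv = cyclic_recurrence_solvable[OF det]
    have "\<exists>K\<ge>0. \<forall>g. integrable (lebesgue_on {lo G e..hi G e}) g \<longrightarrow>
       (\<exists>f f'. edge_solution (lo G e) (hi G e) z g f f' \<and> f (start_pt G e) = 0 \<and> f' (start_pt G e) = 0 \<and>
         (\<forall>x\<in>{lo G e..hi G e}. cmod (f x) \<le> K * (LINT t|lebesgue_on {lo G e..hi G e}. cmod (g t)) \<and>
                      cmod (f' x) \<le> K * (LINT t|lebesgue_on {lo G e..hi G e}. cmod (g t))))" for e
      by (rule edge_particular_solution_at[OF lo_less_hi pts_in_edge(1)[of e]]) blast
    then obtain K where K: "\<And>e. K e \<ge> 0" and part: "\<And>e g. integrable (lebesgue_on {lo G e..hi G e}) g \<Longrightarrow>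
       (\<exists>f f'. edge_solution (lo G e) (hi G e) z g f f' \<and> f (start_pt G e) = 0 \<and> f' (start_pt G e) = 0 \<and>
         (\<forall>x\<in>{lo G e..hi G e}. cmod (f x) \<le> K e * (LINT t|lebesgue_on {lo G e..hi G e}. cmod (g t)) \<and>
                      cmod (f' x) \<le> K e * (LINT t|lebesgue_on {lo G e..hi G e}. cmod (g t))))"
      by metis
    define k where "k = (\<Sum>e\<in>UNIV. K e * (edge_length G e + 1))"
    have el: "edge_length G e > 0" for e using lo_less_hi[of e] by (simp add: edge_length_def)
    have el1: "0 \<le> edge_length G e + 1" for e using el[of e] by linarith
    have k0: "k \<ge> 0" unfolding k_def using K el1 by (intro sum_nonneg mult_nonneg_nonneg)
    have kle: "K e * (edge_length G e + 1) \<le> k" for e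
      unfolding k_def using K el1
      by (intro member_le_sum[of e UNIV "\<lambda>e. K e * (edge_length G e + 1)"] mult_nonneg_nonneg) auto
    have part': "\<exists>P P'. (\<forall>e. edge_solution (lo G e) (hi G e) z (g e) (P e) (P' e) \<and> P e (start_pt G e) = 0 \<and> P' e (start_pt G e) = 0 \<and>
         (\<forall>x\<in>{lo G e..hi G e}. cmod (P e x) \<le> k * L2_norm G g \<and> cmod (P' e x) \<le> k * L2_norm G g))"
      if g: "g \<in> L2 G" for g
    proof -
      have "K e * (LINT t|lebesgue_on {lo G e..hi G e}. cmod (g e t)) \<le> k * L2_norm G g" for e
      proof -
        have "K e * (LINT t|lebesgue_on {lo G e..hi G e}. cmod (g e t)) \<le> K e * ((edge_length G e + 1) * L2_norm G g)"
          using square_integrable_edge(2)[OF g] K by (intro mult_left_mono)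
        also have "\<dots> = K e * (edge_length G e + 1) * L2_norm G g" by simp
        also have "\<dots> \<le> k * L2_norm G g"
          unfolding L2_norm_def by (intro mult_right_mono kle real_sqrt_ge_zero sum_nonneg Bochner_Integration.integral_nonneg) auto
        finally show ?thesis .
      qed
      then have "\<exists>f f'. edge_solution (lo G e) (hi G e) z (g e) f f' \<and> f (start_pt G e) = 0 \<and> f' (start_pt G e) = 0 \<and>
         (\<forall>x\<in>{lo G e..hi G e}. cmod (f x) \<le> k * L2_norm G g \<and> cmod (f' x) \<le> k * L2_norm G g)" for e
        using part[OF square_integrable_edge(1)[OF g, of e]] by (meson order_trans)
      then show ?thesis by metis
    qed
    obtain B where B: "B \<ge> 0" "\<And>r w l. (\<forall>k. w (k + 1) = transfer \<alpha> z k *v w k + r k) \<Longrightarrow> norm (w l) \<le> B * (\<Sum>k\<in>UNIV. norm (r k))"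
      using solv(2) by blast
    obtain W where W: "W \<ge> 0" "\<And>w e x. cmod (wave z w e x) \<le> W * norm (w e)"
      using wave_bound by blast
    have "\<exists>c\<ge>0. \<forall>x. norm (vertex_matrix (of_real (\<alpha> $ (k + 1))) *v x) \<le> c * norm x" for k
      by (meson matrix_apply_bound)
    then obtain c where c: "\<And>k. c k \<ge> 0" "\<And>k x. norm (vertex_matrix (of_real (\<alpha> $ (k + 1))) *v x) \<le> c k * norm x"
      by metis
    \<comment> \<open>The summand \<open>k\<close> bounds the particular solutions, the other one the free waves that they excite at the vertices.\<close>
    define C where "C = sqrt (\<Sum>e\<in>UNIV. edge_length G e) * (k + W * (B * (\<Sum>j\<in>UNIV. c j * (2 * k))))"
    have "(\<exists>!f. (f, g + cscale z f) \<in> graph_laplacian G \<alpha>) \<and>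
        (\<forall>f. (f, g + cscale z f) \<in> graph_laplacian G \<alpha> \<longrightarrow> L2_norm G f \<le> C * L2_norm G g)" if g: "g \<in> L2 G" for g
    proof -
      obtain P P' where P: "\<And>e. edge_solution (lo G e) (hi G e) z (g e) (P e) (P' e)"
        "\<And>e. P e (start_pt G e) = 0" "\<And>e. P' e (start_pt G e) = 0"
        and bP: "\<And>e x. x\<in>{lo G e..hi G e} \<Longrightarrow> cmod (P e x) \<le> k * L2_norm G g"
          "\<And>e x. x\<in>{lo G e..hi G e} \<Longrightarrow> cmod (P' e x) \<le> k * L2_norm G g"
        using part'[OF g] by metis
      define r where "r = (\<lambda>k. vertex_matrix (of_real (\<alpha> $ (k + 1))) *v vector [P k (end_pt G k), dir G k * P' k (end_pt G k)])"
      have N: "0 \<le> L2_norm G g"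
        unfolding L2_norm_def by (intro real_sqrt_ge_zero sum_nonneg Bochner_Integration.integral_nonneg) auto
      have iff: "(f, g + cscale z f) \<in> graph_laplacian G \<alpha> \<longleftrightarrow>
        (\<exists>w. f = (\<lambda>e x. (if x \<in> edge G e then P e x else 0) + wave z w e x) \<and> (\<forall>k. w (k + 1) = transfer \<alpha> z k *v w k + r k))" for f
        unfolding r_def by (rule graph_laplacian_wave[OF g P])
      have "\<exists>!f. (f, g + cscale z f) \<in> graph_laplacian G \<alpha>"
      proof -
        obtain w0 where w0: "\<forall>k. w0 (k + 1) = transfer \<alpha> z k *v w0 k + r k"
          and uniq: "\<And>w. \<forall>k. w (k + 1) = transfer \<alpha> z k *v w k + r k \<Longrightarrow> w = w0"
          using solv(1)[of r] by (elim ex1E) blast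
        show ?thesis
          unfolding iff
        proof (rule ex1I)
          show "\<exists>w. (\<lambda>e x. (if x \<in> edge G e then P e x else 0) + wave z w0 e x)
            = (\<lambda>e x. (if x \<in> edge G e then P e x else 0) + wave z w e x) \<and> (\<forall>k. w (k + 1) = transfer \<alpha> z k *v w k + r k)"
            using w0 by blast
          show "f = (\<lambda>e x. (if x \<in> edge G e then P e x else 0) + wave z w0 e x)"
            if "\<exists>w. f = (\<lambda>e x. (if x \<in> edge G e then P e x else 0) + wave z w e x) \<and> (\<forall>k. w (k + 1) = transfer \<alpha> z k *v w k + r k)" for f
            using that uniq by blast
        qed
      qed
      moreover have "L2_norm G f \<le> C * L2_norm G g" if "(f, g + cscale z f) \<in> graph_laplacian G \<alpha>" for f
      proof -
        obtain w where f: "f = (\<lambda>e x. (if x \<in> edge G e then P e x else 0) + wave z w e x)"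
          and w: "\<forall>k. w (k + 1) = transfer \<alpha> z k *v w k + r k"
          using \<open>(f, g + cscale z f) \<in> graph_laplacian G \<alpha>\<close> unfolding iff by blast
        have r: "norm (r j) \<le> c j * (2 * k) * L2_norm G g" for j
        proof -
          let ?v = "vector [P j (end_pt G j), dir G j * P' j (end_pt G j)] :: complex^2"
          have "norm ?v \<le> cmod (?v $ 1) + cmod (?v $ 2)"
            unfolding norm_vec_def using L2_set_le_sum[of UNIV "\<lambda>i. norm (?v $ i)"] by (simp add: sum_2)
          also have "\<dots> = cmod (P j (end_pt G j)) + cmod (P' j (end_pt G j))"
            by (simp add: dir_def norm_mult)
          also have "\<dots> \<le> k * L2_norm G g + k * L2_norm G g"
            by (intro add_mono bP pts_in_edge)
          finally have "c j * norm ?v \<le> c j * (2 * k * L2_norm G g)"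
            by (intro mult_left_mono c) simp
          then show ?thesis
            using c(2)[of j ?v] unfolding r_def by (simp add: mult.assoc)
        qed
        have "norm (w e) \<le> B * (\<Sum>j\<in>UNIV. c j * (2 * k)) * L2_norm G g" for e
        proof -
          have "norm (w e) \<le> B * (\<Sum>j\<in>UNIV. norm (r j))" by (rule B(2)[OF w])
          also have "\<dots> \<le> B * (\<Sum>j\<in>UNIV. c j * (2 * k) * L2_norm G g)"
            by (intro mult_left_mono sum_mono r B)
          finally show ?thesis by (simp add: sum_distrib_right mult.assoc)
        qed
        then have "W * norm (w e) \<le> W * (B * (\<Sum>j\<in>UNIV. c j * (2 * k)) * L2_norm G g)" for e
          using W(1) by (intro mult_left_mono)
        then have wv: "cmod (wave z w e x) \<le> W * (B * (\<Sum>j\<in>UNIV. c j * (2 * k)) * L2_norm G g)" for e x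
          using W(2) by (rule order_trans[rotated])
        have "cmod (f e x) \<le> (k + W * (B * (\<Sum>j\<in>UNIV. c j * (2 * k)))) * L2_norm G g" if "x \<in> edge G e" for e x
        proof -
          have "cmod (f e x) \<le> cmod (P e x) + cmod (wave z w e x)"
            unfolding f using that by (simp add: norm_triangle_ineq)
          also have "\<dots> \<le> k * L2_norm G g + W * (B * (\<Sum>j\<in>UNIV. c j * (2 * k)) * L2_norm G g)"
            using that by (intro add_mono bP wv) (simp add: edge_eq)
          finally show ?thesis by (simp add: algebra_simps)
        qed
        moreover have "0 \<le> (k + W * (B * (\<Sum>j\<in>UNIV. c j * (2 * k)))) * L2_norm G g"
          using k0 W(1) B(1) c(1) N by (intro mult_nonneg_nonneg add_nonneg_nonneg sum_nonneg) auto
        ultimately show ?thesis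
          unfolding C_def mult.assoc[of "sqrt _"] by (rule L2_norm_le_sup)
      qed
      ultimately show ?thesis by blast
    qed
    then have "z \<in> resolvent_set G (graph_laplacian G \<alpha>)"
      unfolding resolvent_set_def by blast
    then show False using z unfolding op_spectrum_def by blast
  qed
qed

end

section \<open>The trace of the monodromy and alternating couplings\<close>

lemmas matrix2_simps = matrix_matrix_mult_def vec_eq_iff forall_2 sum_2

lemma edge_vertex_product:
  "vertex_matrix a ** edge_matrix z c s = vector [vector [c, s], vector [a * c - z * s, a * s + c]]"
  by (simp add: vertex_matrix_def edge_matrix_def matrix2_simps)

text \<open>
  Expanding in the couplings: a set of vertices contributes the product of its couplings and, for each arc
  between consecutive members, the upper right entry of the product of the edge matrices over that arc.
  The capital letters are the entries for arcs of two edges.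
\<close>

lemma trace_around:
  fixes a c s :: "4 \<Rightarrow> complex" and z :: complex
  defines "C12 \<equiv> c 1 * c 2 - z * s 1 * s 2" and "S12 \<equiv> s 1 * c 2 + c 1 * s 2"
    and "C34 \<equiv> c 3 * c 4 - z * s 3 * s 4" and "S34 \<equiv> s 3 * c 4 + c 3 * s 4"
    and "C41 \<equiv> c 4 * c 1 - z * s 4 * s 1" and "S41 \<equiv> s 4 * c 1 + c 4 * s 1"
    and "S23 \<equiv> s 2 * c 3 + c 2 * s 3"
  shows "trace (around (\<lambda>k. vertex_matrix (a (k + 1)) ** edge_matrix z (c k) (s k))) =
    2 * (C12 * C34 - z * S12 * S34) + (a 1 + a 2 + a 3 + a 4) * (S12 * C34 + C12 * S34)
    + (a 1 * a 2 * s 1 * (s 2 * C34 + c 2 * S34) + a 2 * a 3 * s 2 * (s 3 * C41 + c 3 * S41)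
       + a 3 * a 4 * s 3 * (s 4 * C12 + c 4 * S12) + a 4 * a 1 * s 4 * (C12 * s 3 + S12 * c 3)
       + a 1 * a 3 * S12 * S34 + a 2 * a 4 * S23 * S41)
    + (a 1 * a 2 * a 3 * s 1 * s 2 * S34 + a 2 * a 3 * a 4 * s 2 * s 3 * S41
       + a 3 * a 4 * a 1 * s 3 * s 4 * S12 + a 4 * a 1 * a 2 * s 4 * s 1 * S23)
    + a 1 * a 2 * a 3 * a 4 * s 1 * s 2 * s 3 * s 4"
proof -
  have tr: "trace (A ** B) = A$1$1 * B$1$1 + A$1$2 * B$2$1 + A$2$1 * B$1$2 + A$2$2 * B$2$2" for A B :: "complex^2^2"
    by (simp add: trace_def matrix2_simps)
  have e: "around (\<lambda>k. vertex_matrix (a (k + 1)) ** edge_matrix z (c k) (s k)) =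
     ((vertex_matrix (a 1) ** edge_matrix z (c 4) (s 4)) ** (vertex_matrix (a 4) ** edge_matrix z (c 3) (s 3))) **
     ((vertex_matrix (a 3) ** edge_matrix z (c 2) (s 2)) ** (vertex_matrix (a 2) ** edge_matrix z (c 1) (s 1)))"
    unfolding around_def four_cycle by (simp only: matrix_mul_assoc)
  have prod: "(vector [vector [p, q], vector [r, t]] :: complex^2^2) ** (vector [vector [p', q'], vector [r', t']] :: complex^2^2)
     = vector [vector [p * p' + q * r', p * q' + q * t'], vector [r * p' + t * r', r * q' + t * t']]" for p q r t p' q' r' t'
    by (simp add: matrix2_simps)
  show ?thesis
    unfolding e tr unfolding edge_vertex_product prod vector_2
      C12_def S12_def C34_def S34_def C41_def S41_def S23_def
    by algebra
qed

text \<open>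
  The sum of the couplings is zero, and in the cubic terms, after expanding the arcs of two edges, each
  product of three sines and a cosine occurs twice with opposite signs. The identity holds for
  arbitrary values of \<open>c\<close> and \<open>s\<close>.
\<close>

lemma trace_around_alternating:
  fixes a c s :: "4 \<Rightarrow> complex"
  assumes a: "a 2 = - a 1" "a 3 = a 1" "a 4 = - a 1"
  shows "trace (around (\<lambda>k. vertex_matrix (- a (k + 1)) ** edge_matrix z (c k) (s k)))
       = trace (around (\<lambda>k. vertex_matrix (a (k + 1)) ** edge_matrix z (c k) (s k)))"
  unfolding trace_around[of a] trace_around[of "\<lambda>k. - a k"] a by algebra

lemma edge_matrix_commute:
  "edge_matrix z c s ** edge_matrix z c' s' = edge_matrix z (c * c' - z * s * s') (c * s' + s * c')"
  by (simp add: edge_matrix_def matrix2_simps algebra_simps)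

lemma trace_edge_unit: "trace (A ** edge_matrix z 0 1) = A $ 2 $ 1 - z * A $ 1 $ 2"
  by (simp add: trace_def edge_matrix_def matrix2_simps)

text \<open>
  Multiplication by \<open>edge_matrix z 0 1\<close> differentiates the first edge matrix with respect to the length of
  the edge.
\<close>

lemma trace_around_times_edge_unit:
  "trace (around (\<lambda>k. vertex_matrix (a (k + 1)) ** edge_matrix z (c k) (s k)) ** edge_matrix z 0 1)
    = trace (around (\<lambda>k. vertex_matrix (a (k + 1)) ** edge_matrix z ((c(1 := - z * s 1)) k) ((s(1 := c 1)) k)))"
  unfolding around_def using edge_matrix_commute[of z "c 1" "s 1" 0 1]
  by (simp add: matrix_mul_assoc[symmetric])

text \<open>
  Moves the base point of a cycle by one vertex.
\<close>

definition shift :: "(4 \<Rightarrow> 'a) \<Rightarrow> 4 \<Rightarrow> 'a" where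
  "shift X k = X (k + 1)"

lemma around_shift: "around (shift X) ** X 1 = X 1 ** around X"
  unfolding around_def shift_def four_cycle by (simp add: matrix_mul_assoc)

text \<open>
  The freedom in \<open>trace_around_alternating\<close> is used here: the two traces also agree after differentiating
  in the length of the first edge. For the monodromy \<open>1\<close> that derivative is zero.
\<close>

lemma alternating_imbalance:
  fixes a c s :: "4 \<Rightarrow> complex"
  assumes a: "a 2 = - a 1" "a 3 = a 1" "a 4 = - a 1"
    and one: "around (\<lambda>k. vertex_matrix (a (k + 1)) ** edge_matrix z (c k) (s k)) = mat 1"
  defines "M \<equiv> around (\<lambda>k. vertex_matrix (- a (k + 1)) ** edge_matrix z (c k) (s k))"
  shows "M $ 2 $ 1 = z * M $ 1 $ 2"
proof -
  have "trace (M ** edge_matrix z 0 1) =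
      trace (around (\<lambda>k. vertex_matrix (a (k + 1)) ** edge_matrix z (c k) (s k)) ** edge_matrix z 0 1)"
    unfolding M_def trace_around_times_edge_unit[of a] trace_around_times_edge_unit[of "\<lambda>k. - a k"]
    by (rule trace_around_alternating[OF a])
  then show ?thesis
    unfolding trace_edge_unit one by (simp add: mat_def)
qed

text \<open>
  Such a matrix is \<open>1\<close> plus a nilpotent matrix whose lower left entry is \<open>z\<close> times the upper right one. Its
  kernel is spanned by \<open>(1, \<mu>)\<close>, the data of the solution \<open>exp (\<mu> x)\<close>.
\<close>

lemma fixed_line:
  fixes M :: "complex^2^2"
  assumes "trace M = 2" "det M = 1" "M $ 2 $ 1 = z * M $ 1 $ 2" "M \<noteq> mat 1"
  obtains \<mu> where "\<mu>\<^sup>2 = - z" "\<And>v. M *v v = v \<longleftrightarrow> v $ 2 = \<mu> * v $ 1"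
proof -
  define p where "p = M $ 1 $ 1 - 1"
  define q where "q = M $ 1 $ 2"
  have M: "M $ 1 $ 1 = 1 + p" "M $ 1 $ 2 = q" "M $ 2 $ 1 = z * q" "M $ 2 $ 2 = 1 - p"
    using assms(1,3) by (simp_all add: p_def q_def trace_def sum_2 algebra_simps)
  have det: "p * p = - z * (q * q)"
    using assms(2) unfolding det_2 M by algebra
  have q: "q \<noteq> 0"
  proof
    assume "q = 0"
    with det have "p = 0" by simp
    with \<open>q = 0\<close> assms(4) M show False by (simp add: vec_eq_iff forall_2 mat_def)
  qed
  show ?thesis
  proof (rule that[of "- p / q"])
    show sq: "(- p / q)\<^sup>2 = - z"
      using det q by (simp add: power2_eq_square field_simps)
    show "M *v v = v \<longleftrightarrow> v $ 2 = - p / q * v $ 1" for v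
    proof -
      have "M *v v = v \<longleftrightarrow> p * v $ 1 + q * v $ 2 = 0 \<and> z * q * v $ 1 - p * v $ 2 = 0"
        by (auto simp: matrix_vector_mult_def vec_eq_iff forall_2 sum_2 M algebra_simps)
      also have "\<dots> \<longleftrightarrow> v $ 2 = - p / q * v $ 1"
      proof
        assume "p * v $ 1 + q * v $ 2 = 0 \<and> z * q * v $ 1 - p * v $ 2 = 0"
        then have "q * v $ 2 = - p * v $ 1" by algebra
        then show "v $ 2 = - p / q * v $ 1" using q by (simp add: field_simps)
      next
        assume v: "v $ 2 = - p / q * v $ 1"
        then have 1: "q * v $ 2 = - p * v $ 1" using q by simp
        moreover have "q * (z * q * v $ 1 - p * v $ 2) = 0"
          using 1 det by algebra
        then have "z * q * v $ 1 - p * v $ 2 = 0" using q by simp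
        ultimately show "p * v $ 1 + q * v $ 2 = 0 \<and> z * q * v $ 1 - p * v $ 2 = 0" by algebra
      qed
      finally show ?thesis .
    qed
  qed
qed

lemma transfer_exponential:
  assumes "\<mu>\<^sup>2 = - z" "v $ 2 = \<mu> * v $ 1"
  shows "(vertex_matrix a ** edge_matrix z c s) *v v
     = vector [(c + \<mu> * s) * v $ 1, (\<mu> + a) * ((c + \<mu> * s) * v $ 1)]"
proof -
  have "z = - (\<mu> * \<mu>)" using assms(1) by (simp add: power2_eq_square)
  then show ?thesis
    unfolding matrix_vector_mul_assoc[symmetric] vertex_matrix_apply edge_matrix_apply
    by (simp add: vec_eq_iff forall_2 assms(2) algebra_simps)
qed

lemma fcos_fsin_exp:
  assumes "\<mu>\<^sup>2 = - z"
  shows "fcos z x + \<mu> * fsin z x = exp (\<mu> * of_real x)"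
proof (cases "z = 0")
  case True
  then show ?thesis using assms by (simp add: fcos_def fsin_def)
next
  case False
  have "(\<i> * csqrt z)\<^sup>2 = \<mu>\<^sup>2" using assms by (simp add: power_mult_distrib)
  then consider "\<mu> = \<i> * csqrt z" | "\<mu> = - (\<i> * csqrt z)" 
    by (metis power2_eq_iff)
  then show ?thesis
  proof cases
    case 1
    then show ?thesis
      using False exp_Euler[of "csqrt z * of_real x"] by (simp add: fcos_def fsin_def mult.assoc)
  next
    case 2
    then show ?thesis
      using False exp_minus_Euler[of "csqrt z * of_real x"] by (simp add: fcos_def fsin_def mult.assoc)
  qed
qed

context cycle
begin

lemma transfer_eq: "transfer \<alpha> z = (\<lambda>k. vertex_matrix (of_real (\<alpha> $ (k + 1))) **
     edge_matrix z (fcos z (edge_length G k)) (fsin z (edge_length G k)))"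
  by (simp add: transfer_def fun_eq_iff)

lemma trace_monodromy_alternating:
  assumes "\<alpha> $ 2 = - \<alpha> $ 1" "\<alpha> $ 3 = \<alpha> $ 1" "\<alpha> $ 4 = - \<alpha> $ 1" 
  shows "trace (monodromy (- \<alpha>) z) = trace (monodromy \<alpha> z)"
  unfolding monodromy_def transfer_eq
  using trace_around_alternating[of "\<lambda>k. of_real (\<alpha> $ k)" z "\<lambda>k. fcos z (edge_length G k)" "\<lambda>k. fsin z (edge_length G k)"]
  assms by simp

text \<open>
  If the monodromy for \<open>- \<alpha>\<close> were not \<open>1\<close>, its fixed vectors, for the base points \<open>1\<close> and \<open>2\<close>, would be the
  data of exponentials with rates \<open>\<mu>\<close> and \<open>\<nu>\<close>, both squaring to \<open>- z\<close>. Crossing vertex \<open>2\<close> changes the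
  rate by \<open>\<alpha>\<^sub>1\<close>, hence \<open>\<nu> = - \<mu>\<close> and \<open>\<mu> = - \<alpha>\<^sub>1 / 2\<close>. The rate then changes sign at every vertex, and one turn
  multiplies the solution by \<open>exp (\<mu> (l\<^sub>1 - l\<^sub>2 + l\<^sub>3 - l\<^sub>4))\<close>, which is not \<open>1\<close>.
\<close>

lemma monodromy_alternating_identity:
  assumes \<alpha>: "\<alpha> $ 2 = - \<alpha> $ 1" "\<alpha> $ 3 = \<alpha> $ 1" "\<alpha> $ 4 = - \<alpha> $ 1" 
    and len: "edge_length G 1 + edge_length G 3 \<noteq> edge_length G 2 + edge_length G 4"
    and one: "monodromy \<alpha> z = mat 1"
  shows "monodromy (- \<alpha>) z = mat 1"
proof (rule ccontr)
  assume neq: "monodromy (- \<alpha>) z \<noteq> mat 1"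
  define a where "a = complex_of_real (\<alpha> $ 1)"
  let ?X = "transfer (- \<alpha>) z"
  let ?c = "\<lambda>k. fcos z (edge_length G k)" and ?s = "\<lambda>k. fsin z (edge_length G k)"
  have \<alpha>': "complex_of_real (\<alpha> $ 1) = a" "complex_of_real (\<alpha> $ 2) = - a" "complex_of_real (\<alpha> $ 3) = a" "complex_of_real (\<alpha> $ 4) = - a"
    using \<alpha> by (simp_all add: a_def)
  have "a \<noteq> 0"
  proof
    assume "a = 0"
    then have "\<forall>k. \<alpha> $ k = 0" unfolding forall_4 using \<alpha> by (simp add: a_def)
    then have "\<alpha> = 0" by (simp add: vec_eq_iff)
    then show False using neq one by simp
  qed
  have tr: "trace (monodromy (- \<alpha>) z) = 2"
    using trace_monodromy_alternating[OF \<alpha>, of z] one by (simp add: trace_I)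
  have imb: "monodromy (- \<alpha>) z $ 2 $ 1 = z * monodromy (- \<alpha>) z $ 1 $ 2"
    using alternating_imbalance[of "\<lambda>k. of_real (\<alpha> $ k)" z ?c ?s] one \<alpha>
    unfolding monodromy_def transfer_eq by simp
  obtain \<mu> where \<mu>: "\<mu>\<^sup>2 = - z" and fix\<mu>: "\<And>v. monodromy (- \<alpha>) z *v v = v \<longleftrightarrow> v $ 2 = \<mu> * v $ 1"
    using fixed_line[OF tr det_monodromy imb neq] by blast

  let ?M = "around (shift ?X)"
  have conj: "around (shift X) = mat 1 \<longleftrightarrow> around X = mat 1" if "det (X 1) = 1" for X :: "4 \<Rightarrow> complex^2^2"
  proof -
    have "invertible (X 1)" using that by (simp add: invertible_det_nz)
    then obtain Y where "X 1 ** Y = mat 1" "Y ** X 1 = mat 1" unfolding invertible_def by blast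
    then show ?thesis using around_shift[of X]
      by (metis matrix_mul_assoc matrix_mul_lid matrix_mul_rid)
  qed
  have tr': "trace ?M = 2"
    unfolding around_def shift_def four_cycle using tr
    by (metis around_def matrix_mul_assoc monodromy_def trace_mul_sym)
  have det': "det ?M = 1"
    by (simp add: around_def det_mul shift_def det_transfer)
  have neq': "?M \<noteq> mat 1"
    using conj[of ?X] neq by (simp add: det_transfer monodromy_def)
  have one': "around (shift (transfer \<alpha> z)) = mat 1"
    using conj[of "transfer \<alpha> z"] one by (simp add: det_transfer monodromy_def)
  have imb': "?M $ 2 $ 1 = z * ?M $ 1 $ 2"
  proof -
    have e1: "shift (transfer \<alpha> z) = (\<lambda>k. vertex_matrix (of_real (\<alpha> $ (k + 1 + 1))) ** edge_matrix z (shift ?c k) (shift ?s k))"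
      and e2: "shift ?X = (\<lambda>k. vertex_matrix (- of_real (\<alpha> $ (k + 1 + 1))) ** edge_matrix z (shift ?c k) (shift ?s k))"
      by (simp_all add: shift_def transfer_def fun_eq_iff)
    show ?thesis
      unfolding e2
      by (rule alternating_imbalance[of "\<lambda>k. of_real (\<alpha> $ (k + 1))", OF _ _ _ one'[unfolded e1]])
        (simp_all only: four_cycle \<alpha>' minus_minus)
  qed
  obtain \<nu> where \<nu>: "\<nu>\<^sup>2 = - z" and fix\<nu>: "\<And>v. ?M *v v = v \<longleftrightarrow> v $ 2 = \<nu> * v $ 1"
    using fixed_line[OF tr' det' imb' neq'] by blast
  have step: "?X k *v vector [u, \<mu>' * u] = vector [exp (\<mu>' * edge_length G k) * u, (\<mu>' - of_real (\<alpha> $ (k + 1))) * (exp (\<mu>' * edge_length G k) * u)]"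
    if "\<mu>'\<^sup>2 = - z" for \<mu>' u k
    using transfer_exponential[OF that, of "vector [u, \<mu>' * u]"] fcos_fsin_exp[OF that] 
    by (simp add: transfer_def)
  define v1 :: "complex^2" where "v1 = vector [1, \<mu> * 1]"
  have fix1: "monodromy (- \<alpha>) z *v v1 = v1" unfolding fix\<mu> v1_def by simp
  have "?M *v (?X 1 *v v1) = ?X 1 *v v1"
    using fix1 around_shift[of ?X] unfolding monodromy_def
    by (metis matrix_vector_mul_assoc)
  then have "(\<mu> + a) * exp (\<mu> * edge_length G 1) = \<nu> * exp (\<mu> * edge_length G 1)"
    unfolding fix\<nu> v1_def step[OF \<mu>] by (simp add: \<alpha>')
  then have "\<mu> + a = \<nu>" by simp
  then have "(\<mu> + a)\<^sup>2 = \<mu>\<^sup>2" using \<mu> \<nu> by simp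
  then have "a * (2 * \<mu> + a) = 0" by algebra
  then have a: "a = - 2 * \<mu>" using \<open>a \<noteq> 0\<close> by (simp add: eq_neg_iff_add_eq_0 add.commute)
  have \<mu>m: "(- \<mu>)\<^sup>2 = - z" using \<mu> by simp
  have 1: "?X 1 *v vector [u, \<mu> * u] = vector [exp (\<mu> * edge_length G 1) * u, - \<mu> * (exp (\<mu> * edge_length G 1) * u)]" for u
    unfolding step[OF \<mu>] by (simp add: \<alpha>' a)
  have 2: "?X 2 *v vector [u, - \<mu> * u] = vector [exp (- \<mu> * edge_length G 2) * u, \<mu> * (exp (- \<mu> * edge_length G 2) * u)]" for u
    unfolding step[OF \<mu>m] by (simp add: \<alpha>' a)
  have 3: "?X 3 *v vector [u, \<mu> * u] = vector [exp (\<mu> * edge_length G 3) * u, - \<mu> * (exp (\<mu> * edge_length G 3) * u)]" for u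
    unfolding step[OF \<mu>] by (simp only: four_cycle \<alpha>' a) simp
  have 4: "?X 4 *v vector [u, - \<mu> * u] = vector [exp (- \<mu> * edge_length G 4) * u, \<mu> * (exp (- \<mu> * edge_length G 4) * u)]" for u
    unfolding step[OF \<mu>m] by (simp only: four_cycle \<alpha>' a) simp
  have "monodromy (- \<alpha>) z *v v1 = ?X 4 *v (?X 3 *v (?X 2 *v (?X 1 *v v1)))"
    by (simp only: monodromy_def around_def matrix_vector_mul_assoc matrix_mul_assoc)
  also have "\<dots> $ 1 = exp (- \<mu> * edge_length G 4) * (exp (\<mu> * edge_length G 3) *
       (exp (- \<mu> * edge_length G 2) * (exp (\<mu> * edge_length G 1) * 1)))"
    unfolding v1_def 1 2 3 4 vector_2 ..
  also have "\<dots> = exp (\<mu> * of_real (edge_length G 1 - edge_length G 2 + edge_length G 3 - edge_length G 4))"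
    by (simp add: exp_add[symmetric] algebra_simps)
  finally have "exp (\<mu> * of_real (edge_length G 1 - edge_length G 2 + edge_length G 3 - edge_length G 4)) = 1"
    unfolding fix1 by (simp add: v1_def)
  moreover have "\<mu> = of_real (- \<alpha> $ 1 / 2)" using a by (simp add: a_def)
  ultimately have "exp (complex_of_real (- \<alpha> $ 1 / 2 * (edge_length G 1 - edge_length G 2 + edge_length G 3 - edge_length G 4))) = 1"
    by (simp only: of_real_mult)
  then have "complex_of_real (exp (- \<alpha> $ 1 / 2 * (edge_length G 1 - edge_length G 2 + edge_length G 3 - edge_length G 4))) = 1"
    by (simp only: exp_of_real)
  then have "- \<alpha> $ 1 / 2 * (edge_length G 1 - edge_length G 2 + edge_length G 3 - edge_length G 4) = 0"
    by (metis of_real_eq_1_iff exp_eq_one_iff)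
  then show False using len \<open>a \<noteq> 0\<close> by (simp add: a_def)
qed


section \<open>Multiplicities\<close>

definition orbit :: "(4 \<Rightarrow> complex^2^2) \<Rightarrow> complex^2 \<Rightarrow> 4 \<Rightarrow> complex^2" where
  "orbit X v = (\<lambda>k. if k = 1 then v else if k = 2 then X 1 *v v
     else if k = 3 then X 2 *v (X 1 *v v) else X 3 *v (X 2 *v (X 1 *v v)))"

lemma orbit_unfold: "orbit X v 1 = v" "orbit X v 2 = X 1 *v v" "orbit X v 3 = X 2 *v (X 1 *v v)"
    "orbit X v 4 = X 3 *v (X 2 *v (X 1 *v v))"
  by (simp_all add: orbit_def)

lemma periodic_iff_orbit:
  "(\<forall>k. w (k + 1) = X k *v w k) \<longleftrightarrow> (\<exists>v. around X *v v = v \<and> w = orbit X v)"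
proof -
  have "(\<forall>k. w (k + 1) = X k *v w k) \<longleftrightarrow> around X *v w 1 = w 1 \<and> w = orbit X (w 1)"
    using cyclic_recurrence_iff[of w X "\<lambda>_. 0"] unfolding fun_eq_iff[of w] forall_4[of "\<lambda>x. w x = _ x"] orbit_unfold
    by auto
  then show ?thesis by (metis orbit_unfold(1))
qed

lemma eigenspace_orbit:
  "eigenspace (graph_laplacian G \<alpha>) z =
     (\<lambda>v. wave z (orbit (transfer \<alpha> z) v)) ` {v. monodromy \<alpha> z *v v = v}"
  unfolding eigenspace_eq periodic_iff_orbit monodromy_def by auto

lemma wave_orbit_linear:
  "wave z (orbit X (u + v)) = wave z (orbit X u) + wave z (orbit X v)"
  "wave z (orbit X (x *s v)) = cscale x (wave z (orbit X v))"
  by (auto simp: wave_def orbit_def fun_eq_iff cscale_def matrix_vector_right_distrib vector_scalar_commute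
      algebra_simps)

lemma wave_orbit_eq_zero_iff: "wave z (orbit X v) = 0 \<longleftrightarrow> v = 0"
  unfolding wave_eq_zero_iff forall_4[of "\<lambda>k. orbit X v k = 0"] orbit_unfold by auto

text \<open>
  The map from fixed vectors of the monodromy to eigenfunctions is linear and injective, so the multiplicity
  is the dimension of the space of fixed vectors. A matrix \<open>N\<close> of determinant zero other than \<open>0\<close> has a
  one-dimensional kernel, spanned by the vector orthogonal to any nonzero row.
\<close>

lemma multiplicity_of_eq:
  assumes "trace (monodromy \<alpha> z) = 2"
  shows "multiplicity_of (graph_laplacian G \<alpha>) z = (if monodromy \<alpha> z = mat 1 then 2 else 1)"
proof -
  interpret C: vector_space "cscale :: complex \<Rightarrow> 4 graph_fun \<Rightarrow> 4 graph_fun"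
    by (rule vector_space_cscale)
  define \<Phi> where "\<Phi> = (\<lambda>v. wave z (orbit (transfer \<alpha> z) v))"
  have lin: "\<Phi> (u + v) = \<Phi> u + \<Phi> v" "\<Phi> (x *s v) = cscale x (\<Phi> v)" and zero: "\<Phi> v = 0 \<longleftrightarrow> v = 0" for u v x
    unfolding \<Phi>_def by (rule wave_orbit_linear wave_orbit_eq_zero_iff)+
  have eig: "eigenspace (graph_laplacian G \<alpha>) z = \<Phi> ` {v. monodromy \<alpha> z *v v = v}"
    unfolding \<Phi>_def by (rule eigenspace_orbit)
  show ?thesis
  proof (cases "monodromy \<alpha> z = mat 1")
    case True
    define e1 :: "complex^2" where "e1 = vector [1, 0]"
    define e2 :: "complex^2" where "e2 = vector [0, 1]"
    have dec: "v = v $ 1 *s e1 + v $ 2 *s e2" for v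
      by (simp add: e1_def e2_def vec_eq_iff forall_2)
    have notin: "\<Phi> e1 \<notin> C.span {\<Phi> e2}"
    proof
      assume "\<Phi> e1 \<in> C.span {\<Phi> e2}"
      then obtain x where "\<Phi> e1 = cscale x (\<Phi> e2)" by (auto simp: C.span_singleton)
      then have "\<Phi> (e1 + (- x) *s e2) = 0" unfolding lin by (simp add: cscale_def fun_eq_iff)
      then have "e1 + (- x) *s e2 = 0" unfolding zero .
      then have "(e1 + (- x) *s e2) $ 1 = 0" by simp
      then show False by (simp add: e1_def e2_def)
    qed
    have ne: "\<Phi> e2 \<noteq> 0" unfolding zero by (simp add: e2_def vec_eq_iff forall_2)
    have ind: "C.independent {\<Phi> e1, \<Phi> e2}"
      unfolding C.independent_insert[of "\<Phi> e1"]
      using notin ne C.dependent_single by auto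
    have "eigenspace (graph_laplacian G \<alpha>) z = C.span {\<Phi> e1, \<Phi> e2}"
    proof -
      have "\<Phi> v = cscale (v $ 1) (\<Phi> e1) + cscale (v $ 2) (\<Phi> e2)" for v
        using arg_cong[OF dec[of v], of \<Phi>] unfolding lin .
      moreover have "cscale x (\<Phi> e1) + cscale y (\<Phi> e2) = \<Phi> (x *s e1 + y *s e2)" for x y
        unfolding lin ..
      ultimately have "range \<Phi> = {cscale x (\<Phi> e1) + cscale y (\<Phi> e2) | x y. True}"
        by (auto simp: image_iff)
      also have "\<dots> = C.span {\<Phi> e1, \<Phi> e2}"
      proof (intro equalityI subsetI)
        fix f assume "f \<in> {cscale x (\<Phi> e1) + cscale y (\<Phi> e2) | x y. True}"
        then show "f \<in> C.span {\<Phi> e1, \<Phi> e2}"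
          by (auto intro!: C.span_add C.span_scale intro: C.span_base)
      next
        fix f assume "f \<in> C.span {\<Phi> e1, \<Phi> e2}"
        then obtain x y where "f - cscale x (\<Phi> e1) = cscale y (\<Phi> e2)"
          unfolding C.span_insert[of "\<Phi> e1"] C.span_singleton by blast
        then have "f = cscale x (\<Phi> e1) + cscale y (\<Phi> e2)"
          by (simp add: diff_eq_eq add.commute)
        then show "f \<in> {cscale x (\<Phi> e1) + cscale y (\<Phi> e2) | x y. True}" by blast
      qed
      finally show ?thesis unfolding eig True by simp
    qed
    moreover have "\<Phi> e1 \<noteq> \<Phi> e2" using notin C.span_base by auto
    ultimately show ?thesis
      using True C.dim_span_eq_card_independent[OF ind] unfolding multiplicity_of_def by simp
  next
    case False
    define N where "N = monodromy \<alpha> z - mat 1"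
    have ker: "monodromy \<alpha> z *v v = v \<longleftrightarrow> N *v v = 0" for v
      unfolding N_def by (simp add: matrix_vector_mult_diff_rdistrib)
    have "det N = 0" unfolding N_def det_minus_one using assms by (simp add: det_monodromy)
    then have det: "N $ 1 $ 1 * N $ 2 $ 2 = N $ 1 $ 2 * N $ 2 $ 1" unfolding det_2 by simp
    have app: "N *v v = 0 \<longleftrightarrow> N $ 1 $ 1 * v $ 1 + N $ 1 $ 2 * v $ 2 = 0 \<and> N $ 2 $ 1 * v $ 1 + N $ 2 $ 2 * v $ 2 = 0" for v
      by (simp add: matrix_vector_mult_def vec_eq_iff forall_2 sum_2)
    have "N \<noteq> 0" using False by (simp add: N_def)
    then obtain i where i: "N $ i $ 1 \<noteq> 0 \<or> N $ i $ 2 \<noteq> 0"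
      by (auto simp: vec_eq_iff forall_2)
    define v :: "complex^2" where "v = vector [- N $ i $ 2, N $ i $ 1]"
    have v0: "v \<noteq> 0" using i by (auto simp: v_def vec_eq_iff forall_2)
    have Nv: "N *v v = 0"
      using exhaust_2[of i] det unfolding app v_def by (auto simp: algebra_simps)
    have mult: "\<exists>x. u = x *s v" if u: "N *v u = 0" for u
    proof -
      have *: "N $ i $ 1 * u $ 1 + N $ i $ 2 * u $ 2 = 0"
        using exhaust_2[of i] u unfolding app by auto
      show ?thesis
      proof (cases "N $ i $ 1 = 0")
        case False
        then have "u = (u $ 2 / N $ i $ 1) *s v"
          using * by (simp add: v_def vec_eq_iff forall_2 field_simps eq_neg_iff_add_eq_0)
        then show ?thesis ..
      next
        case True
        then have "u = (- u $ 1 / N $ i $ 2) *s v"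
          using * i by (simp add: v_def vec_eq_iff forall_2)
        then show ?thesis ..
      qed
    qed
    have "eigenspace (graph_laplacian G \<alpha>) z = C.span {\<Phi> v}"
    proof -
      have "N *v (x *s v) = 0" for x using Nv by (simp add: vector_scalar_commute)
      then have "{u. N *v u = 0} = range (\<lambda>x. x *s v)" using mult by blast
      then show ?thesis unfolding eig ker C.span_singleton by (simp add: image_image lin)
    qed
    moreover have "C.independent {\<Phi> v}" using zero v0 C.dependent_single by auto
    ultimately show ?thesis
      using False C.dim_span_eq_card_independent[of "{\<Phi> v}"] unfolding multiplicity_of_def by simp
  qed
qed

theorem isospectral_alternating:
  assumes \<alpha>: "\<alpha> $ 2 = - \<alpha> $ 1" "\<alpha> $ 3 = \<alpha> $ 1" "\<alpha> $ 4 = - \<alpha> $ 1" 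
    and len: "edge_length G 1 + edge_length G 3 \<noteq> edge_length G 2 + edge_length G 4"
  shows "isospectral G (graph_laplacian G \<alpha>) (graph_laplacian G (- \<alpha>))"
proof -
  have tr: "trace (monodromy (- \<alpha>) z) = trace (monodromy \<alpha> z)" for z
    by (rule trace_monodromy_alternating[OF \<alpha>])
  have m: "monodromy \<alpha> z = mat 1 \<longleftrightarrow> monodromy (- \<alpha>) z = mat 1" for z
    using monodromy_alternating_identity[of \<alpha> z] monodromy_alternating_identity[of "- \<alpha>" z] \<alpha> len by auto
  show ?thesis
    unfolding isospectral_def using multiplicity_of_eq tr m by (auto simp: spectrum_iff)
qed

end

section \<open>The secular function at high energy\<close>

text \<open>
  For phases \<open>x j = k l\<^sub>j\<close>, these are the contributions of the sets of two, three and four vertices to the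
  trace of the monodromy, without the powers of \<open>k\<close>.
\<close>

definition pair_term :: "real^4 \<Rightarrow> (4 \<Rightarrow> real) \<Rightarrow> real" where
  "pair_term a x = a$1 * a$2 * sin (x 1) * sin (x 2 + x 3 + x 4) + a$2 * a$3 * sin (x 2) * sin (x 3 + x 4 + x 1)
     + a$3 * a$4 * sin (x 3) * sin (x 4 + x 1 + x 2) + a$4 * a$1 * sin (x 4) * sin (x 1 + x 2 + x 3)
     + a$1 * a$3 * sin (x 1 + x 2) * sin (x 3 + x 4) + a$2 * a$4 * sin (x 2 + x 3) * sin (x 4 + x 1)"

definition triple_term :: "real^4 \<Rightarrow> (4 \<Rightarrow> real) \<Rightarrow> real" where
  "triple_term a x = a$1 * a$2 * a$3 * sin (x 1) * sin (x 2) * sin (x 3 + x 4)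
     + a$2 * a$3 * a$4 * sin (x 2) * sin (x 3) * sin (x 4 + x 1)
     + a$3 * a$4 * a$1 * sin (x 3) * sin (x 4) * sin (x 1 + x 2)
     + a$4 * a$1 * a$2 * sin (x 4) * sin (x 1) * sin (x 2 + x 3)"

definition quadruple_term :: "real^4 \<Rightarrow> (4 \<Rightarrow> real) \<Rightarrow> real" where
  "quadruple_term a x = a$1 * a$2 * a$3 * a$4 * sin (x 1) * sin (x 2) * sin (x 3) * sin (x 4)"

definition total :: "real^4 \<Rightarrow> real" where
  "total a = a$1 + a$2 + a$3 + a$4"

lemma fcos_fsin_real:
  assumes "k \<noteq> 0"
  shows "fcos (of_real (k\<^sup>2)) x = of_real (cos (k * x))"
    and "fsin (of_real (k\<^sup>2)) x = of_real (sin (k * x) / k)"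
proof -
  have r: "csqrt (of_real (k\<^sup>2)) = of_real \<bar>k\<bar>"
    by (subst csqrt_of_real_nonneg) simp_all
  have "fcos (of_real (k\<^sup>2)) x = cos (of_real (\<bar>k\<bar> * x))"
    unfolding fcos_def r of_real_mult ..
  also have "\<dots> = of_real (cos (\<bar>k\<bar> * x))" by (rule cos_of_real)
  also have "cos (\<bar>k\<bar> * x) = cos (k * x)" by (simp add: abs_if)
  finally show "fcos (of_real (k\<^sup>2)) x = of_real (cos (k * x))" .
  have "of_real (k\<^sup>2) \<noteq> (0 :: complex)" using assms by simp
  then have "fsin (of_real (k\<^sup>2)) x = sin (of_real (\<bar>k\<bar> * x)) / of_real \<bar>k\<bar>"
    unfolding fsin_def r of_real_mult by (rule if_not_P)
  also have "\<dots> = of_real (sin (\<bar>k\<bar> * x) / \<bar>k\<bar>)" unfolding sin_of_real of_real_divide ..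
  also have "sin (\<bar>k\<bar> * x) / \<bar>k\<bar> = sin (k * x) / k" by (simp add: abs_if)
  finally show "fsin (of_real (k\<^sup>2)) x = of_real (sin (k * x) / k)" .
qed

context cycle
begin

definition perimeter :: real where
  "perimeter = edge_length G 1 + edge_length G 2 + edge_length G 3 + edge_length G 4"

definition phases :: "real \<Rightarrow> 4 \<Rightarrow> real" where
  "phases k j = k * edge_length G j"

text \<open>
  The value \<open>k\<^sup>2 (trace - 2)\<close>, a scaling that has a finite limit near the zeros of
  \<open>2 cos (k L) - 2\<close>.
\<close>

definition secular :: "real^4 \<Rightarrow> real \<Rightarrow> real" where
  "secular a k = k\<^sup>2 * (2 * cos (k * perimeter) - 2) + total a * (k * sin (k * perimeter))
     + pair_term a (phases k) + triple_term a (phases k) / k + quadruple_term a (phases k) / k\<^sup>2"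

lemma trace_monodromy:
  fixes \<alpha> :: "real^4"
  defines "l \<equiv> edge_length G"
  shows "trace (monodromy \<alpha> z) = 2 * fcos z (l 1 + l 2 + l 3 + l 4) 
    + (of_real (\<alpha>$1) + of_real (\<alpha>$2) + of_real (\<alpha>$3) + of_real (\<alpha>$4)) * fsin z (l 1 + l 2 + l 3 + l 4)
    + (of_real (\<alpha>$1) * of_real (\<alpha>$2) * fsin z (l 1) * fsin z (l 2 + l 3 + l 4) + of_real (\<alpha>$2) * of_real (\<alpha>$3) * fsin z (l 2) * fsin z (l 3 + l 4 + l 1)
     + of_real (\<alpha>$3) * of_real (\<alpha>$4) * fsin z (l 3) * fsin z (l 4 + l 1 + l 2) + of_real (\<alpha>$4) * of_real (\<alpha>$1) * fsin z (l 4) * fsin z (l 1 + l 2 + l 3)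
     + of_real (\<alpha>$1) * of_real (\<alpha>$3) * fsin z (l 1 + l 2) * fsin z (l 3 + l 4) + of_real (\<alpha>$2) * of_real (\<alpha>$4) * fsin z (l 2 + l 3) * fsin z (l 4 + l 1))
    + (of_real (\<alpha>$1) * of_real (\<alpha>$2) * of_real (\<alpha>$3) * fsin z (l 1) * fsin z (l 2) * fsin z (l 3 + l 4)
     + of_real (\<alpha>$2) * of_real (\<alpha>$3) * of_real (\<alpha>$4) * fsin z (l 2) * fsin z (l 3) * fsin z (l 4 + l 1)
     + of_real (\<alpha>$3) * of_real (\<alpha>$4) * of_real (\<alpha>$1) * fsin z (l 3) * fsin z (l 4) * fsin z (l 1 + l 2)
     + of_real (\<alpha>$4) * of_real (\<alpha>$1) * of_real (\<alpha>$2) * fsin z (l 4) * fsin z (l 1) * fsin z (l 2 + l 3))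
    + of_real (\<alpha>$1) * of_real (\<alpha>$2) * of_real (\<alpha>$3) * of_real (\<alpha>$4) * fsin z (l 1) * fsin z (l 2) * fsin z (l 3) * fsin z (l 4)"
  unfolding monodromy_def transfer_eq trace_around[of "\<lambda>k. of_real (\<alpha> $ k)"] fcos_fsin_add l_def
  by algebra

lemma secular_iff:
  assumes "k \<noteq> 0"
  shows "of_real (k\<^sup>2) \<in> op_spectrum G (graph_laplacian G \<alpha>) \<longleftrightarrow> secular \<alpha> k = 0"
proof -
  have "trace (monodromy \<alpha> (of_real (k\<^sup>2))) = of_real (2 + secular \<alpha> k / k\<^sup>2)"
    unfolding trace_monodromy fcos_fsin_real[OF assms] secular_def perimeter_def pair_term_def
      triple_term_def quadruple_term_def total_def phases_def
    using assms
    by (simp add: field_simps power2_eq_square)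
  then have "trace (monodromy \<alpha> (of_real (k\<^sup>2))) = 2 \<longleftrightarrow> complex_of_real (2 + secular \<alpha> k / k\<^sup>2) = of_real 2"
    by simp
  also have "\<dots> \<longleftrightarrow> secular \<alpha> k = 0"
    unfolding of_real_eq_iff using assms by simp
  finally show ?thesis unfolding spectrum_iff .
qed

end

text \<open>
  Phases converge modulo \<open>2 \<pi>\<close> only. The function \<open>cis\<close> expresses this, and it is compatible with adding
  phases.
\<close>

lemma tendsto_cis_add:
  assumes "((\<lambda>p. cis (x p)) \<longlongrightarrow> cis s) F" "((\<lambda>p. cis (y p)) \<longlongrightarrow> cis t) F"
  shows "((\<lambda>p. cis (x p + y p)) \<longlongrightarrow> cis (s + t)) F"
  using tendsto_mult[OF assms] by (simp add: cis_mult)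

lemma tendsto_sin_cis:
  assumes "((\<lambda>p. cis (x p)) \<longlongrightarrow> cis s) F"
  shows "((\<lambda>p. sin (x p)) \<longlongrightarrow> sin s) F"
  using tendsto_Im[OF assms] by simp

lemma tendsto_terms:
  assumes "\<And>j. ((\<lambda>p. cis (X p j)) \<longlongrightarrow> cis (\<theta> j)) F"
  shows "((\<lambda>p. pair_term a (X p)) \<longlongrightarrow> pair_term a \<theta>) F"
    and "((\<lambda>p. triple_term a (X p)) \<longlongrightarrow> triple_term a \<theta>) F"
    and "((\<lambda>p. quadruple_term a (X p)) \<longlongrightarrow> quadruple_term a \<theta>) F"
  unfolding pair_term_def triple_term_def quadruple_term_def
  by (intro tendsto_add tendsto_mult tendsto_const tendsto_sin_cis tendsto_cis_add assms)+

text \<open>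
  The number \<open>\<bar>\<Sum> a\<^sub>j exp (2 \<i> \<phi>\<^sub>j)\<bar>\<^sup>2\<close>.
\<close>

definition discriminant :: "real^4 \<Rightarrow> (4 \<Rightarrow> real) \<Rightarrow> real" where
  "discriminant a \<phi> = (\<Sum>j\<in>UNIV. a $ j * cos (2 * \<phi> j))\<^sup>2 + (\<Sum>j\<in>UNIV. a $ j * sin (2 * \<phi> j))\<^sup>2"

definition differences :: "(4 \<Rightarrow> real) \<Rightarrow> 4 \<Rightarrow> real" where
  "differences \<phi> j = \<phi> (j + 1) - \<phi> j"

text \<open>
  The right-hand side is the discriminant of the limiting quadratic polynomial. Since
  the differences add up to zero around the cycle, every pair \<open>i, j\<close> contributes \<open>- a\<^sub>i a\<^sub>j sin\<^sup>2 (\<phi>\<^sub>i - \<phi>\<^sub>j)\<close>, and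
  \<open>1 - 2 sin\<^sup>2\<close> is the cosine of the doubled difference.
\<close>

lemma discriminant_eq: "discriminant a \<phi> = (total a)\<^sup>2 + 4 * pair_term a (differences \<phi>)"
proof -
  have pr: "cos (2 * x) * cos (2 * y) + sin (2 * x) * sin (2 * y) = 1 - 2 * (sin (x - y))\<^sup>2" for x y :: real
  proof -
    have "cos (2 * x) * cos (2 * y) + sin (2 * x) * sin (2 * y) = cos (2 * (x - y))"
      by (simp add: cos_diff right_diff_distrib)
    then show ?thesis by (simp only: cos_double_sin)
  qed
  have "pair_term a (differences \<phi>) = - (a$1 * a$2 * (sin (\<phi> 1 - \<phi> 2))\<^sup>2 + a$2 * a$3 * (sin (\<phi> 2 - \<phi> 3))\<^sup>2
     + a$3 * a$4 * (sin (\<phi> 3 - \<phi> 4))\<^sup>2 + a$4 * a$1 * (sin (\<phi> 4 - \<phi> 1))\<^sup>2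
     + a$1 * a$3 * (sin (\<phi> 1 - \<phi> 3))\<^sup>2 + a$2 * a$4 * (sin (\<phi> 2 - \<phi> 4))\<^sup>2)"
  proof -
    have s: "sin (x - y) = - sin (y - x)" for x y :: real by (metis minus_diff_eq sin_minus)
    have e: "\<phi> 2 - \<phi> 1 + (\<phi> 3 - \<phi> 2) = \<phi> 3 - \<phi> 1" "\<phi> 3 - \<phi> 2 + (\<phi> 4 - \<phi> 3) = \<phi> 4 - \<phi> 2"
      "\<phi> 4 - \<phi> 3 + (\<phi> 1 - \<phi> 4) = \<phi> 1 - \<phi> 3" "\<phi> 1 - \<phi> 4 + (\<phi> 2 - \<phi> 1) = \<phi> 2 - \<phi> 4"
      "\<phi> 4 - \<phi> 2 + (\<phi> 1 - \<phi> 4) = \<phi> 1 - \<phi> 2" "\<phi> 1 - \<phi> 3 + (\<phi> 2 - \<phi> 1) = \<phi> 2 - \<phi> 3"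
      "\<phi> 2 - \<phi> 4 + (\<phi> 3 - \<phi> 2) = \<phi> 3 - \<phi> 4" "\<phi> 3 - \<phi> 1 + (\<phi> 4 - \<phi> 3) = \<phi> 4 - \<phi> 1"
      by simp_all
    show ?thesis
      unfolding pair_term_def differences_def four_cycle e
      unfolding s[of "\<phi> 2" "\<phi> 1"] s[of "\<phi> 3" "\<phi> 2"] s[of "\<phi> 4" "\<phi> 3"] s[of "\<phi> 1" "\<phi> 4"] s[of "\<phi> 3" "\<phi> 1"] s[of "\<phi> 4" "\<phi> 2"]
      by algebra
  qed
  then show ?thesis
    unfolding discriminant_def total_def sum_4
    using pr[of "\<phi> 1" "\<phi> 2"] pr[of "\<phi> 2" "\<phi> 3"] pr[of "\<phi> 3" "\<phi> 4"] pr[of "\<phi> 4" "\<phi> 1"] pr[of "\<phi> 1" "\<phi> 3"] pr[of "\<phi> 2" "\<phi> 4"]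
      sin_cos_squared_add[of "2 * \<phi> 1"] sin_cos_squared_add[of "2 * \<phi> 2"] sin_cos_squared_add[of "2 * \<phi> 3"] sin_cos_squared_add[of "2 * \<phi> 4"]
    by algebra
qed

text \<open>
  The continuous extension of \<open>sin x / x\<close>, so that no case distinction is needed where a phase
  correction vanishes.
\<close>

definition sinc :: "real \<Rightarrow> real" where
  "sinc x = (if x = 0 then 1 else sin x / x)"

lemma sinc_mult: "x * sinc x = sin x"
  by (simp add: sinc_def)

lemma tendsto_sinc:
  assumes "(f \<longlongrightarrow> 0) F"
  shows "((\<lambda>p. sinc (f p)) \<longlongrightarrow> 1) F"
proof -
  have "isCont sinc 0"
  proof -
    have "((\<lambda>x. (sin x - sin 0) / (x - 0)) \<longlongrightarrow> cos 0) (at (0::real))"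
      using DERIV_sin[of 0] unfolding has_field_derivative_iff by simp
    then have "(sinc \<longlongrightarrow> cos 0) (at 0)"
      by (rule Lim_transform_eventually) (auto simp: eventually_at_filter sinc_def)
    then show ?thesis by (simp add: isCont_def sinc_def)
  qed
  from isCont_tendsto_compose[OF this assms] show ?thesis by (simp add: sinc_def)
qed

context cycle
begin

text \<open>
  The points \<open>K m\<close> are zeros of \<open>cos (k L) - 1\<close> that escape to infinity, in either direction, while the
  phases converge.
\<close>

definition approaching :: "(nat \<Rightarrow> real) \<Rightarrow> (4 \<Rightarrow> real) \<Rightarrow> bool" where
  "approaching K \<theta> \<longleftrightarrow> filterlim K at_infinity sequentially \<and> (\<forall>m. cis (K m * perimeter) = 1) \<and>
     (\<forall>j. (\<lambda>m. cis (K m * edge_length G j)) \<longlonglongrightarrow> cis (\<theta> j))"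

text \<open>
  The point \<open>k = k\<^sub>0 + \<kappa> / (L k\<^sub>0)\<close>; with this step the first three terms of the secular function all
  tend to finite limits.
\<close>

definition perturbed :: "(nat \<Rightarrow> real) \<Rightarrow> nat \<times> real \<Rightarrow> real" where
  "perturbed K p = K (fst p) + snd p / (perimeter * K (fst p))"

lemma length_pos: "edge_length G e > 0"
  using lo_less_hi[of e] by (simp add: edge_length_def)

lemma perimeter_pos: "perimeter > 0"
  unfolding perimeter_def using length_pos by (simp add: add_pos_pos)

text \<open>
  With \<open>cos (k L) = cos (\<kappa> / k\<^sub>0)\<close>, the term \<open>k\<^sup>2 (2 cos (k L) - 2)\<close> tends to \<open>- \<kappa>\<^sup>2\<close> and \<open>k sin (k L)\<close> to \<open>\<kappa>\<close>, while
  the phases feel only the limit of \<open>k\<^sub>0 l\<^sub>j\<close>. The limit is taken jointly in the index and in \<open>\<kappa>\<close>, which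
  gives uniformity near \<open>\<kappa>\<^sub>0\<close>.
\<close>

lemma approaching_limits:
  fixes \<kappa>\<^sub>0 :: real
  assumes K: "approaching K \<theta>"
  defines "F \<equiv> sequentially \<times>\<^sub>F nhds \<kappa>\<^sub>0"
  shows "eventually (\<lambda>p. perturbed K p \<noteq> 0) F"
    and "((\<lambda>p. cis (phases (perturbed K p) j)) \<longlongrightarrow> cis (\<theta> j)) F"
    and "((\<lambda>p. secular a (perturbed K p)) \<longlongrightarrow> - \<kappa>\<^sub>0\<^sup>2 + total a * \<kappa>\<^sub>0 + pair_term a \<theta>) F"
proof -
  let ?K = "\<lambda>p. K (fst p)" and ?k = "perturbed K"
  have Kinf: "filterlim K at_infinity sequentially"
    and Kcis: "(\<lambda>m. cis (K m * edge_length G j)) \<longlonglongrightarrow> cis (\<theta> j)" for j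
    using K unfolding approaching_def by blast+
  have inf: "filterlim ?K at_infinity F"
    unfolding F_def by (rule filterlim_compose[OF Kinf filterlim_fst])
  have i0: "((\<lambda>p. inverse (?K p)) \<longlongrightarrow> 0) F"
    using filterlim_compose[OF tendsto_inverse_0 inf] .
  have nz: "eventually (\<lambda>p. ?K p \<noteq> 0) F"
    by (rule eventually_compose_filterlim[OF eventually_not_equal_at_infinity inf])
  have \<kappa>: "(snd \<longlongrightarrow> \<kappa>\<^sub>0) F"
    unfolding F_def by (rule filterlim_snd)
  have r: "((\<lambda>p. 1 + snd p / perimeter * inverse (?K p) * inverse (?K p)) \<longlongrightarrow> 1 + \<kappa>\<^sub>0 / perimeter * 0 * 0) F"
    using perimeter_pos by (intro tendsto_intros i0 \<kappa>) auto
  then have r1: "((\<lambda>p. 1 + snd p / perimeter * inverse (?K p) * inverse (?K p)) \<longlongrightarrow> 1) F" by simp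
  have rk: "?k p * inverse (?K p) = 1 + snd p / perimeter * inverse (?K p) * inverse (?K p)" if "?K p \<noteq> 0" for p
    using that perimeter_pos by (simp add: perturbed_def field_simps)
  have ratio: "((\<lambda>p. ?k p * inverse (?K p)) \<longlongrightarrow> 1) F"
    by (rule Lim_transform_eventually[OF r1], rule eventually_mono[OF nz]) (rule rk[symmetric])
  show knz: "eventually (\<lambda>p. ?k p \<noteq> 0) F"
    using tendsto_imp_eventually_ne[OF ratio, of 0] by (auto elim: eventually_mono)
  have ik: "((\<lambda>p. inverse (?k p)) \<longlongrightarrow> 0) F"
  proof -
    have "((\<lambda>p. inverse (?K p) * inverse (?k p * inverse (?K p))) \<longlongrightarrow> 0 * inverse 1) F"
      by (intro tendsto_intros i0 ratio) auto
    then have "((\<lambda>p. inverse (?K p) * inverse (?k p * inverse (?K p))) \<longlongrightarrow> 0) F" by simp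
    then show ?thesis
    proof (rule Lim_transform_eventually, intro eventually_mono[OF nz])
      show "inverse (?K p) * inverse (?k p * inverse (?K p)) = inverse (?k p)" if "?K p \<noteq> 0" for p
        using that by (simp add: inverse_mult_distrib)
    qed
  qed
  have cis: "((\<lambda>p. cis (phases (?k p) j)) \<longlongrightarrow> cis (\<theta> j)) F" for j
  proof -
    have "((\<lambda>p. cis (?K p * edge_length G j)) \<longlongrightarrow> cis (\<theta> j)) F"
      unfolding F_def by (rule filterlim_compose[OF Kcis filterlim_fst])
    moreover have "((\<lambda>p. cis (edge_length G j / perimeter * snd p * inverse (?K p))) \<longlongrightarrow> cis (edge_length G j / perimeter * \<kappa>\<^sub>0 * 0)) F"
      using perimeter_pos unfolding cis_conv_exp
      by (intro tendsto_intros i0 \<kappa>) auto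
    ultimately have "((\<lambda>p. cis (?K p * edge_length G j + edge_length G j / perimeter * snd p * inverse (?K p))) \<longlongrightarrow> cis (\<theta> j + edge_length G j / perimeter * \<kappa>\<^sub>0 * 0)) F"
      by (rule tendsto_cis_add)
    then show ?thesis
      by (simp add: phases_def perturbed_def field_simps)
  qed
  show "((\<lambda>p. cis (phases (?k p) j)) \<longlongrightarrow> cis (\<theta> j)) F" by (rule cis)
  have per: "cis (?k p * perimeter) = cis (snd p * inverse (?K p))" for p
  proof -
    have "?k p * perimeter = ?K p * perimeter + snd p * inverse (?K p)"
      using perimeter_pos by (simp add: perturbed_def field_simps)
    then show ?thesis
      using K unfolding approaching_def by (simp add: cis_mult[symmetric])
  qed
  then have per': "cos (?k p * perimeter) = cos (snd p * inverse (?K p))" "sin (?k p * perimeter) = sin (snd p * inverse (?K p))" for p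
    by (metis cis.sel(1), metis cis.sel(2))
  have t1: "((\<lambda>p. ?k p * sin (?k p * perimeter)) \<longlongrightarrow> \<kappa>\<^sub>0) F"
  proof -
    have z: "((\<lambda>p. snd p * inverse (?K p)) \<longlongrightarrow> 0) F"
      using tendsto_mult[OF \<kappa> i0] by simp
    have "((\<lambda>p. (?k p * inverse (?K p)) * (snd p * sinc (snd p * inverse (?K p)))) \<longlongrightarrow> 1 * (\<kappa>\<^sub>0 * 1)) F"
      by (intro tendsto_intros ratio \<kappa> tendsto_sinc z)
    moreover have "(?k p * inverse (?K p)) * (snd p * sinc (snd p * inverse (?K p))) = ?k p * sin (?k p * perimeter)" for p
      unfolding per' sinc_mult[of "snd p * inverse (?K p)", symmetric] by simp
    ultimately show ?thesis by simp
  qed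
  have t2: "((\<lambda>p. (?k p)\<^sup>2 * (2 * cos (?k p * perimeter) - 2)) \<longlongrightarrow> - \<kappa>\<^sub>0\<^sup>2) F"
  proof -
    have z: "((\<lambda>p. snd p * inverse (?K p) / 2) \<longlongrightarrow> 0) F"
      using tendsto_divide[OF tendsto_mult[OF \<kappa> i0] tendsto_const[of 2]] by simp
    have "((\<lambda>p. - ((?k p * inverse (?K p)) * (snd p * sinc (snd p * inverse (?K p) / 2)))\<^sup>2) \<longlongrightarrow> - (1 * (\<kappa>\<^sub>0 * 1))\<^sup>2) F"
      by (intro tendsto_intros ratio \<kappa> tendsto_sinc z)
    moreover have "- ((?k p * inverse (?K p)) * (snd p * sinc (snd p * inverse (?K p) / 2)))\<^sup>2
        = (?k p)\<^sup>2 * (2 * cos (?k p * perimeter) - 2)" for p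
    proof -
      define y where "y = snd p * inverse (?K p) / 2"
      have c: "cos (?k p * perimeter) = 1 - 2 * (sin y)\<^sup>2"
        unfolding per' y_def using cos_double_sin[of "snd p * inverse (?K p) / 2"] by simp
      have e: "(?k p * inverse (?K p)) * (snd p * sinc y) = 2 * ?k p * sin y"
        unfolding sinc_mult[of y, symmetric] by (simp add: y_def)
      show ?thesis unfolding y_def[symmetric] c e by algebra
    qed
    ultimately show ?thesis by simp
  qed
  have "((\<lambda>p. (?k p)\<^sup>2 * (2 * cos (?k p * perimeter) - 2) + total a * (?k p * sin (?k p * perimeter))
     + pair_term a (phases (?k p)) + triple_term a (phases (?k p)) * inverse (?k p) + quadruple_term a (phases (?k p)) * (inverse (?k p))\<^sup>2)
     \<longlongrightarrow> - \<kappa>\<^sub>0\<^sup>2 + total a * \<kappa>\<^sub>0 + pair_term a \<theta> + triple_term a \<theta> * 0 + quadruple_term a \<theta> * 0\<^sup>2) F"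
    by (intro tendsto_intros t1 t2 tendsto_terms cis ik)
  then show "((\<lambda>p. secular a (?k p)) \<longlongrightarrow> - \<kappa>\<^sub>0\<^sup>2 + total a * \<kappa>\<^sub>0 + pair_term a \<theta>) F"
    by (simp add: secular_def divide_inverse power_inverse)
qed

text \<open>
  At a simple root the limiting polynomial changes sign, so by the intermediate value theorem the secular
  function has zeros \<open>k\<close> that correspond to values of \<open>\<kappa>\<close> as close to \<open>\<kappa>\<^sub>0\<close> as desired. At these
  \<open>k\<close> the function \<open>X\<close> vanishes, hence so does its joint limit.
\<close>

lemma limit_vanishes_at_simple_root:
  assumes K: "approaching K \<theta>"
    and root: "- \<kappa>\<^sub>0\<^sup>2 + total b * \<kappa>\<^sub>0 + pair_term b \<theta> = 0" and simple: "2 * \<kappa>\<^sub>0 \<noteq> total b"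
    and X: "((\<lambda>p. X (perturbed K p)) \<longlongrightarrow> \<xi>) (sequentially \<times>\<^sub>F nhds \<kappa>\<^sub>0)"
    and zero: "\<And>k. k \<noteq> 0 \<Longrightarrow> secular b k = 0 \<Longrightarrow> X k = 0"
  shows "\<xi> = (0::real)"
proof (rule ccontr)
  assume "\<xi> \<noteq> 0"
  then have "eventually (\<lambda>p. X (perturbed K p) \<noteq> 0) (sequentially \<times>\<^sub>F nhds \<kappa>\<^sub>0)"
    by (rule tendsto_imp_eventually_ne[OF X])
  then have "eventually (\<lambda>p. X (perturbed K p) \<noteq> 0 \<and> perturbed K p \<noteq> 0) (sequentially \<times>\<^sub>F nhds \<kappa>\<^sub>0)"
    using approaching_limits(1)[OF K] by (rule eventually_conj)
  then obtain P Q where P: "eventually P sequentially" and Q: "eventually Q (nhds \<kappa>\<^sub>0)"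
    and PQ: "\<And>m \<kappa>. P m \<Longrightarrow> Q \<kappa> \<Longrightarrow> X (perturbed K (m, \<kappa>)) \<noteq> 0 \<and> perturbed K (m, \<kappa>) \<noteq> 0"
    unfolding eventually_prod_filter by (metis (no_types, lifting))
  obtain d where d: "d > 0" "\<And>\<kappa>. dist \<kappa> \<kappa>\<^sub>0 < d \<Longrightarrow> Q \<kappa>"
    using Q unfolding eventually_nhds_metric by blast
  \<comment> \<open>With \<open>p\<close> the limiting polynomial, \<open>p (\<kappa>\<^sub>0 + e) = e (g - e)\<close>; so \<open>p\<close> changes sign at distance \<open>e < \<bar>g\<bar>\<close>.\<close>
  define g where "g = total b - 2 * \<kappa>\<^sub>0"
  have g: "\<bar>g\<bar> > 0" using simple by (simp add: g_def)
  define e where "e = min (d / 2) (\<bar>g\<bar> / 2)"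
  have e: "e > 0" "e < d" "e < \<bar>g\<bar>" using d g by (auto simp: e_def min_def)
  define p where "p = (\<lambda>\<kappa>. - \<kappa>\<^sup>2 + total b * \<kappa> + pair_term b \<theta>)"
  have "p (\<kappa>\<^sub>0 + e) * p (\<kappa>\<^sub>0 - e) = - (e * e * (g * g - e * e))"
  proof -
    have "p (\<kappa>\<^sub>0 + e) = e * (g - e)" "p (\<kappa>\<^sub>0 - e) = - e * (g + e)"
      using root unfolding p_def g_def by algebra+
    then show ?thesis by algebra
  qed
  moreover have "e * e < g * g" using e by (metis abs_mult_self_eq abs_of_pos abs_mult_less)
  then have "e * e * (g * g - e * e) > 0" using e by simp
  ultimately have neg: "p (\<kappa>\<^sub>0 + e) * p (\<kappa>\<^sub>0 - e) < 0" by simp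
  have lim: "(\<lambda>m. secular b (perturbed K (m, \<kappa>))) \<longlonglongrightarrow> p \<kappa>" for \<kappa>
  proof -
    have "filterlim (\<lambda>m. (m, \<kappa>)) (sequentially \<times>\<^sub>F nhds \<kappa>) sequentially"
      by (intro filterlim_Pair filterlim_ident tendsto_const)
    from filterlim_compose[OF approaching_limits(3)[OF K] this] show ?thesis
      by (simp add: p_def)
  qed
  have "eventually (\<lambda>m. secular b (perturbed K (m, \<kappa>\<^sub>0 + e)) * secular b (perturbed K (m, \<kappa>\<^sub>0 - e)) < 0) sequentially"
    by (rule order_tendstoD(2)[OF tendsto_mult[OF lim lim] neg])
  then have "eventually (\<lambda>m. P m \<and> secular b (perturbed K (m, \<kappa>\<^sub>0 + e)) * secular b (perturbed K (m, \<kappa>\<^sub>0 - e)) < 0) sequentially"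
    using P by (intro eventually_conj)
  then obtain m where m: "P m" and sgn: "secular b (perturbed K (m, \<kappa>\<^sub>0 + e)) * secular b (perturbed K (m, \<kappa>\<^sub>0 - e)) < 0"
    using eventually_happens[of _ sequentially] by fastforce
  have nz: "X (perturbed K (m, \<kappa>)) \<noteq> 0 \<and> perturbed K (m, \<kappa>) \<noteq> 0" if "\<kappa> \<in> {\<kappa>\<^sub>0 - e..\<kappa>\<^sub>0 + e}" for \<kappa>
    using that e d by (intro PQ m d) (auto simp: dist_real_def)
  have "continuous_on {\<kappa>\<^sub>0 - e..\<kappa>\<^sub>0 + e} (\<lambda>\<kappa>. secular b (perturbed K (m, \<kappa>)))"
  proof -
    have c: "continuous_on {\<kappa>\<^sub>0 - e..\<kappa>\<^sub>0 + e} (\<lambda>\<kappa>. perturbed K (m, \<kappa>))"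
    proof -
      have "(\<lambda>\<kappa>. perturbed K (m, \<kappa>)) = (\<lambda>\<kappa>. K m + \<kappa> * inverse (perimeter * K m))"
        by (simp add: perturbed_def divide_inverse)
      then show ?thesis by (simp only:) (intro continuous_intros)
    qed
    show ?thesis
      unfolding secular_def pair_term_def triple_term_def quadruple_term_def phases_def
      by (intro continuous_intros c) (use nz in auto)
  qed
  then have "\<exists>\<kappa>\<in>{\<kappa>\<^sub>0 - e..\<kappa>\<^sub>0 + e}. secular b (perturbed K (m, \<kappa>)) = 0"
  proof (cases "secular b (perturbed K (m, \<kappa>\<^sub>0 - e)) < 0")
    case True
    then have "0 \<le> secular b (perturbed K (m, \<kappa>\<^sub>0 + e))" using sgn by (simp add: mult_less_0_iff)
    then show ?thesis
      using IVT'[of "\<lambda>\<kappa>. secular b (perturbed K (m, \<kappa>))" "\<kappa>\<^sub>0 - e" 0 "\<kappa>\<^sub>0 + e"] True e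
        \<open>continuous_on _ _\<close> by fastforce
  next
    case False
    then have "secular b (perturbed K (m, \<kappa>\<^sub>0 + e)) \<le> 0" using sgn by (simp add: mult_less_0_iff)
    then show ?thesis
      using IVT2'[of "\<lambda>\<kappa>. secular b (perturbed K (m, \<kappa>))" "\<kappa>\<^sub>0 + e" 0 "\<kappa>\<^sub>0 - e"] False e
        \<open>continuous_on _ _\<close> by fastforce
  qed
  then show False using nz zero by blast
qed

end

section \<open>Prescribing the phases\<close>

lemma rationally_independent_int:
  fixes l :: "4 \<Rightarrow> real"
  assumes l: "rationally_independent l"
    and zero: "of_int p * l 1 + of_int q * l 2 + of_int r * l 3 + of_int s * l 4 = 0"
  shows "p = 0 \<and> q = 0 \<and> r = 0 \<and> s = 0"
proof -
  define c :: "4 \<Rightarrow> rat" where "c = (\<lambda>i. if i = 1 then of_int p else if i = 2 then of_int q else if i = 3 then of_int r else of_int s)"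
  have c: "c 1 = of_int p" "c 2 = of_int q" "c 3 = of_int r" "c 4 = of_int s" by (simp_all add: c_def)
  have "(\<Sum>i\<in>UNIV. of_rat (c i) * l i) = 0"
    unfolding sum_4 c using zero by simp
  then have "c 1 = 0 \<and> c 2 = 0 \<and> c 3 = 0 \<and> c 4 = 0"
    using l unfolding rationally_independent_def by blast
  then show ?thesis unfolding c by simp
qed

lemma filterlim_int_at_infinity:
  fixes n :: "nat \<Rightarrow> int"
  assumes "\<And>k. eventually (\<lambda>m. n m \<noteq> k) sequentially"
  shows "filterlim (\<lambda>m. real_of_int (n m)) at_infinity sequentially"
proof (subst filterlim_at_infinity[OF order_refl], intro allI impI)
  fix r :: real
  have "eventually (\<lambda>m. \<forall>k\<in>{- \<lceil>r\<rceil>..\<lceil>r\<rceil>}. n m \<noteq> k) sequentially"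
    using assms by (intro eventually_ball_finite) auto
  then show "eventually (\<lambda>m. r \<le> norm (real_of_int (n m))) sequentially"
  proof (rule eventually_mono)
    fix m assume "\<forall>k\<in>{- \<lceil>r\<rceil>..\<lceil>r\<rceil>}. n m \<noteq> k"
    then have "\<lceil>r\<rceil> < \<bar>n m\<bar>" by force
    then show "r \<le> norm (real_of_int (n m))" by (simp add: ceiling_less_iff less_imp_le)
  qed
qed

locale independent_cycle = cycle +
  assumes independent: "rationally_independent (edge_length G)"
begin

lemma independent_int:
  "of_int p * edge_length G 1 + of_int q * edge_length G 2 + of_int r * edge_length G 3 + of_int s * edge_length G 4 = 0
    \<Longrightarrow> p = 0 \<and> q = 0 \<and> r = 0 \<and> s = 0"
  by (rule rationally_independent_int[OF independent])

text \<open>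
  The numbers \<open>l\<^sub>1 / L, l\<^sub>2 / L, l\<^sub>3 / L, 1\<close> are independent over the integers because \<open>l\<^sub>1, \<dots>, l\<^sub>4\<close> are.
\<close>

lemma kronecker_approximation:
  assumes "\<epsilon> > 0"
  obtains n h1 h2 h3 :: int where
    "\<bar>n * (edge_length G 1 / perimeter) - h1 - \<beta>1\<bar> < \<epsilon>"
    "\<bar>n * (edge_length G 2 / perimeter) - h2 - \<beta>2\<bar> < \<epsilon>"
    "\<bar>n * (edge_length G 3 / perimeter) - h3 - \<beta>3\<bar> < \<epsilon>"
proof -
  define \<theta> :: "nat \<Rightarrow> real" where "\<theta> = (\<lambda>i. if i = 0 then edge_length G 1 / perimeter
     else if i = 1 then edge_length G 2 / perimeter else if i = 2 then edge_length G 3 / perimeter else 1)"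
  define \<beta> :: "nat \<Rightarrow> real" where "\<beta> = (\<lambda>i. if i = 0 then \<beta>1 else if i = 1 then \<beta>2 else \<beta>3)"
  have \<theta>: "\<theta> 0 = edge_length G 1 / perimeter" "\<theta> (Suc 0) = edge_length G 2 / perimeter" "\<theta> (Suc (Suc 0)) = edge_length G 3 / perimeter" "\<theta> (Suc (Suc (Suc 0))) = 1"
    by (simp_all add: \<theta>_def)
  have four: "{..3::nat} = {0, Suc 0, Suc (Suc 0), Suc (Suc (Suc 0))}" by auto
  have zero: "u 0 = 0 \<and> u (Suc 0) = 0 \<and> u (Suc (Suc 0)) = 0 \<and> u (Suc (Suc (Suc 0))) = 0"
    if "of_int (u 0) * \<theta> 0 + of_int (u (Suc 0)) * \<theta> (Suc 0) + of_int (u (Suc (Suc 0))) * \<theta> (Suc (Suc 0)) + of_int (u (Suc (Suc (Suc 0)))) * \<theta> (Suc (Suc (Suc 0))) = 0"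
    for u :: "nat \<Rightarrow> int"
  proof -
    define s where "s = u (Suc (Suc (Suc 0)))"
    have "of_int (u 0) * edge_length G 1 + of_int (u (Suc 0)) * edge_length G 2 + of_int (u (Suc (Suc 0))) * edge_length G 3 + of_int s * perimeter = 0"
      using that perimeter_pos unfolding \<theta> s_def by (simp add: field_simps)
    then have "of_int (u 0 + s) * edge_length G 1 + of_int (u (Suc 0) + s) * edge_length G 2 + of_int (u (Suc (Suc 0)) + s) * edge_length G 3 + of_int s * edge_length G 4 = 0"
      unfolding perimeter_def by (simp add: algebra_simps)
    from independent_int[OF this] show ?thesis by (simp add: s_def)
  qed
  have inj: "inj_on \<theta> {..3}"
  proof (rule inj_onI, rule ccontr)
    fix i j :: nat assume ij: "i \<in> {..3}" "j \<in> {..3}" "\<theta> i = \<theta> j" "i \<noteq> j"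
    \<comment> \<open>Equal values at \<open>i\<close> and \<open>j\<close> are the integer relation with coefficients \<open>1\<close> and \<open>- 1\<close>.\<close>
    define u :: "nat \<Rightarrow> int" where "u = (\<lambda>k. if k = i then 1 else if k = j then - 1 else 0)"
    have "u i = 0"
      using zero[of u] ij unfolding four by (auto simp: u_def)
    then show False by (simp add: u_def)
  qed
  interpret Z: Modules.module "\<lambda>r x. real_of_int r * x"
    by (simp add: Modules.module.intro distrib_left distrib_right mult.commute)
  have indep: "Z.independent (\<theta> ` {..3})"
  proof -
    have "u v = 0" if "(\<Sum>v\<in>\<theta> ` {..3}. of_int (u v) * v) = 0" "v \<in> \<theta> ` {..3}" for u v
    proof -
      have "(\<Sum>i\<in>{..3}. of_int (u (\<theta> i)) * \<theta> i) = 0"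
        using that(1) by (simp add: sum.reindex[OF inj])
      then have "of_int ((u \<circ> \<theta>) 0) * \<theta> 0 + of_int ((u \<circ> \<theta>) (Suc 0)) * \<theta> (Suc 0) + of_int ((u \<circ> \<theta>) (Suc (Suc 0))) * \<theta> (Suc (Suc 0)) + of_int ((u \<circ> \<theta>) (Suc (Suc (Suc 0)))) * \<theta> (Suc (Suc (Suc 0))) = 0"
        unfolding four by (simp add: add.assoc)
      from zero[OF this] show ?thesis using that(2) unfolding four by auto
    qed
    then show ?thesis
      by (subst Z.dependent_finite) auto
  qed
  have "\<theta> 3 = 1" by (simp add: \<theta>_def)
  obtain k m where km: "\<And>i. i < 3 \<Longrightarrow> \<bar>of_int k * \<theta> i - of_int (m i) - \<beta> i\<bar> < \<epsilon>"
    using Kronecker_thm_2[OF indep inj \<open>\<theta> 3 = 1\<close> assms] by blast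
  show ?thesis
    using km[of 0] km[of 1] km[of 2] by (intro that[of k "m 0" "m 1" "m 2"]) (simp_all add: \<theta>_def \<beta>_def)
qed

text \<open>
  Kronecker's theorem yields integers \<open>n m\<close> without a lower bound on their size. A bounded subsequence would
  repeat some integer \<open>k\<close> forever, which then satisfies \<open>k l\<^sub>1 / L - r \<in> \<int>\<close>; this contradicts the
  irrationality of \<open>l\<^sub>1 / L\<close> for \<open>k \<noteq> 0\<close>, and \<open>r \<notin> \<int>\<close> for \<open>k = 0\<close>. The fourth phase is
  determined by the other three, as the total phase is a multiple of \<open>2 \<pi>\<close>.
\<close>

lemma approaching_exists:
  assumes r: "\<phi> 1 = 0" "\<phi> 2 = 2 * pi * r" "r \<in> \<rat>" "r \<notin> \<int>"
  obtains K where "approaching K (differences \<phi>)"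
proof -
  define \<beta> where "\<beta> = (\<lambda>j. differences \<phi> j / (2 * pi))"
  define l where "l = (\<lambda>j. edge_length G j / perimeter)"
  have "\<exists>(n::int) (h1::int) (h2::int) (h3::int). \<bar>n * l 1 - h1 - \<beta> 1\<bar> < inverse (real (Suc m)) \<and>
    \<bar>n * l 2 - h2 - \<beta> 2\<bar> < inverse (real (Suc m)) \<and> \<bar>n * l 3 - h3 - \<beta> 3\<bar> < inverse (real (Suc m))" for m
    unfolding l_def by (rule kronecker_approximation[of "inverse (real (Suc m))" "\<beta> 1" "\<beta> 2" "\<beta> 3"]) auto
  then obtain n h1 h2 h3 :: "nat \<Rightarrow> int" where
    nh: "\<And>m. \<bar>n m * l 1 - h1 m - \<beta> 1\<bar> < inverse (real (Suc m))" "\<And>m. \<bar>n m * l 2 - h2 m - \<beta> 2\<bar> < inverse (real (Suc m))"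
      "\<And>m. \<bar>n m * l 3 - h3 m - \<beta> 3\<bar> < inverse (real (Suc m))"
    by metis
  have b1: "\<beta> 1 = r" using r by (simp add: \<beta>_def differences_def)
  have notint: "k * l 1 - r \<notin> \<int>" for k :: int
  proof
    assume "k * l 1 - r \<in> \<int>"
    then obtain h :: int where h: "k * l 1 - r = h" by (auto elim: Ints_cases)
    obtain p q :: int where q: "q > 0" "r = of_int p / of_int q"
      using \<open>r \<in> \<rat>\<close> by (metis Rats_cases')
    have "of_int (q * k) * edge_length G 1 = of_int (q * h + p) * perimeter"
      using h q perimeter_pos by (simp add: l_def field_simps)
    then have "of_int (q * k - (q * h + p)) * edge_length G 1 + of_int (- (q * h + p)) * edge_length G 2 
        + of_int (- (q * h + p)) * edge_length G 3 + of_int (- (q * h + p)) * edge_length G 4 = 0"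
      unfolding perimeter_def by (simp add: algebra_simps)
    from independent_int[OF this] have "p = q * (- h)" by auto
    then have "r = of_int (- h)" using q by simp
    then show False using \<open>r \<notin> \<int>\<close> by auto
  qed
  have "eventually (\<lambda>m. n m \<noteq> k) sequentially" for k
  proof -
    define x where "x = k * l 1 - r"
    \<comment> \<open>The integer \<open>k\<close> misses the target by at least \<open>d\<close>, so it is not used once the tolerance is below \<open>d\<close>.\<close>
    define d where "d = \<bar>x - round x\<bar>"
    have "x \<noteq> of_int (round x)" using notint[of k] unfolding x_def by (metis Ints_of_int)
    then have d: "d > 0" by (simp add: d_def)
    have "eventually (\<lambda>m. inverse (real (Suc m)) < d) sequentially"
      using LIMSEQ_inverse_real_of_nat d by (rule order_tendstoD(2))
    then show ?thesis
    proof (rule eventually_mono)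
      fix m assume small: "inverse (real (Suc m)) < d"
      show "n m \<noteq> k"
      proof
      assume m: "n m = k"
      have "d \<le> \<bar>x - of_int (h1 m)\<bar>" unfolding d_def by (rule round_diff_minimal)
      also have "\<dots> = \<bar>n m * l 1 - h1 m - \<beta> 1\<bar>" using m by (simp add: x_def b1 algebra_simps)
      also have "\<dots> < inverse (real (Suc m))" by (rule nh)
      finally show False using small by simp
      qed
    qed
  qed
  then have inf: "filterlim (\<lambda>m. real_of_int (n m)) at_infinity sequentially"
    by (rule filterlim_int_at_infinity)
  define K where "K = (\<lambda>m. 2 * pi / perimeter * n m)"
  have "filterlim K at_infinity sequentially"
    unfolding K_def using perimeter_pos by (intro tendsto_mult_filterlim_at_infinity[OF tendsto_const _ inf]) auto
  moreover have per: "cis (K m * perimeter) = 1" for m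
    using perimeter_pos by (simp add: K_def cis_multiple_2pi)
  moreover have lim: "(\<lambda>m. cis (K m * edge_length G j)) \<longlonglongrightarrow> cis (differences \<phi> j)"
    if "\<And>m. \<bar>n m * l j - h m - \<beta> j\<bar> < inverse (real (Suc m))" for h :: "nat \<Rightarrow> int" and j
  proof -
    have "(\<lambda>m. n m * l j - h m - \<beta> j) \<longlonglongrightarrow> 0"
      by (rule Lim_null_comparison[OF _ LIMSEQ_inverse_real_of_nat])
        (use that in \<open>auto intro!: always_eventually less_imp_le\<close>)
    then have t: "(\<lambda>m. 2 * pi * ((n m * l j - h m - \<beta> j) + \<beta> j)) \<longlonglongrightarrow> 2 * pi * (0 + \<beta> j)"
      by (intro tendsto_add tendsto_mult tendsto_const)
    have "2 * pi * (0 + \<beta> j) = differences \<phi> j" by (simp add: \<beta>_def)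
    then have "(\<lambda>m. cis (2 * pi * ((n m * l j - h m - \<beta> j) + \<beta> j))) \<longlonglongrightarrow> cis (differences \<phi> j)"
      using tendsto_exp[OF tendsto_mult[OF tendsto_const[of \<i>] tendsto_of_real[OF t]]]
      unfolding cis_conv_exp by (simp only:)
    moreover have "cis (2 * pi * ((n m * l j - h m - \<beta> j) + \<beta> j)) = cis (K m * edge_length G j)" for m
    proof -
      have "K m * edge_length G j = 2 * pi * ((n m * l j - h m - \<beta> j) + \<beta> j) + 2 * pi * of_int (h m)"
        using perimeter_pos by (simp add: K_def l_def field_simps)
      then show ?thesis by (simp add: cis_mult[symmetric] cis_multiple_2pi)
    qed
    ultimately show ?thesis by simp
  qed
  moreover have "(\<lambda>m. cis (K m * edge_length G 4)) \<longlonglongrightarrow> cis (differences \<phi> 4)"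
  proof -
    have "(\<lambda>m. cnj (cis (K m * edge_length G 1 + K m * edge_length G 2 + K m * edge_length G 3)))
      \<longlonglongrightarrow> cnj (cis (differences \<phi> 1 + differences \<phi> 2 + differences \<phi> 3))"
      by (intro tendsto_cnj tendsto_cis_add lim[OF nh(1)] lim[OF nh(2)] lim[OF nh(3)])
    moreover have "cnj (cis (differences \<phi> 1 + differences \<phi> 2 + differences \<phi> 3)) = cis (differences \<phi> 4)"
      unfolding cis_cnj differences_def four_cycle by (simp add: algebra_simps)
    moreover have "cnj (cis (K m * edge_length G 1 + K m * edge_length G 2 + K m * edge_length G 3)) = cis (K m * edge_length G 4)" for m
    proof -
      have "K m * edge_length G 4 = K m * perimeter + - (K m * edge_length G 1 + K m * edge_length G 2 + K m * edge_length G 3)"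
        by (simp add: perimeter_def algebra_simps)
      then show ?thesis unfolding cis_cnj by (simp only: cis_mult[symmetric] per mult_1)
    qed
    ultimately show ?thesis by simp
  qed
  ultimately have "approaching K (differences \<phi>)"
    unfolding approaching_def using lim[OF nh(1)] lim[OF nh(2)] lim[OF nh(3)] by (simp only: forall_4) blast
  then show ?thesis using that by blast
qed

definition angles :: "real \<Rightarrow> real \<Rightarrow> real \<Rightarrow> 4 \<Rightarrow> real" where
  "angles x y u = (\<lambda>j. if j = 1 then 0 else if j = 2 then x else if j = 3 then y else u)"

lemma angles: "angles x y u 1 = 0" "angles x y u 2 = x" "angles x y u 3 = y" "angles x y u 4 = u"
  by (simp_all add: angles_def)

lemma approaching_angles:
  assumes "x = 2 * pi * r" "r \<in> \<rat>" "r \<notin> \<int>"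
  obtains K where "approaching K (differences (angles x y u))"
  using approaching_exists[of "angles x y u" r] assms by (auto simp: angles)

section \<open>Recovering the couplings\<close>

text \<open>
  Both roots of the limiting polynomial for \<open>b\<close> are simple, hence roots of the one for \<open>a\<close>; two quadratic
  polynomials with leading coefficient \<open>- 1\<close> and two common roots are equal.
\<close>

lemma leading_terms_agree:
  assumes zeros: "\<And>k. k \<noteq> 0 \<Longrightarrow> secular b k = 0 \<Longrightarrow> secular a k = 0"
    and K: "approaching K (differences \<phi>)" and pos: "discriminant b \<phi> \<noteq> 0"
  shows "total a = total b \<and> discriminant a \<phi> = discriminant b \<phi>"
proof -
  define D where "D = sqrt (discriminant b \<phi>)"
  have "discriminant b \<phi> \<ge> 0" by (simp add: discriminant_def)
  then have D: "D > 0" "D * D = discriminant b \<phi>" using pos by (auto simp: D_def)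
  have root: "- \<kappa>\<^sup>2 + total a * \<kappa> + pair_term a (differences \<phi>) = 0" 
    if "2 * \<kappa> = total b + D \<or> 2 * \<kappa> = total b - D" for \<kappa>
  proof (rule limit_vanishes_at_simple_root[OF K _ _ approaching_limits(3)[OF K] zeros])
    have "(2 * \<kappa> - total b)\<^sup>2 = discriminant b \<phi>"
      using that D(2) by (auto simp: power2_eq_square)
    then show "- \<kappa>\<^sup>2 + total b * \<kappa> + pair_term b (differences \<phi>) = 0"
      unfolding discriminant_eq by algebra
    show "2 * \<kappa> \<noteq> total b" using that D(1) by auto
  qed
  have 1: "(total b + D) * (total b + D) = 2 * total a * (total b + D) + 4 * pair_term a (differences \<phi>)"
    using root[of "(total b + D) / 2"] by (simp add: power2_eq_square field_simps)
  have 2: "(total b - D) * (total b - D) = 2 * total a * (total b - D) + 4 * pair_term a (differences \<phi>)"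
    using root[of "(total b - D) / 2"] by (simp add: power2_eq_square field_simps)
  have "4 * D * (total b - total a) = 0" using 1 2 by algebra
  then have t: "total a = total b" using D by simp
  moreover have "discriminant a \<phi> = discriminant b \<phi>"
    unfolding discriminant_eq[of a] D(2)[symmetric] using 1 t by algebra
  ultimately show ?thesis by blast
qed

context
  fixes \<alpha> \<beta> :: "real^4"
  assumes zeros: "\<And>k. k \<noteq> 0 \<Longrightarrow> secular \<alpha> k = 0 \<longleftrightarrow> secular \<beta> k = 0"
begin

lemma discriminants_agree:
  assumes K: "approaching K (differences \<phi>)"
  shows "discriminant \<alpha> \<phi> = discriminant \<beta> \<phi>"
    and "discriminant \<beta> \<phi> \<noteq> 0 \<Longrightarrow> total \<alpha> = total \<beta>"
  using leading_terms_agree[OF _ K, of \<alpha> \<beta>] leading_terms_agree[OF _ K, of \<beta> \<alpha>] zeros by metis+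

text \<open>
  Angles that are multiples of \<open>\<pi> / 2\<close> make every \<open>exp (2 \<i> \<phi>\<^sub>j)\<close> a sign. The sign \<open>1\<close> is represented by the
  angle \<open>\<pi>\<close>, not by \<open>0\<close>, since the second angle must not be a multiple of \<open>2 \<pi>\<close>.
\<close>

lemma signed_sums_agree:
  assumes "s \<in> {1, - 1}" "t \<in> {1, - 1}" "u \<in> {1, - 1}"
  shows "(\<alpha>$1 + s * \<alpha>$2 + t * \<alpha>$3 + u * \<alpha>$4)\<^sup>2 = (\<beta>$1 + s * \<beta>$2 + t * \<beta>$3 + u * \<beta>$4)\<^sup>2"
    and "\<beta>$1 + s * \<beta>$2 + t * \<beta>$3 + u * \<beta>$4 \<noteq> 0 \<Longrightarrow> total \<alpha> = total \<beta>"
proof -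
  define ang where "ang = (\<lambda>v::real. if v = 1 then pi else pi / 2)"
  have ang: "cos (2 * ang v) = v" "sin (2 * ang v) = 0" if "v \<in> {1, - 1}" for v
    using that by (auto simp: ang_def)
  define \<phi> where "\<phi> = angles (ang s) (ang t) (ang u)"
  have d: "discriminant a \<phi> = (a$1 + s * a$2 + t * a$3 + u * a$4)\<^sup>2" for a
    unfolding discriminant_def \<phi>_def sum_4 angles ang[OF assms(1)] ang[OF assms(2)] ang[OF assms(3)]
    by (simp add: algebra_simps)
  define r :: real where "r = (if s = 1 then 1/2 else 1/4)"
  have "r \<notin> \<int>" unfolding r_def by (auto elim!: Ints_cases simp: field_simps)
  moreover have "r \<in> \<rat>" "ang s = 2 * pi * r" unfolding r_def ang_def by auto
  ultimately obtain K where "approaching K (differences \<phi>)"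
    unfolding \<phi>_def using approaching_angles by blast
  from discriminants_agree[OF this]
  show "(\<alpha>$1 + s * \<alpha>$2 + t * \<alpha>$3 + u * \<alpha>$4)\<^sup>2 = (\<beta>$1 + s * \<beta>$2 + t * \<beta>$3 + u * \<beta>$4)\<^sup>2"
    and "\<beta>$1 + s * \<beta>$2 + t * \<beta>$3 + u * \<beta>$4 \<noteq> 0 \<Longrightarrow> total \<alpha> = total \<beta>"
    unfolding d by auto
qed

lemma totals_agree:
  assumes "\<beta> $ 1 \<noteq> 0"
  shows "total \<alpha> = total \<beta>"
  using assms signed_sums_agree(2)[of 1 1 1] signed_sums_agree(2)[of "-1" "-1" "-1"]
  by fastforce

lemma products_agree:
  "\<alpha>$1 * \<alpha>$2 = \<beta>$1 * \<beta>$2" "\<alpha>$1 * \<alpha>$3 = \<beta>$1 * \<beta>$3" "\<alpha>$1 * \<alpha>$4 = \<beta>$1 * \<beta>$4" "\<alpha>$2 * \<alpha>$3 = \<beta>$2 * \<beta>$3"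
proof -
  note e = signed_sums_agree(1)[of 1 1 1] signed_sums_agree(1)[of 1 1 "-1"] signed_sums_agree(1)[of 1 "-1" 1]
    signed_sums_agree(1)[of 1 "-1" "-1"] signed_sums_agree(1)[of "-1" 1 1] signed_sums_agree(1)[of "-1" 1 "-1"]
    signed_sums_agree(1)[of "-1" "-1" 1] signed_sums_agree(1)[of "-1" "-1" "-1"]
  \<comment> \<open>Orthogonality of the characters of the group of signs.\<close>
  have id: "16 * (a1 * a2) = (a1 + 1 * a2 + 1 * a3 + 1 * a4)\<^sup>2 + (a1 + 1 * a2 + 1 * a3 + - 1 * a4)\<^sup>2
      + (a1 + 1 * a2 + - 1 * a3 + 1 * a4)\<^sup>2 + (a1 + 1 * a2 + - 1 * a3 + - 1 * a4)\<^sup>2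
      - (a1 + - 1 * a2 + 1 * a3 + 1 * a4)\<^sup>2 - (a1 + - 1 * a2 + 1 * a3 + - 1 * a4)\<^sup>2
      - (a1 + - 1 * a2 + - 1 * a3 + 1 * a4)\<^sup>2 - (a1 + - 1 * a2 + - 1 * a3 + - 1 * a4)\<^sup>2"
    "16 * (a1 * a3) = (a1 + 1 * a2 + 1 * a3 + 1 * a4)\<^sup>2 + (a1 + 1 * a2 + 1 * a3 + - 1 * a4)\<^sup>2
      - (a1 + 1 * a2 + - 1 * a3 + 1 * a4)\<^sup>2 - (a1 + 1 * a2 + - 1 * a3 + - 1 * a4)\<^sup>2
      + (a1 + - 1 * a2 + 1 * a3 + 1 * a4)\<^sup>2 + (a1 + - 1 * a2 + 1 * a3 + - 1 * a4)\<^sup>2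
      - (a1 + - 1 * a2 + - 1 * a3 + 1 * a4)\<^sup>2 - (a1 + - 1 * a2 + - 1 * a3 + - 1 * a4)\<^sup>2"
    "16 * (a1 * a4) = (a1 + 1 * a2 + 1 * a3 + 1 * a4)\<^sup>2 - (a1 + 1 * a2 + 1 * a3 + - 1 * a4)\<^sup>2
      + (a1 + 1 * a2 + - 1 * a3 + 1 * a4)\<^sup>2 - (a1 + 1 * a2 + - 1 * a3 + - 1 * a4)\<^sup>2
      + (a1 + - 1 * a2 + 1 * a3 + 1 * a4)\<^sup>2 - (a1 + - 1 * a2 + 1 * a3 + - 1 * a4)\<^sup>2
      + (a1 + - 1 * a2 + - 1 * a3 + 1 * a4)\<^sup>2 - (a1 + - 1 * a2 + - 1 * a3 + - 1 * a4)\<^sup>2"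
    "16 * (a2 * a3) = (a1 + 1 * a2 + 1 * a3 + 1 * a4)\<^sup>2 + (a1 + 1 * a2 + 1 * a3 + - 1 * a4)\<^sup>2
      - (a1 + 1 * a2 + - 1 * a3 + 1 * a4)\<^sup>2 - (a1 + 1 * a2 + - 1 * a3 + - 1 * a4)\<^sup>2
      - (a1 + - 1 * a2 + 1 * a3 + 1 * a4)\<^sup>2 - (a1 + - 1 * a2 + 1 * a3 + - 1 * a4)\<^sup>2
      + (a1 + - 1 * a2 + - 1 * a3 + 1 * a4)\<^sup>2 + (a1 + - 1 * a2 + - 1 * a3 + - 1 * a4)\<^sup>2"
    for a1 a2 a3 a4 :: real
    by algebra+
  have "16 * (\<alpha>$1 * \<alpha>$2) = 16 * (\<beta>$1 * \<beta>$2)"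
    unfolding id(1)[of "\<alpha>$1" "\<alpha>$2" "\<alpha>$3" "\<alpha>$4"] id(1)[of "\<beta>$1" "\<beta>$2" "\<beta>$3" "\<beta>$4"] using e by simp
  moreover have "16 * (\<alpha>$1 * \<alpha>$3) = 16 * (\<beta>$1 * \<beta>$3)"
    unfolding id(2)[of "\<alpha>$1" "\<alpha>$3" "\<alpha>$2" "\<alpha>$4"] id(2)[of "\<beta>$1" "\<beta>$3" "\<beta>$2" "\<beta>$4"] using e by simp
  moreover have "16 * (\<alpha>$1 * \<alpha>$4) = 16 * (\<beta>$1 * \<beta>$4)"
    unfolding id(3)[of "\<alpha>$1" "\<alpha>$4" "\<alpha>$2" "\<alpha>$3"] id(3)[of "\<beta>$1" "\<beta>$4" "\<beta>$2" "\<beta>$3"] using e by simp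
  moreover have "16 * (\<alpha>$2 * \<alpha>$3) = 16 * (\<beta>$2 * \<beta>$3)"
    unfolding id(4)[of "\<alpha>$2" "\<alpha>$3" "\<alpha>$1" "\<alpha>$4"] id(4)[of "\<beta>$2" "\<beta>$3" "\<beta>$1" "\<beta>$4"] using e by simp
  ultimately show "\<alpha>$1 * \<alpha>$2 = \<beta>$1 * \<beta>$2" "\<alpha>$1 * \<alpha>$3 = \<beta>$1 * \<beta>$3"
    "\<alpha>$1 * \<alpha>$4 = \<beta>$1 * \<beta>$4" "\<alpha>$2 * \<alpha>$3 = \<beta>$2 * \<beta>$3" by simp_all
qed

text \<open>
  The products determine the first coupling up to sign, as \<open>\<alpha>\<^sub>1\<^sup>2 = (\<alpha>\<^sub>1 \<alpha>\<^sub>2) (\<alpha>\<^sub>1 \<alpha>\<^sub>3) / (\<alpha>\<^sub>2 \<alpha>\<^sub>3)\<close>, and then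
  the others.
\<close>

lemma equal_or_opposite:
  assumes "\<forall>k. \<alpha> $ k \<noteq> 0"
  shows "\<alpha> = \<beta> \<or> \<alpha> = - \<beta>"
proof -
  have "\<alpha>$1 * \<alpha>$1 * (\<alpha>$2 * \<alpha>$3) = \<beta>$1 * \<beta>$1 * (\<alpha>$2 * \<alpha>$3)"
    using products_agree by algebra
  then have "(\<alpha>$1)\<^sup>2 = (\<beta>$1)\<^sup>2" using assms by (simp add: power2_eq_square)
  then consider "\<beta>$1 = \<alpha>$1" | "\<beta>$1 = - \<alpha>$1" by (auto simp: power2_eq_iff)
  then show ?thesis
  proof cases
    case 1
    then have "\<forall>k. \<alpha> $ k = \<beta> $ k" using products_agree assms unfolding forall_4 by simp
    then show ?thesis by (simp add: vec_eq_iff)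
  next
    case 2
    have "\<alpha>$1 * (\<alpha>$2 + \<beta>$2) = 0" "\<alpha>$1 * (\<alpha>$3 + \<beta>$3) = 0" "\<alpha>$1 * (\<alpha>$4 + \<beta>$4) = 0"
      using products_agree 2 by algebra+
    then have "\<alpha>$2 + \<beta>$2 = 0" "\<alpha>$3 + \<beta>$3 = 0" "\<alpha>$4 + \<beta>$4 = 0"
      using assms by simp_all
    then have "\<forall>k. \<alpha> $ k = (- \<beta>) $ k"
      unfolding forall_4[of "\<lambda>k. \<alpha> $ k = (- \<beta>) $ k"] using 2 by (simp add: eq_neg_iff_add_eq_0)
    then show ?thesis by (simp add: vec_eq_iff)
  qed
qed

text \<open>
  For opposite couplings of total zero the secular functions differ only in their cubic terms, which therefore
  vanish at the common zeros. The root used is the positive one.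
\<close>

lemma triple_term_vanishes:
  assumes opp: "\<alpha> = - \<beta>" and tot: "total \<beta> = 0" and K: "approaching K (differences \<phi>)" and pos: "discriminant \<beta> \<phi> \<noteq> 0"
  shows "triple_term \<beta> (differences \<phi>) = 0"
proof (rule limit_vanishes_at_simple_root[OF K, of "sqrt (discriminant \<beta> \<phi>) / 2"])
  have "discriminant \<beta> \<phi> \<ge> 0" by (simp add: discriminant_def)
  then show "- (sqrt (discriminant \<beta> \<phi>) / 2)\<^sup>2 + total \<beta> * (sqrt (discriminant \<beta> \<phi>) / 2) + pair_term \<beta> (differences \<phi>) = 0"
    using tot discriminant_eq[of \<beta> \<phi>] by (simp add: power_divide)
  show "2 * (sqrt (discriminant \<beta> \<phi>) / 2) \<noteq> total \<beta>" using tot pos by simp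
  show "((\<lambda>p. triple_term \<beta> (phases (perturbed K p))) \<longlongrightarrow> triple_term \<beta> (differences \<phi>))
      (sequentially \<times>\<^sub>F nhds (sqrt (discriminant \<beta> \<phi>) / 2))"
    by (intro tendsto_terms approaching_limits(2)[OF K])
  fix k :: real assume k: "k \<noteq> 0" and "secular \<beta> k = 0"
  then have "secular \<alpha> k - secular \<beta> k = 0" using zeros by simp
  moreover have "total (- \<beta>) = - total \<beta>" "pair_term (- \<beta>) x = pair_term \<beta> x"
    "triple_term (- \<beta>) x = - triple_term \<beta> x" "quadruple_term (- \<beta>) x = quadruple_term \<beta> x" for x
    by (simp_all add: total_def pair_term_def triple_term_def quadruple_term_def)
  ultimately have "2 * (triple_term \<beta> (phases k) / k) = 0"
    using tot unfolding secular_def opp by simp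
  then show "triple_term \<beta> (phases k) = 0" using k by simp
qed

text \<open>
  In the first choice of angles, vertices \<open>3\<close> and \<open>4\<close> have the same angle, so the cubic terms without one of
  them survive with equal weights and the others contain a vanishing sine. The discriminant is then at least
  \<open>(\<beta>\<^sub>3 + \<beta>\<^sub>4)\<^sup>2\<close>, so it is nonzero unless the claim holds. The second choice treats vertices \<open>2\<close> and
  \<open>3\<close> in the same way.
\<close>

lemma opposite_imp_alternating:
  assumes opp: "\<alpha> = - \<beta>" and nz: "\<forall>k. \<beta> $ k \<noteq> 0"
  shows "\<beta> $ 2 = - \<beta> $ 1 \<and> \<beta> $ 3 = \<beta> $ 1 \<and> \<beta> $ 4 = - \<beta> $ 1"
proof -
  have tot: "total \<beta> = 0"
    using totals_agree nz opp by (simp add: total_def)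
  have r: "pi / 2 = 2 * pi * (1 / 4)" "(1 / 4 :: real) \<in> \<rat>" "(1 / 4 :: real) \<notin> \<int>"
    "pi / 4 = 2 * pi * (1 / 8)" "(1 / 8 :: real) \<in> \<rat>" "(1 / 8 :: real) \<notin> \<int>"
    by (auto elim!: Ints_cases simp: field_simps)
  have sq: "sqrt 2 * (sqrt 2 * x) = 2 * x" for x :: real
    by (simp add: mult.assoc[symmetric])
  have 34: "\<beta> $ 3 + \<beta> $ 4 = 0"
  proof (rule ccontr)
    assume neq: "\<beta> $ 3 + \<beta> $ 4 \<noteq> 0"
    let ?\<phi> = "angles (pi / 2) (pi / 4) (pi / 4)"
    have "discriminant \<beta> ?\<phi> = (\<beta> $ 1 - \<beta> $ 2)\<^sup>2 + (\<beta> $ 3 + \<beta> $ 4)\<^sup>2"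
      unfolding discriminant_def sum_4 angles by (simp add: algebra_simps)
    then have "discriminant \<beta> ?\<phi> \<noteq> 0" using neq by (simp add: sum_power2_eq_zero_iff)
    moreover obtain K where "approaching K (differences ?\<phi>)"
      using approaching_angles r(1-3) by blast
    ultimately have "triple_term \<beta> (differences ?\<phi>) = 0"
      using triple_term_vanishes[OF opp tot] by blast
    moreover have "differences ?\<phi> 1 = pi / 2" "differences ?\<phi> 2 = - (pi / 4)" "differences ?\<phi> 3 = 0" "differences ?\<phi> 4 = - (pi / 4)"
      unfolding differences_def four_cycle angles by simp_all
    ultimately have "\<beta> $ 1 * \<beta> $ 2 * (\<beta> $ 3 + \<beta> $ 4) = 0"
      by (simp add: triple_term_def sin_45 sq algebra_simps)
    then show False using nz neq by simp
  qed
  have 23: "\<beta> $ 2 + \<beta> $ 3 = 0"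
  proof (rule ccontr)
    assume neq: "\<beta> $ 2 + \<beta> $ 3 \<noteq> 0"
    let ?\<phi> = "angles (pi / 4) (pi / 4) (pi / 2)"
    have "discriminant \<beta> ?\<phi> = (\<beta> $ 1 - \<beta> $ 4)\<^sup>2 + (\<beta> $ 2 + \<beta> $ 3)\<^sup>2"
      unfolding discriminant_def sum_4 angles by (simp add: algebra_simps)
    then have "discriminant \<beta> ?\<phi> \<noteq> 0" using neq by (simp add: sum_power2_eq_zero_iff)
    moreover obtain K where "approaching K (differences ?\<phi>)"
      using approaching_angles r(4-6) by blast
    ultimately have "triple_term \<beta> (differences ?\<phi>) = 0"
      using triple_term_vanishes[OF opp tot] by blast
    moreover have "differences ?\<phi> 1 = pi / 4" "differences ?\<phi> 2 = 0" "differences ?\<phi> 3 = pi / 4" "differences ?\<phi> 4 = - (pi / 2)"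
      unfolding differences_def four_cycle angles by simp_all
    ultimately have "\<beta> $ 1 * \<beta> $ 4 * (\<beta> $ 2 + \<beta> $ 3) = 0"
      by (simp add: triple_term_def sin_45 sq algebra_simps)
    then show False using nz neq by simp
  qed
  show ?thesis using tot 34 23 unfolding total_def by auto
qed

end

end

section \<open>The isospectrality theorem\<close>

lemma vector_4_nth:
  "(vector [a, b, c, d] :: 'a::zero^4) $ 1 = a" "(vector [a, b, c, d] :: 'a^4) $ 2 = b"
  "(vector [a, b, c, d] :: 'a^4) $ 3 = c" "(vector [a, b, c, d] :: 'a^4) $ 4 = d"
  unfolding vector_def by simp_all

theorem proposition5p3:
  fixes G :: "(4, 4) metric_graph"
  assumes "metric_C4 G"
    and "rationally_independent (edge_length G)"
  shows "(\<forall>\<alpha> \<beta> :: real^4.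
            (\<forall>k. \<alpha> $ k \<noteq> 0) \<longrightarrow> (\<forall>k. \<beta> $ k \<noteq> 0) \<longrightarrow>
            isospectral G (graph_laplacian G \<alpha>) (graph_laplacian G \<beta>) \<longrightarrow>
            \<alpha> = \<beta> \<or> (\<exists>a. \<alpha> = vector [a, -a, a, -a] \<and> \<beta> = vector [-a, a, -a, a]))
       \<and> (\<forall>(\<alpha> :: real^4) (\<beta> :: real^4) a.
            \<alpha> = vector [a, -a, a, -a] \<and> \<beta> = vector [-a, a, -a, a] \<longrightarrow>
            isospectral G (graph_laplacian G \<alpha>) (graph_laplacian G \<beta>))"
proof -
  interpret independent_cycle G
    by unfold_locales (use assms in auto)
  have vec4: "x = vector [p, q, r, s] \<longleftrightarrow> x $ 1 = p \<and> x $ 2 = q \<and> x $ 3 = r \<and> x $ 4 = s" for x :: "real^4" and p q r s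
    unfolding vec_eq_iff forall_4[of "\<lambda>k. x $ k = _ k"] vector_4_nth ..
  show ?thesis
  proof (intro conjI allI impI)
    fix \<alpha> \<beta> :: "real^4"
    assume \<alpha>: "\<forall>k. \<alpha> $ k \<noteq> 0" and \<beta>: "\<forall>k. \<beta> $ k \<noteq> 0"
      and iso: "isospectral G (graph_laplacian G \<alpha>) (graph_laplacian G \<beta>)"
    have zeros: "secular \<alpha> k = 0 \<longleftrightarrow> secular \<beta> k = 0" if "k \<noteq> 0" for k
      using iso unfolding isospectral_def by (simp add: secular_iff[OF that, symmetric])
    have "\<alpha> = \<beta> \<or> \<alpha> = - \<beta>" by (rule equal_or_opposite[OF zeros \<alpha>])
    then show "\<alpha> = \<beta> \<or> (\<exists>a. \<alpha> = vector [a, -a, a, -a] \<and> \<beta> = vector [-a, a, -a, a])"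
    proof
      assume opp: "\<alpha> = - \<beta>"
      from opposite_imp_alternating[OF zeros opp \<beta>]
      \<comment> \<open>The parameter is the first coupling of \<open>\<alpha>\<close>.\<close>
      have "\<alpha> = vector [- \<beta> $ 1, - (- \<beta> $ 1), - \<beta> $ 1, - (- \<beta> $ 1)]"
        "\<beta> = vector [- (- \<beta> $ 1), - \<beta> $ 1, - (- \<beta> $ 1), - \<beta> $ 1]"
        unfolding vec4 opp by simp_all
      then show ?thesis by blast
    qed simp
  next
    fix \<alpha> \<beta> :: "real^4" and a
    assume ab: "\<alpha> = vector [a, -a, a, -a] \<and> \<beta> = vector [-a, a, -a, a]"
    then have "\<forall>k. \<beta> $ k = (- \<alpha>) $ k"
      unfolding forall_4[of "\<lambda>k. \<beta> $ k = (- \<alpha>) $ k"] by (simp add: vector_4_nth)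
    then have "\<beta> = - \<alpha>" unfolding vec_eq_iff .
    moreover have "edge_length G 1 + edge_length G 3 \<noteq> edge_length G 2 + edge_length G 4"
      using independent_int[of 1 "-1" 1 "-1"] by auto
    ultimately show "isospectral G (graph_laplacian G \<alpha>) (graph_laplacian G \<beta>)"
      using ab isospectral_alternating[of \<alpha>] by (simp add: vector_4_nth)
  qed
qed

end
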